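(* There is a $U_v$-module decomposition $$\widetilde{\mathcal Q}_v(n,r)=\bigoplus_{\mu\in\Lambda(n,r)}\widetilde{\mathcal Q}_v(n,r)^{\mu},$$ where each $\widetilde{\mathcal Q}_v(n,r)^{\mu}=\mathrm{span}\{\Phi_{A^\star}: A^\star\in M_n(\mathbb N|\mathbb Z_2)_r,\ \mathrm{co}(A)=\mu\}$ is a submodule. Furthermore, each submodule $\widetilde{\mathcal Q}_v(n,r)^{\mu}$ has a weight space decomposition $$\widetilde{\mathcal Q}_v(n,r)^{\mu}=\bigoplus_{\lambda\in\Lambda(n,r)}\widetilde{\mathcal Q}_v(n,r)^{\mu}_{\lambda},$$ where $\widetilde{\mathcal Q}_v(n,r)^{\mu}_{\lambda}=\mathrm{span}\{\Phi_{A^\star}: A^\star\in M_n(\mathbb N|\mathbb Z_2)_r,\ \mathrm{ro}(A)=\lambda,\ \mathrm{co}(A)=\mu\}$ is the weight space of weight $\lambda$ (i.e. of weight $v^\lambda=(v^{\lambda_1},\dots,v^{\lambda_n})$).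
   Context: Standing assumption: $n,r\ge2$ are integers. Ground field $\mathbb Q(v)$, $v$ an indeterminate, $q=v^2$; $\mathbb N=\{0,1,2,\dots\}$; $\Lambda(n,r)=\{\lambda\in\mathbb N^n:\sum_i\lambda_i=r\}$. $E_{a,b}$ are the $n\times n$ matrix units, $O$ is the zero matrix. Hecke–Clifford superalgebra $\mathcal H^c_r$: the $\mathbb Q(v)$-superalgebra with even generators $T_1,\dots,T_{r-1}$, odd generators $c_1,\dots,c_r$ and relations $(T_i-q)(T_i+1)=0$; $T_iT_j=T_jT_i$ for $|i-j|>1$; $T_iT_{i+1}T_i=T_{i+1}T_iT_{i+1}$; $c_i^2=-1$; $c_ic_j=-c_jc_i$ for $i\ne j$; $T_ic_j=c_jT_i$ for $j\ne i,i+1$; $T_ic_i=c_{i+1}T_i$; $T_ic_{i+1}=c_iT_i-(q-1)(c_i-c_{i+1})$. For $w\in\mathfrak S_r$ with reduced expression $s_{i_1}\cdots s_{i_k}$ put $T_w=T_{i_1}\cdots T_{i_k}$. For a composition $\lambda$ of $r$, $\mathfrak S_\lambda$ is the standard Young subgroup, $x_\lambda=\sum_{w\in\mathfrak S_\lambda}T_w$, $\tilde\lambda_k=\lambda_1+\cdots+\lambda_k$. Put $c_{q,i,j}=\sum_{t=i}^{j}q^{j-t}c_t$ and, for a composition $\lambda$ with $N$ parts and $\alpha\in\{0,1\}^N$, $c_\lambda^\alpha=(c_{q,1,\tilde\lambda_1})^{\alpha_1}(c_{q,\tilde\lambda_1+1,\tilde\lambda_2})^{\alpha_2}\cdots(c_{q,\tilde\lambda_{N-1}+1,\tilde\lambda_N})^{\alpha_N}$.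 $M_n(\mathbb N|\mathbb Z_2)_r$ is the set of pairs $A^\star=(A^{\bar0}|A^{\bar1})$ with $A^{\bar0}=(a^{\bar0}_{i,j})\in M_n(\mathbb N)$, $A^{\bar1}=(a^{\bar1}_{i,j})\in M_n(\{0,1\})$, such that $A=A^{\bar0}+A^{\bar1}=(a_{i,j})$ has entry sum $r$. Parity: $p(A^\star)=\sum a^{\bar1}_{i,j}\bmod 2$. $\mathrm{ro}(A),\mathrm{co}(A)\in\Lambda(n,r)$ are the vectors of row sums and column sums of $A$. Put $\nu_A=(a_{1,1},\dots,a_{n,1},\dots,a_{1,n},\dots,a_{n,n})$, $\nu_{A^{\bar1}}$ the same reading of $A^{\bar1}$, $c_{A^\star}=c_{\nu_A}^{\nu_{A^{\bar1}}}$. With $\lambda=\mathrm{ro}(A)$, $\mu=\mathrm{co}(A)$, let $d_A\in\mathfrak S_r$ be the shortest element of the double coset $\mathfrak S_\lambda d_A\mathfrak S_\mu$ determined by $|R^\lambda_i\cap d_A(R^\mu_j)|=a_{i,j}$, where $R^\lambda_i=\{\tilde\lambda_{i-1}+1,\dots,\tilde\lambda_i\}$; let $\mathcal D_{\nu}$ be the set of shortest representatives of the right cosets $\mathfrak S_\nu w$ in $\mathfrak S_r$. Put $T_{A^\star}=x_\lambda T_{d_A}c_{A^\star}\sum_{\sigma\in\mathcal D_{\nu_A}\cap\mathfrak S_\mu}T_\sigma$. Twisted queer $q$-Schur superalgebra: $\widetilde{\mathcal Q}_v(n,r)=\mathrm{End}^s_{\mathcal H^c_r}\big(\bigoplus_{\lambda\in\Lambda(n,r)}x_\lambda\mathcal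 H^c_r\big)$, the superalgebra (under composition) spanned by homogeneous linear maps $f$ with $f(mh)=(-1)^{p(f)p(h)}f(m)h$ for homogeneous $h$. It has the $\mathbb Q(v)$-basis $\{\Phi_{A^\star}: A^\star\in M_n(\mathbb N|\mathbb Z_2)_r\}$, where $\Phi_{A^\star}(x_\mu w)=(-1)^{p(A^\star)p(w)}\delta_{\mu,\mathrm{co}(A)}T_{A^\star}w$. Put $[A^\star]=v^{-\partial(A^\star)}\Phi_{A^\star}$, $\partial(A^\star)=\sum_{i\ge k,\,j<l}a_{i,j}a_{k,l}+\sum_{i,j}a^{\bar1}_{i,j}a^{\bar0}_{i,j}$. $U_v$-action: $U_v=U_v(\mathfrak q_n)$ is the quantum queer superalgebra, with even generators $\mathsf K_i^{\pm1},\mathsf E_j,\mathsf F_j$ and odd generators $\mathsf K_{\bar i},\mathsf E_{\bar j},\mathsf F_{\bar j}$ ($1\le i\le n$, $1\le j\le n-1$). It acts on $\widetilde{\mathcal Q}_v(n,r)$ by left multiplication through the superalgebra homomorphism $U_v\to\widetilde{\mathcal Q}_v(n,r)$ with $\mathsf K_i^{\pm1}\mapsto\sum_{\lambda\in\Lambda(n,r)}v^{\pm\lambda_i}[\mathrm{diag}(\lambda)|O]$ and, with all sums over $\lambda\in\Lambda(n,r-1)$, $\mathsf K_{\bar i}\mapsto\sum[\mathrm{diag}(\lambda)|E_{i,i}]$, $\mathsf E_j\mapsto\sum[\mathrm{diag}(\lambda)+E_{j,j+1}|O]$, $\mathsf E_{\bar j}\mapsto\sum[\mathrm{diag}(\lambda)|E_{j,j+1}]$,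 $\mathsf F_j\mapsto\sum[\mathrm{diag}(\lambda)+E_{j+1,j}|O]$, $\mathsf F_{\bar j}\mapsto\sum[\mathrm{diag}(\lambda)|E_{j+1,j}]$. Thus a $U_v$-submodule of $\widetilde{\mathcal Q}_v(n,r)$ is a subspace stable under left multiplication by all these elements. The weight space of weight $\gamma\in(\mathbb Q(v)\setminus\{0\})^n$ in a $U_v$-module $M$ is $M_\gamma=\{m\in M:\mathsf K_im=\gamma_im\ \text{for all }1\le i\le n\}$. *)

theory Defs
  imports
    "HOL-Library.Poly_Mapping"
    "HOL-Library.Function_Algebras"
    "HOL-Library.FuncSet"
    "HOL-Library.Cardinality"
    "HOL-Computational_Algebra.Computational_Algebra"
    "HOL-Combinatorics.Permutations"
    "Jordan_Normal_Form.Matrix"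
begin

section \<open>The ground field\<close>

type_synonym qv = "rat poly fract"

definition vv :: qv where
  "vv = Fract [:0, 1:] 1"

definition qq :: qv where
  "qq = vv\<^sup>2"


section \<open>The Hecke--Clifford superalgebra\<close>

text \<open>
  The free algebra on symbols \<open>T\<^sub>i\<close>, \<open>c\<^sub>i\<close> is the monoid algebra of the free monoid of words,
  written additively so that the convolution product of finitely supported functions
  from theory \<open>Poly_Mapping\<close> applies.
\<close>

datatype hc_gen = GenT nat | GenC nat

datatype hc_word = Word (letters: "hc_gen list")

instantiation hc_word :: monoid_add
begin

definition "0 = Word []"

definition "x + y = Word (letters x @ letters y)"

instance
  by standard (auto simp: zero_hc_word_def plus_hc_word_def)

end

type_synonym hc_free = "hc_word \<Rightarrow>\<^sub>0 qv"

definition free_scalar :: "qv \<Rightarrow> hc_free" where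
  "free_scalar a = Poly_Mapping.single 0 a"

definition free_T :: "nat \<Rightarrow> hc_free" where
  "free_T i = Poly_Mapping.single (Word [GenT i]) 1"

definition free_c :: "nat \<Rightarrow> hc_free" where
  "free_c i = Poly_Mapping.single (Word [GenC i]) 1"

text \<open>
  The generators are \<open>T\<^sub>1, \<dots>, T\<^bsub>r-1\<^esub>\<close> and \<open>c\<^sub>1, \<dots>, c\<^sub>r\<close>. The type \<^typ>\<open>hc_gen\<close> has symbols for all
  natural indices; the superfluous ones are eliminated from the presentation by the
  relations \<open>no_T\<close> and \<open>no_c\<close>. In each rule the indices of all occurring generators are in range.
\<close>

inductive_set hc_relators :: "nat \<Rightarrow> hc_free set" for r :: nat where
  no_T: "i \<notin> {1..<r} \<Longrightarrow> free_T i \<in> hc_relators r"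
| no_c: "i \<notin> {1..r} \<Longrightarrow> free_c i \<in> hc_relators r"
| T_quadratic: "i \<in> {1..<r} \<Longrightarrow>
    (free_T i - free_scalar qq) * (free_T i + 1) \<in> hc_relators r"
| T_commute: "i \<in> {1..<r} \<Longrightarrow> j \<in> {1..<r} \<Longrightarrow> \<bar>int i - int j\<bar> > 1 \<Longrightarrow>
    free_T i * free_T j - free_T j * free_T i \<in> hc_relators r"
| T_braid: "i \<in> {1..<r} \<Longrightarrow> i + 1 \<in> {1..<r} \<Longrightarrow>
    free_T i * free_T (i + 1) * free_T i - free_T (i + 1) * free_T i * free_T (i + 1)
      \<in> hc_relators r"
| c_square: "i \<in> {1..r} \<Longrightarrow> free_c i * free_c i + 1 \<in> hc_relators r"
| c_anticommute: "i \<in> {1..r} \<Longrightarrow> j \<in> {1..r} \<Longrightarrow> i \<noteq> j \<Longrightarrow>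
    free_c i * free_c j + free_c j * free_c i \<in> hc_relators r"
| T_c_commute: "i \<in> {1..<r} \<Longrightarrow> j \<in> {1..r} \<Longrightarrow> j \<noteq> i \<Longrightarrow> j \<noteq> i + 1 \<Longrightarrow>
    free_T i * free_c j - free_c j * free_T i \<in> hc_relators r"
| T_c_same: "i \<in> {1..<r} \<Longrightarrow>
    free_T i * free_c i - free_c (i + 1) * free_T i \<in> hc_relators r"
| T_c_next: "i \<in> {1..<r} \<Longrightarrow>
    free_T i * free_c (i + 1)
      - (free_c i * free_T i - free_scalar (qq - 1) * (free_c i - free_c (i + 1)))
      \<in> hc_relators r"

inductive_set hc_ideal :: "nat \<Rightarrow> hc_free set" for r :: nat where
  relator: "x \<in> hc_relators r \<Longrightarrow> x \<in> hc_ideal r"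
| zero: "0 \<in> hc_ideal r"
| add: "x \<in> hc_ideal r \<Longrightarrow> y \<in> hc_ideal r \<Longrightarrow> x + y \<in> hc_ideal r"
| mult_left: "x \<in> hc_ideal r \<Longrightarrow> a * x \<in> hc_ideal r"
| mult_right: "x \<in> hc_ideal r \<Longrightarrow> x * a \<in> hc_ideal r"

lemma hc_ideal_uminus: "x \<in> hc_ideal r \<Longrightarrow> - x \<in> hc_ideal r"
  using hc_ideal.mult_left[of x r "-1"] by simp

lemma hc_ideal_diff: "x \<in> hc_ideal r \<Longrightarrow> y \<in> hc_ideal r \<Longrightarrow> x - y \<in> hc_ideal r"
  using hc_ideal.add[OF _ hc_ideal_uminus, of x r y] by simp

text \<open>The rank \<open>r\<close> is the cardinality of the index type.\<close>

quotient_type 'r hc = hc_free / "\<lambda>x y. x - y \<in> hc_ideal CARD('r)"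
proof (rule equivpI)
  show "reflp (\<lambda>x y. x - y \<in> hc_ideal CARD('r))"
    by (rule reflpI) (simp add: hc_ideal.zero)
  show "symp (\<lambda>x y. x - y \<in> hc_ideal CARD('r))"
  proof (rule sympI)
    fix x y assume "x - y \<in> hc_ideal CARD('r)"
    from hc_ideal_uminus[OF this] show "y - x \<in> hc_ideal CARD('r)" by simp
  qed
  show "transp (\<lambda>x y. x - y \<in> hc_ideal CARD('r))"
  proof (rule transpI)
    fix x y z assume "x - y \<in> hc_ideal CARD('r)" "y - z \<in> hc_ideal CARD('r)"
    from hc_ideal.add[OF this] show "x - z \<in> hc_ideal CARD('r)" by simp
  qed
qed

instantiation hc :: (type) "{ring, monoid_mult}"
begin

lift_definition zero_hc :: "'a hc" is 0 .

lift_definition one_hc :: "'a hc" is 1 .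

lift_definition uminus_hc :: "'a hc \<Rightarrow> 'a hc" is uminus
proof -
  fix x y :: hc_free
  assume "x - y \<in> hc_ideal CARD('a)"
  from hc_ideal_uminus[OF this] show "- x - - y \<in> hc_ideal CARD('a)" by simp
qed

lift_definition plus_hc :: "'a hc \<Rightarrow> 'a hc \<Rightarrow> 'a hc" is "(+)"
proof -
  fix x x' y y' :: hc_free
  assume "x - x' \<in> hc_ideal CARD('a)" "y - y' \<in> hc_ideal CARD('a)"
  from hc_ideal.add[OF this] show "x + y - (x' + y') \<in> hc_ideal CARD('a)"
    by (simp add: add_diff_add)
qed

lift_definition minus_hc :: "'a hc \<Rightarrow> 'a hc \<Rightarrow> 'a hc" is "(-)"
proof -
  fix x x' y y' :: hc_free
  assume "x - x' \<in> hc_ideal CARD('a)" "y - y' \<in> hc_ideal CARD('a)"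
  then have "(x - x') - (y - y') \<in> hc_ideal CARD('a)"
    by (rule hc_ideal_diff)
  moreover have "(x - x') - (y - y') = x - y - (x' - y')"
    by (simp add: algebra_simps)
  ultimately show "x - y - (x' - y') \<in> hc_ideal CARD('a)"
    by (simp only:)
qed

lift_definition times_hc :: "'a hc \<Rightarrow> 'a hc \<Rightarrow> 'a hc" is "(*)"
proof -
  fix x x' y y' :: hc_free
  assume "x - x' \<in> hc_ideal CARD('a)" "y - y' \<in> hc_ideal CARD('a)"
  then have "(x - x') * y + x' * (y - y') \<in> hc_ideal CARD('a)"
    by (intro hc_ideal.add hc_ideal.mult_left hc_ideal.mult_right)
  moreover have "(x - x') * y + x' * (y - y') = x * y - x' * y'"
    by (simp add: left_diff_distrib right_diff_distrib)
  ultimately show "x * y - x' * y' \<in> hc_ideal CARD('a)"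
    by (simp only:)
qed

instance
proof
  fix a b c :: "'a hc"
  show "a * b * c = a * (b * c)" by transfer (simp add: mult.assoc hc_ideal.zero)
  show "a + b + c = a + (b + c)" by transfer (simp add: add.assoc hc_ideal.zero)
  show "a + b = b + a" by transfer (simp add: add.commute hc_ideal.zero)
  show "0 + a = a" by transfer (simp add: hc_ideal.zero)
  show "- a + a = 0" by transfer (simp add: hc_ideal.zero)
  show "a - b = a + - b" by transfer (simp add: hc_ideal.zero)
  show "1 * a = a" by transfer (simp add: hc_ideal.zero)
  show "a * 1 = a" by transfer (simp add: hc_ideal.zero)
  show "(a + b) * c = a * c + b * c" by transfer (simp add: distrib_right hc_ideal.zero)
  show "a * (b + c) = a * b + a * c" by transfer (simp add: distrib_left hc_ideal.zero)
qed

end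

lift_definition hc_scale :: "qv \<Rightarrow> 'r hc \<Rightarrow> 'r hc" is "\<lambda>a x. free_scalar a * x"
proof -
  fix a and x y :: hc_free
  assume "x - y \<in> hc_ideal CARD('r)"
  from hc_ideal.mult_left[OF this, of "free_scalar a"]
  show "free_scalar a * x - free_scalar a * y \<in> hc_ideal CARD('r)"
    by (simp add: right_diff_distrib)
qed

lift_definition T_gen :: "nat \<Rightarrow> 'r hc" is free_T .

lift_definition c_gen :: "nat \<Rightarrow> 'r hc" is free_c .

lemma hc_vector_space: "vector_space (hc_scale :: qv \<Rightarrow> 'r hc \<Rightarrow> 'r hc)"
proof
  fix a b :: qv and x y :: "'r hc"
  show "hc_scale a (x + y) = hc_scale a x + hc_scale a y"
    by transfer (simp add: distrib_left hc_ideal.zero)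
  show "hc_scale (a + b) x = hc_scale a x + hc_scale b x"
    by transfer (simp add: distrib_right free_scalar_def Poly_Mapping.single_add hc_ideal.zero)
  show "hc_scale a (hc_scale b x) = hc_scale (a * b) x"
    by transfer (simp add: mult.assoc[symmetric] free_scalar_def Poly_Mapping.mult_single
        hc_ideal.zero)
  show "hc_scale 1 x = x"
    by transfer (simp add: free_scalar_def hc_ideal.zero)
qed

text \<open>Parities are represented by the natural numbers 0 and 1.\<close>

definition word_parity :: "hc_word \<Rightarrow> nat" where
  "word_parity w = length (filter (\<lambda>g. \<exists>i. g = GenC i) (letters w)) mod 2"

definition hc_homogeneous :: "nat \<Rightarrow> 'r hc set" where
  "hc_homogeneous p = {abs_hc x | x. \<forall>w \<in> Poly_Mapping.keys x. word_parity w = p}"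


section \<open>Symmetric groups and compositions\<close>

text \<open>
  Permutations act on \<open>{1..r}\<close> and are composed as functions. The parts of a composition, and
  likewise rows and columns of matrices, are indexed from 0.
\<close>

definition word_perm :: "nat list \<Rightarrow> nat \<Rightarrow> nat" where
  "word_perm is = foldr (\<lambda>i w. transpose i (i + 1) \<circ> w) is id"

definition perm_length :: "nat \<Rightarrow> (nat \<Rightarrow> nat) \<Rightarrow> nat" where
  "perm_length r w =
    (LEAST k. \<exists>is. set is \<subseteq> {1..<r} \<and> length is = k \<and> word_perm is = w)"

definition reduced_word :: "nat \<Rightarrow> (nat \<Rightarrow> nat) \<Rightarrow> nat list \<Rightarrow> bool" where
  "reduced_word r w is \<longleftrightarrow>
    set is \<subseteq> {1..<r} \<and> word_perm is = w \<and> length is = perm_length r w"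

text \<open>By Matsumoto's theorem the choice of the reduced expression does not matter.\<close>

definition T_perm :: "(nat \<Rightarrow> nat) \<Rightarrow> 'r hc" where
  "T_perm w = prod_list (map T_gen (SOME is. reduced_word CARD('r) w is))"

definition compositions :: "nat \<Rightarrow> nat \<Rightarrow> nat list set" where
  "compositions n r = {\<kappa>. length \<kappa> = n \<and> sum_list \<kappa> = r}"

definition block :: "nat list \<Rightarrow> nat \<Rightarrow> nat set" where
  "block \<kappa> k = {sum_list (take k \<kappa>) + 1 .. sum_list (take (Suc k) \<kappa>)}"

definition young :: "nat list \<Rightarrow> (nat \<Rightarrow> nat) set" where
  "young \<kappa> = {w. w permutes {1..sum_list \<kappa>} \<and> (\<forall>k < length \<kappa>. w ` block \<kappa> k = block \<kappa> k)}"

definition x_comp :: "nat list \<Rightarrow> 'r hc" where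
  "x_comp \<kappa> = (\<Sum>w \<in> young \<kappa>. T_perm w)"

definition right_coset_reps :: "nat \<Rightarrow> nat list \<Rightarrow> (nat \<Rightarrow> nat) set" where
  "right_coset_reps r \<nu> =
    {d. d permutes {1..r} \<and> (\<forall>w \<in> young \<nu>. perm_length r d \<le> perm_length r (w \<circ> d))}"

definition double_coset :: "nat list \<Rightarrow> (nat \<Rightarrow> nat) \<Rightarrow> nat list \<Rightarrow> (nat \<Rightarrow> nat) set" where
  "double_coset \<kappa> d \<mu> = {w \<circ> d \<circ> u | w u. w \<in> young \<kappa> \<and> u \<in> young \<mu>}"

definition c_q :: "nat \<Rightarrow> nat \<Rightarrow> 'r hc" where
  "c_q i j = (\<Sum>t = i..j. hc_scale (qq ^ (j - t)) (c_gen t))"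

definition c_comp :: "nat list \<Rightarrow> nat list \<Rightarrow> 'r hc" where
  "c_comp \<kappa> \<alpha> = prod_list (map
    (\<lambda>k. c_q (sum_list (take k \<kappa>) + 1) (sum_list (take (Suc k) \<kappa>)) ^ (\<alpha> ! k))
    [0..<length \<kappa>])"


section \<open>Matrices\<close>

text \<open>A pair \<open>(A0, A1)\<close> stands for the matrix \<open>(A0|A1)\<close> with even part \<open>A0\<close> and odd part \<open>A1\<close>.\<close>

type_synonym smat = "nat mat \<times> nat mat"

abbreviation total :: "smat \<Rightarrow> nat mat" where
  "total A \<equiv> fst A + snd A"

definition entry_sum :: "nat mat \<Rightarrow> nat" where
  "entry_sum B = (\<Sum>i < dim_row B. \<Sum>j < dim_col B. B $$ (i, j))"

definition smats :: "nat \<Rightarrow> nat \<Rightarrow> smat set" where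
  "smats n r = {A. fst A \<in> carrier_mat n n \<and> snd A \<in> carrier_mat n n \<and>
    elements_mat (snd A) \<subseteq> {0, 1} \<and> entry_sum (total A) = r}"

definition parity :: "smat \<Rightarrow> nat" where
  "parity A = entry_sum (snd A) mod 2"

definition ro :: "nat mat \<Rightarrow> nat list" where
  "ro B = map (\<lambda>i. \<Sum>j < dim_col B. B $$ (i, j)) [0..<dim_row B]"

definition co :: "nat mat \<Rightarrow> nat list" where
  "co B = map (\<lambda>j. \<Sum>i < dim_row B. B $$ (i, j)) [0..<dim_col B]"

definition nu :: "nat mat \<Rightarrow> nat list" where
  "nu B = concat (map (\<lambda>j. map (\<lambda>i. B $$ (i, j)) [0..<dim_row B]) [0..<dim_col B])"

text \<open>The shortest element of the double coset selected by the intersection numbers \<open>B\<close>.\<close>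

definition d_mat :: "nat mat \<Rightarrow> nat \<Rightarrow> nat" where
  "d_mat B = (THE d. d permutes {1..entry_sum B} \<and>
    (\<forall>i < dim_row B. \<forall>j < dim_col B.
      card (block (ro B) i \<inter> d ` block (co B) j) = B $$ (i, j)) \<and>
    (\<forall>w \<in> double_coset (ro B) d (co B).
      perm_length (entry_sum B) d \<le> perm_length (entry_sum B) w))"

definition T_mat :: "smat \<Rightarrow> 'r hc" where
  "T_mat A = x_comp (ro (total A)) * T_perm (d_mat (total A)) * c_comp (nu (total A)) (nu (snd A)) *
    (\<Sum>\<sigma> \<in> right_coset_reps CARD('r) (nu (total A)) \<inter> young (co (total A)). T_perm \<sigma>)"

definition diag :: "nat list \<Rightarrow> nat mat" where
  "diag \<kappa> = mat_diag (length \<kappa>) (\<lambda>i. \<kappa> ! i)"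

definition matrix_unit :: "nat \<Rightarrow> nat \<Rightarrow> nat \<Rightarrow> nat mat" where
  "matrix_unit n i j = mat n n (\<lambda>ab. if ab = (i, j) then 1 else 0)"

definition twist :: "smat \<Rightarrow> nat" where
  "twist A = (let n = dim_row (total A); B = total A in
    (\<Sum>(i, j, k, l) \<in> {(i, j, k, l). i < n \<and> j < n \<and> k < n \<and> l < n \<and> i \<ge> k \<and> j < l}.
      B $$ (i, j) * B $$ (k, l)) +
    (\<Sum>i < n. \<Sum>j < n. snd A $$ (i, j) * fst A $$ (i, j)))"


section \<open>The twisted queer q-Schur superalgebra\<close>

text \<open>
  An element of the direct sum of the \<open>x\<^sub>\<kappa> H\<close> is the family of its components, extended by 0
  to indices that are not compositions. A map defined on this right module is
  represented by its extension by 0 to the whole ambient type.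
\<close>

type_synonym 'r family = "nat list \<Rightarrow> 'r hc"

type_synonym 'r endo = "'r family \<Rightarrow> 'r family"

definition family_scale :: "qv \<Rightarrow> 'r family \<Rightarrow> 'r family" where
  "family_scale a m = (\<lambda>\<kappa>. hc_scale a (m \<kappa>))"

definition family_act :: "'r family \<Rightarrow> 'r hc \<Rightarrow> 'r family" where
  "family_act m h = (\<lambda>\<kappa>. m \<kappa> * h)"

definition at_comp :: "nat list \<Rightarrow> 'r hc \<Rightarrow> 'r family" where
  "at_comp \<mu> h = (\<lambda>\<kappa>. if \<kappa> = \<mu> then h else 0)"

definition perm_module :: "nat \<Rightarrow> 'r family set" where
  "perm_module n = {m. \<forall>\<kappa>. if \<kappa> \<in> compositions n CARD('r)
    then m \<kappa> \<in> range (\<lambda>h. x_comp \<kappa> * h) else m \<kappa> = 0}"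

definition module_homogeneous :: "nat \<Rightarrow> nat \<Rightarrow> 'r family set" where
  "module_homogeneous n p = {m \<in> perm_module n. \<forall>\<kappa>. m \<kappa> \<in> hc_homogeneous p}"

definition linear_maps :: "nat \<Rightarrow> 'r endo set" where
  "linear_maps n = {f. f ` perm_module n \<subseteq> perm_module n \<and>
    (\<forall>m \<in> perm_module n. \<forall>m' \<in> perm_module n. f (m + m') = f m + f m') \<and>
    (\<forall>a. \<forall>m \<in> perm_module n. f (family_scale a m) = family_scale a (f m)) \<and>
    (\<forall>m. m \<notin> perm_module n \<longrightarrow> f m = 0)}"

definition homogeneous_endos :: "nat \<Rightarrow> nat \<Rightarrow> 'r endo set" where
  "homogeneous_endos n p = {f \<in> linear_maps n.
    (\<forall>p' \<in> {0, 1}. f ` module_homogeneous n p' \<subseteq> module_homogeneous n ((p + p') mod 2)) \<and>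
    (\<forall>p' \<in> {0, 1}. \<forall>m \<in> perm_module n. \<forall>h \<in> hc_homogeneous p'.
      f (family_act m h) = family_scale ((-1) ^ (p * p')) (family_act (f m) h))}"

definition endo_scale :: "qv \<Rightarrow> 'r endo \<Rightarrow> 'r endo" where
  "endo_scale a f = (\<lambda>m. family_scale a (f m))"

global_interpretation endo: vector_space "endo_scale :: qv \<Rightarrow> 'r endo \<Rightarrow> 'r endo"
  defines endo_span = endo.span and endo_subspace = endo.subspace
proof -
  interpret hc: vector_space "hc_scale :: qv \<Rightarrow> 'r hc \<Rightarrow> 'r hc"
    by (rule hc_vector_space)
  show "vector_space (endo_scale :: qv \<Rightarrow> 'r endo \<Rightarrow> 'r endo)"
    by standard
      (auto simp: fun_eq_iff endo_scale_def family_scale_def hc.scale_right_distrib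
        hc.scale_left_distrib)
qed

definition twisted_schur :: "nat \<Rightarrow> 'r endo set" where
  "twisted_schur n = endo_span (homogeneous_endos n 0 \<union> homogeneous_endos n 1)"

text \<open>
  The module is generated by the \<open>x\<^sub>\<mu>\<close>, and every element of the algebra is a sum of
  homogeneous ones, so the formula on the \<open>x\<^sub>\<mu> w\<close> with \<open>w\<close> homogeneous determines a linear map.
\<close>

definition Phi :: "nat \<Rightarrow> smat \<Rightarrow> 'r endo" where
  "Phi n A = (THE f. f \<in> linear_maps n \<and>
    (\<forall>\<mu> \<in> compositions n CARD('r). \<forall>p \<in> {0, 1}. \<forall>w \<in> hc_homogeneous p.
      f (at_comp \<mu> (x_comp \<mu> * w)) =
        (if \<mu> = co (total A)
         then family_scale ((-1) ^ (parity A * p)) (at_comp (ro (total A)) (T_mat A * w))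
         else 0)))"

definition Phi_norm :: "nat \<Rightarrow> smat \<Rightarrow> 'r endo" where
  "Phi_norm n A = endo_scale (vv powi (- int (twist A))) (Phi n A)"


section \<open>The action of the quantum queer superalgebra\<close>

text \<open>
  The algebra acts by left multiplication with the images \<open>uv_image\<close> of its generators.
  \<open>UK s i\<close> stands for \<open>K\<^sub>i\<close> if \<open>s = 1\<close> and for its inverse if \<open>s = -1\<close>.
\<close>

datatype uv_gen = UK int nat | UKbar nat | UE nat | UEbar nat | UF nat | UFbar nat

definition uv_gens :: "nat \<Rightarrow> uv_gen set" where
  "uv_gens n = {UK s i | s i. s \<in> {1, -1} \<and> i < n} \<union> UKbar ` {..<n} \<union>
    (\<Union>j \<in> {j. j + 1 < n}. {UE j, UEbar j, UF j, UFbar j})"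

definition uv_sum :: "nat \<Rightarrow> (nat list \<Rightarrow> smat) \<Rightarrow> 'r endo" where
  "uv_sum n M = (\<Sum>\<kappa> \<in> compositions n (CARD('r) - 1). Phi_norm n (M \<kappa>))"

fun uv_image :: "nat \<Rightarrow> uv_gen \<Rightarrow> 'r endo" where
  "uv_image n (UK s i) = (\<Sum>\<kappa> \<in> compositions n CARD('r).
    endo_scale (vv powi (s * int (\<kappa> ! i))) (Phi_norm n (diag \<kappa>, 0\<^sub>m n n)))"
| "uv_image n (UKbar i) = uv_sum n (\<lambda>\<kappa>. (diag \<kappa>, matrix_unit n i i))"
| "uv_image n (UE j) = uv_sum n (\<lambda>\<kappa>. (diag \<kappa> + matrix_unit n j (j + 1), 0\<^sub>m n n))"
| "uv_image n (UEbar j) = uv_sum n (\<lambda>\<kappa>. (diag \<kappa>, matrix_unit n j (j + 1)))"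
| "uv_image n (UF j) = uv_sum n (\<lambda>\<kappa>. (diag \<kappa> + matrix_unit n (j + 1) j, 0\<^sub>m n n))"
| "uv_image n (UFbar j) = uv_sum n (\<lambda>\<kappa>. (diag \<kappa>, matrix_unit n (j + 1) j))"

definition uv_submodule :: "nat \<Rightarrow> 'r endo set \<Rightarrow> bool" where
  "uv_submodule n W \<longleftrightarrow> W \<subseteq> twisted_schur n \<and> endo_subspace W \<and>
    (\<forall>g \<in> uv_gens n. \<forall>f \<in> W. uv_image n g \<circ> f \<in> W)"

definition weight_space :: "nat \<Rightarrow> 'r endo set \<Rightarrow> (nat \<Rightarrow> qv) \<Rightarrow> 'r endo set" where
  "weight_space n W \<gamma> = {f \<in> W. \<forall>i < n. uv_image n (UK 1 i) \<circ> f = endo_scale (\<gamma> i) f}"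

definition internal_direct_sum :: "'r endo set \<Rightarrow> 'i set \<Rightarrow> ('i \<Rightarrow> 'r endo set) \<Rightarrow> bool" where
  "internal_direct_sum V I W \<longleftrightarrow> finite I \<and> endo_subspace V \<and>
    (\<forall>i \<in> I. endo_subspace (W i) \<and> W i \<subseteq> V) \<and>
    (\<forall>f \<in> V. \<exists>!g. g \<in> (\<Pi>\<^sub>E i \<in> I. W i) \<and> f = (\<Sum>i \<in> I. g i))"

definition col_part :: "nat \<Rightarrow> nat list \<Rightarrow> 'r endo set" where
  "col_part n \<mu> = endo_span {Phi n A | A. A \<in> smats n CARD('r) \<and> co (total A) = \<mu>}"

definition row_col_part :: "nat \<Rightarrow> nat list \<Rightarrow> nat list \<Rightarrow> 'r endo set" where
  "row_col_part n \<mu> \<kappa> =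
    endo_span {Phi n A | A. A \<in> smats n CARD('r) \<and> ro (total A) = \<kappa> \<and> co (total A) = \<mu>}"

end

(*
  A homogeneous endomorphism is determined by its values on the generators x_mu, and the component
  z in x_kappa H of such a value satisfies z T_i = q z for all simple reflections in S_mu. Since the
  Poincare polynomial P_mu is nonzero in Q(v), conversely every such z equals P_mu^-1 z x_mu, so it
  is the image of x_mu under a homomorphism, and it lies in x_kappa H x_mu. Straightening along a
  reduced word reduces this space to the elements x_kappa T_d a x_mu with d a shortest double coset
  representative and a in the Clifford algebra. Between the left and right invariants attached to
  nu_A one can replace c_{i+1} by c_i and cancel the product c_i c_{i+1} whenever i and i+1 lie in
  the same block; hence only products of the c_{q,i,j} survive, and these give the T_A. Thus the
  Phi_A span the algebra; their linear independence plays no role, since the decompositions are cut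
  out by the projections to the components of source and target. On the target component of index
  lambda the K_i act by v^{lambda_i}, and these scalars separate the weights.
*)

theory Submission
  imports Defs
begin

section \<open>Length and reduced words in the symmetric group\<close>

unbundle no m_inv_syntax

text \<open>Most objects are given by a choice or a description, and each has to be tied to
  something computable. \<open>T_perm\<close> picks some reduced word, \<open>d_mat\<close> and
  \<open>Phi\<close> are definite descriptions, and an element is homogeneous if some representative
  of it is. Counting inversions turns the length into a number that a simple reflection changes by
  exactly one, which yields independence of the reduced word. Being increasing on blocks in both
  directions replaces minimality in a double coset and determines a permutation from its
  intersection numbers. The grading is read off from the eigenspaces of an involution. Finally
  \<open>Phi n A\<close> equals the explicit map sending m to P_\<mu>^-1 T_A m_\<mu>, up to the sign
  rule: dividing by P_\<mu> gives the value at x_\<mu> h without choosing h. The obstacle is that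
  T_A ends in a sum over coset representatives, so that neither its invariance under S_\<mu> nor its
  place in x_\<lambda> H x_\<mu> is visible. Inserting x_\<nu> in front of that sum costs only the
  nonzero scalar P_\<nu> and turns the sum into x_\<mu>.\<close>

abbreviation adj :: "nat \<Rightarrow> nat \<Rightarrow> nat" where
  "adj i \<equiv> transpose i (Suc i)"

lemma word_perm_Nil [simp]: "word_perm [] = id"
  by (simp add: word_perm_def)

lemma word_perm_Cons [simp]: "word_perm (i # is) = adj i \<circ> word_perm is"
  by (simp add: word_perm_def)

lemma word_perm_append: "word_perm (is @ js) = word_perm is \<circ> word_perm js"
  by (induction "is") (simp_all add: o_assoc)

lemma word_perm_snoc: "word_perm (is @ [i]) = word_perm is \<circ> adj i"
  by (simp add: word_perm_append fun_eq_iff)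

lemma transpose_Suc_permutes: "i \<in> {1..<r} \<Longrightarrow> adj i permutes {1..r}"
  by (rule permutes_swap_id) auto

lemma word_perm_permutes: "set is \<subseteq> {1..<r} \<Longrightarrow> word_perm is permutes {1..r}"
proof (induction "is")
  case (Cons i "is")
  then show ?case
    unfolding word_perm_Cons by (intro permutes_compose[OF _ transpose_Suc_permutes]) auto
qed (simp add: permutes_id)

text \<open>The pairs range over all natural numbers, so the count carries no rank; for a
  permutation of {1..r} all inversions stay inside {1..r}, which gives finiteness.\<close>

definition inversions :: "(nat \<Rightarrow> nat) \<Rightarrow> (nat \<times> nat) set" where
  "inversions w = {(a, b). a < b \<and> w b < w a}"

lemma inversions_subset:
  assumes "w permutes {1..r}"
  shows "inversions w \<subseteq> {1..r} \<times> {1..r}"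
proof clarify
  fix a b assume "(a, b) \<in> inversions w"
  then have ab: "a < b" "w b < w a" by (auto simp: inversions_def)
  have "b \<le> r"
  proof (rule ccontr)
    assume "\<not> b \<le> r"
    then have "w b = b" using permutes_not_in[OF assms] by auto
    then have "a \<notin> {1..r}" using \<open>\<not> b \<le> r\<close> ab permutes_in_image[OF assms, of a] by auto
    then show False using \<open>w b = b\<close> ab permutes_not_in[OF assms, of a] by auto
  qed
  moreover have "a \<noteq> 0" using ab permutes_not_in[OF assms, of 0] by (cases a) auto
  ultimately show "a \<in> {1..r} \<and> b \<in> {1..r}" using ab by auto
qed

lemma inversions_id [simp]: "inversions id = {}"
  by (auto simp: inversions_def)

lemma finite_inversions: "w permutes {1..r} \<Longrightarrow> finite (inversions w)"
  by (rule finite_subset[OF inversions_subset]) auto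

text \<open>\<open>adj i\<close> preserves the order of every pair of positions except (i, i+1). At
  an ascent the old inversions are therefore only relabelled, and the one new inversion is (i, i+1)
  itself.\<close>

lemma inversions_comp_transpose:
  assumes "w i < w (Suc i)"
  shows "inversions (w \<circ> adj i) =
    insert (i, Suc i) (map_prod (adj i) (adj i) ` inversions w)"
    (is "?L = insert _ (map_prod ?s ?s ` _)")
proof -
  have mono: "?s a < ?s b" if "a < b" "(a, b) \<noteq> (i, Suc i)" for a b
    using that by (auto simp: Transposition.transpose_def)
  have "(a, b) \<in> ?L \<longleftrightarrow> (a, b) \<in> insert (i, Suc i) (map_prod ?s ?s ` inversions w)" for a b
  proof (cases "(a, b) = (i, Suc i)")
    case True
    then show ?thesis using assms by (simp add: inversions_def)
  next
    case False
    have "(a, b) \<in> map_prod ?s ?s ` inversions w \<longleftrightarrow> (?s a, ?s b) \<in> inversions w"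
    proof
      assume "(?s a, ?s b) \<in> inversions w"
      from imageI[OF this, of "map_prod ?s ?s"]
      show "(a, b) \<in> map_prod ?s ?s ` inversions w" by simp
    qed auto
    also have "\<dots> \<longleftrightarrow> (a, b) \<in> ?L"
    proof -
      have "?s a < ?s b \<longleftrightarrow> a < b" if "w (?s b) < w (?s a)"
      proof
        assume "?s a < ?s b"
        moreover have "(?s a, ?s b) \<noteq> (i, Suc i)" using that assms by auto
        ultimately show "a < b" using mono[of "?s a" "?s b"] by simp
      qed (use mono False in auto)
      then show ?thesis by (auto simp: inversions_def)
    qed
    finally show ?thesis using False by blast
  qed
  then show ?thesis by auto
qed

lemma card_inversions_comp_transpose:
  assumes w: "w permutes {1..r}" and asc: "w i < w (Suc i)"
  shows "card (inversions (w \<circ> adj i)) = Suc (card (inversions w))"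
proof -
  let ?s = "adj i"
  have "(i, Suc i) \<notin> map_prod ?s ?s ` inversions w"
  proof
    assume "(i, Suc i) \<in> map_prod ?s ?s ` inversions w"
    then obtain a b where "(a, b) \<in> inversions w" "?s a = i" "?s b = Suc i" by auto
    moreover from this have "a = Suc i" "b = i"
      by (metis transpose_apply_first transpose_apply_second transpose_involutory)+
    ultimately show False by (auto simp: inversions_def)
  qed
  moreover have "inj_on (map_prod ?s ?s) (inversions w)"
    using map_prod_inj_on[of ?s UNIV ?s UNIV] by (auto intro: inj_on_subset)
  ultimately show ?thesis
    unfolding inversions_comp_transpose[of w, OF asc]
    using finite_inversions[OF w] by (simp add: card_image)
qed

lemma card_inversions_inv:
  assumes "w permutes {1..r}"
  shows "card (inversions (inv w)) = card (inversions w)"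
proof -
  have eq: "inv w (w x) = x" "w (inv w x) = x" for x
    using permutes_inverses[OF assms] by auto
  have "bij_betw (\<lambda>(a, b). (w b, w a)) (inversions w) (inversions (inv w))"
    by (rule bij_betw_byWitness[where f' = "\<lambda>(a, b). (inv w b, inv w a)"])
      (auto simp: inversions_def eq)
  then show ?thesis by (simp add: bij_betw_same_card)
qed

text \<open>Increasing steps give i \<le> w i by induction upwards and w i \<le> i by induction
  downwards from r; the latter runs over the distance k from r.\<close>

lemma permutes_increasing_eq_id:
  assumes w: "w permutes {1..r}" and asc: "\<And>i. i \<in> {1..<r} \<Longrightarrow> w i < w (Suc i)"
  shows "w = id"
proof -
  have img: "w i \<in> {1..r} \<longleftrightarrow> i \<in> {1..r}" for i using permutes_in_image[OF w] .
  have ge: "i \<le> w i" if "i \<in> {1..r}" for i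
    using that
  proof (induction i)
    case (Suc i)
    then show ?case using asc[of i] img[of "Suc i"] by (cases "i = 0") auto
  qed simp
  have le: "w (r - k) \<le> r - k" if "k < r" for k
    using that
  proof (induction k)
    case 0
    then show ?case using img[of r] by auto
  next
    case (Suc k)
    then have "Suc (r - Suc k) = r - k" by auto
    moreover from Suc.prems have "r - Suc k \<in> {1..<r}" by auto
    ultimately show ?case using Suc asc[of "r - Suc k"] by auto
  qed
  show ?thesis
  proof
    fix i show "w i = id i"
    proof (cases "i \<in> {1..r}")
      case True
      then have "w i \<le> i" using le[of "r - i"] by auto
      with ge[OF True] show ?thesis by simp
    qed (simp add: permutes_not_in[OF w])
  qed
qed

lemma permutes_Suc_neq: "w permutes S \<Longrightarrow> w i \<noteq> w (Suc i)"
  by (simp add: inj_eq[OF permutes_inj])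

text \<open>Sorting by adjacent transpositions: a permutation other than the identity has a descent,
  and removing it lowers the number of inversions by exactly one.\<close>

lemma ex_word_inversions:
  assumes "w permutes {1..r}"
  shows "\<exists>is. set is \<subseteq> {1..<r} \<and> length is = card (inversions w) \<and> word_perm is = w"
  using assms
proof (induction "card (inversions w)" arbitrary: w rule: less_induct)
  case less
  show ?case
  proof (cases "w = id")
    case True
    then show ?thesis by (intro exI[of _ "[]"]) auto
  next
    case False
    then obtain i where i: "i \<in> {1..<r}" "\<not> w i < w (Suc i)"
      using permutes_increasing_eq_id less.prems by blast
    let ?s = "adj i"
    have ws: "w \<circ> ?s permutes {1..r}"
      using permutes_compose[OF transpose_Suc_permutes[OF i(1)] less.prems] .
    have "w i \<noteq> w (Suc i)" by (rule permutes_Suc_neq[OF less.prems])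
    then have card: "card (inversions w) = Suc (card (inversions (w \<circ> ?s)))"
      using card_inversions_comp_transpose[OF ws, of i] i by (auto simp: o_assoc[symmetric])
    then obtain "is" where "is": "set is \<subseteq> {1..<r}" "length is = card (inversions (w \<circ> ?s))"
      "word_perm is = w \<circ> ?s" using less.hyps[OF _ ws] by auto
    show ?thesis
      by (rule exI[of _ "is @ [i]"])
        (use "is" i card in \<open>auto simp: word_perm_append o_assoc[symmetric]\<close>)
  qed
qed

text \<open>A letter appended on the right changes the number of inversions by one up or down, so a
  word cannot create more of them than it has letters.\<close>

lemma card_inversions_word_perm:
  assumes "set is \<subseteq> {1..<r}"
  shows "card (inversions (word_perm is)) \<le> length is"
  using assms
proof (induction "is" rule: rev_induct)
  case (snoc i "is")
  let ?w = "word_perm is" and ?s = "adj i"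
  have perm: "?w permutes {1..r}" "?w \<circ> ?s permutes {1..r}"
    using word_perm_permutes[of "is" r] word_perm_permutes[of "is @ [i]" r] snoc.prems
    by (auto simp: word_perm_append)
  have "?w i \<noteq> ?w (Suc i)" by (rule permutes_Suc_neq[OF perm(1)])
  then consider "?w i < ?w (Suc i)" | "?w (Suc i) < ?w i" by linarith
  then show ?case
  proof cases
    case 1
    have "card (inversions ?w) \<le> length is" using snoc by simp
    with card_inversions_comp_transpose[OF perm(1) 1] show ?thesis
      unfolding word_perm_snoc by (simp only: length_append_singleton Suc_le_mono)
  next
    case 2
    then have "Suc (card (inversions (?w \<circ> ?s))) = card (inversions ?w)"
      using card_inversions_comp_transpose[OF perm(2), of i] by (simp add: o_assoc[symmetric])
    moreover have "card (inversions ?w) \<le> length is" using snoc by simp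
    ultimately show ?thesis
      unfolding word_perm_snoc length_append_singleton by linarith
  qed
qed simp

lemma perm_length_eq_inversions:
  assumes "w permutes {1..r}"
  shows "perm_length r w = card (inversions w)"
  unfolding perm_length_def
  by (rule Least_equality) (use ex_word_inversions[OF assms] card_inversions_word_perm in auto)

lemma perm_length_id [simp]: "perm_length r id = 0"
  by (simp add: perm_length_eq_inversions permutes_id)

lemma perm_length_eq_0:
  assumes "w permutes {1..r}" "perm_length r w = 0"
  shows "w = id"
  using ex_word_inversions[OF assms(1)] assms by (auto simp: perm_length_eq_inversions)

lemma perm_length_inv: "w permutes {1..r} \<Longrightarrow> perm_length r (inv w) = perm_length r w"
  by (simp add: perm_length_eq_inversions permutes_inv card_inversions_inv)

lemma perm_length_comp_transpose:
  assumes "w permutes {1..r}" "i \<in> {1..<r}" "w i < w (Suc i)"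
  shows "perm_length r (w \<circ> adj i) = Suc (perm_length r w)"
  using assms(1,3) permutes_compose[OF transpose_Suc_permutes[OF assms(2)] assms(1)]
  by (simp add: perm_length_eq_inversions card_inversions_comp_transpose)

lemma perm_length_transpose_comp:
  assumes w: "w permutes {1..r}" and i: "i \<in> {1..<r}" and "inv w i < inv w (Suc i)"
  shows "perm_length r (adj i \<circ> w) = Suc (perm_length r w)"
proof -
  have "inv (adj i \<circ> w) = inv w \<circ> adj i"
    by (simp add: o_inv_distrib permutes_bij[OF w])
  then show ?thesis
    using perm_length_comp_transpose[OF permutes_inv[OF w] i assms(3)]
      perm_length_inv[OF w] perm_length_inv[OF permutes_compose[OF w transpose_Suc_permutes[OF i]]]
    by simp
qed

lemma ex_reduced_word: "w permutes {1..r} \<Longrightarrow> \<exists>is. reduced_word r w is"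
  using ex_word_inversions by (auto simp: reduced_word_def perm_length_eq_inversions)

lemma reduced_word_permutes: "reduced_word r w is \<Longrightarrow> w permutes {1..r}"
  using word_perm_permutes by (auto simp: reduced_word_def)

lemma transpose_comp_cancel [simp]:
  "transpose a b \<circ> (transpose a b \<circ> w) = w"
  "(w \<circ> transpose a b) \<circ> transpose a b = w"
  by (auto simp: fun_eq_iff)

lemma inv_transpose_comp:
  assumes "w permutes S"
  shows "inv (transpose a b \<circ> w) = inv w \<circ> transpose a b"
  by (simp add: o_inv_distrib permutes_bij[OF assms])

lemma perm_length_transpose_comp_desc:
  assumes w: "w permutes {1..r}" and i: "i \<in> {1..<r}" and "inv w (Suc i) < inv w i"
  shows "perm_length r w = Suc (perm_length r (adj i \<circ> w))"
  using perm_length_transpose_comp[OF permutes_compose[OF w transpose_Suc_permutes[OF i]] i] assms(3)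
  by (simp add: inv_transpose_comp[OF w])

lemma perm_length_comp_transpose_desc:
  assumes w: "w permutes {1..r}" and i: "i \<in> {1..<r}" and "w (Suc i) < w i"
  shows "perm_length r w = Suc (perm_length r (w \<circ> adj i))"
  using perm_length_comp_transpose[OF permutes_compose[OF transpose_Suc_permutes[OF i] w] i] assms(3)
  by simp

lemma reduced_word_ConsD:
  assumes "reduced_word r w (i # is)"
  shows "reduced_word r (adj i \<circ> w) is" "inv w (Suc i) < inv w i" "i \<in> {1..<r}"
proof -
  note w = reduced_word_permutes[OF assms]
  show i: "i \<in> {1..<r}" using assms by (auto simp: reduced_word_def)
  have "is": "set is \<subseteq> {1..<r}" and sw: "word_perm is = adj i \<circ> w"
    using assms by (auto simp: reduced_word_def)
  have le: "perm_length r (adj i \<circ> w) \<le> length is"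
    unfolding perm_length_def by (rule Least_le) (use "is" sw in blast)
  have len: "perm_length r w = Suc (length is)" using assms by (simp add: reduced_word_def)
  show desc: "inv w (Suc i) < inv w i"
  proof (rule ccontr)
    assume "\<not> ?thesis"
    moreover have "inv w i \<noteq> inv w (Suc i)"
      by (rule permutes_Suc_neq[OF permutes_inv[OF w]])
    ultimately show False using perm_length_transpose_comp[OF w i] le len by simp
  qed
  show "reduced_word r (adj i \<circ> w) is"
    using "is" sw perm_length_transpose_comp_desc[OF w i desc] len by (simp add: reduced_word_def)
qed

lemma reduced_word_ConsI:
  assumes "w permutes {1..r}" "i \<in> {1..<r}" "inv w (Suc i) < inv w i"
    "reduced_word r (adj i \<circ> w) is"
  shows "reduced_word r w (i # is)"
  using assms perm_length_transpose_comp_desc[OF assms(1-3)] by (auto simp: reduced_word_def)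

lemma reduced_word_snocI:
  assumes "w permutes {1..r}" "i \<in> {1..<r}" "w i < w (Suc i)" "reduced_word r w is"
  shows "reduced_word r (w \<circ> adj i) (is @ [i])"
  using assms perm_length_comp_transpose[OF assms(1-3)]
  by (auto simp: reduced_word_def word_perm_append)

text \<open>Matsumoto's theorem for a monoid-valued g obeying the braid relations, by induction on
  the length. If two reduced words of w start with i \<noteq> j, both letters are left descents, so
  w also has two reduced words that start with the two spellings of the longest element of the
  subgroup generated by s_i and s_j. These two agree by a single braid relation, and each shares its
  first letter with one of the given words.\<close>

lemma matsumoto_symmetric:
  fixes g :: "nat \<Rightarrow> 'a::monoid_mult"
  assumes comm: "\<And>i j. i \<in> {1..<r} \<Longrightarrow> j \<in> {1..<r} \<Longrightarrow> Suc i < j \<Longrightarrow> g i * g j = g j * g i"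
    and braid: "\<And>i. i \<in> {1..<r} \<Longrightarrow> Suc i \<in> {1..<r} \<Longrightarrow>
      g i * g (Suc i) * g i = g (Suc i) * g i * g (Suc i)"
    and "reduced_word r w is" "reduced_word r w js"
  shows "prod_list (map g is) = prod_list (map g js)"
  using assms(3,4)
proof (induction "length is" arbitrary: w "is" js rule: less_induct)
  case less
  note IH = less.hyps
  have lens: "length is = length js" using less.prems by (simp add: reduced_word_def)
  have wp: "w permutes {1..r}" using reduced_word_permutes less.prems by blast
  show ?case
  proof (cases "is")
    case Nil
    then show ?thesis using lens by simp
  next
    case (Cons i is')
    then obtain j js' where js: "js = j # js'" using lens by (cases js) auto
    \<comment> \<open>The claim is symmetric in the two words, so i \<le> j may be assumed; the
      other order follows by exchanging them.\<close>
    have *: "prod_list (map g (i # is')) = prod_list (map g (j # js'))"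
      if "i \<le> j" "length is' < length is" "length js' < length is"
        "reduced_word r w (i # is')" "reduced_word r w (j # js')"
      for i j is' js'
    proof -
      note i = reduced_word_ConsD[OF that(4)] and j = reduced_word_ConsD[OF that(5)]
      have perm: "adj k \<circ> u permutes {1..r}" if "u permutes {1..r}" "k \<in> {1..<r}" for k u
        using that permutes_compose transpose_Suc_permutes by blast
      note inv_s = inv_transpose_comp
      note wi = perm[OF wp i(3)] note wj = perm[OF wp j(3)]
      note wji = perm[OF wi j(3)] note wij = perm[OF wj i(3)]
      consider "i = j" | "Suc i < j" | "j = Suc i" using \<open>i \<le> j\<close> by linarith
      then show ?thesis
      proof cases
        case 1
        then show ?thesis using IH[OF that(2) i(1)] j(1) by simp
      next
        case 2
        have eq: "adj j \<circ> (adj i \<circ> w) =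
            adj i \<circ> (adj j \<circ> w)"
          using 2 by (auto simp: fun_eq_iff Transposition.transpose_def)
        obtain ks where ks: "reduced_word r (adj j \<circ> (adj i \<circ> w)) ks"
          using ex_reduced_word[OF wji] by blast
        have "reduced_word r (adj i \<circ> w) (j # ks)"
          by (rule reduced_word_ConsI[OF wi j(3) _ ks]) (use j(2) 2 in \<open>simp add: inv_s[OF wp]\<close>)
        then have 1: "prod_list (map g is') = g j * prod_list (map g ks)"
          using IH[OF that(2) i(1)] by simp
        have "reduced_word r (adj j \<circ> w) (i # ks)"
          by (rule reduced_word_ConsI[OF wj i(3)]) (use i(2) 2 ks eq in \<open>simp_all add: inv_s[OF wp]\<close>)
        then have "prod_list (map g js') = g i * prod_list (map g ks)"
          using IH[OF that(3) j(1)] by simp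
        with 1 show ?thesis using comm[OF i(3) j(3) 2] by (simp add: mult.assoc[symmetric])
      next
        case 3
        note j' = j[unfolded 3] note wj' = wj[unfolded 3]
        have eq: "adj i \<circ> (adj (Suc i) \<circ> (adj i \<circ> w)) =
            adj (Suc i) \<circ> (adj i \<circ> (adj (Suc i) \<circ> w))"
          by (auto simp: fun_eq_iff Transposition.transpose_def)
        note wji' = wji[unfolded 3] note wij' = wij[unfolded 3]
        \<comment> \<open>\<open>ks\<close> spells what remains of w after the longest element s_i
          s_{i+1} s_i has been stripped; by \<open>eq\<close> its other spelling leaves the same
          permutation.\<close>
        obtain ks where ks: "reduced_word r (adj i \<circ>
            (adj (Suc i) \<circ> (adj i \<circ> w))) ks"
          using ex_reduced_word[OF perm[OF wji' i(3)]] by blast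
        have "reduced_word r (adj i \<circ> w) (Suc i # i # ks)"
          using i(2) j'(2) ks
          by (intro reduced_word_ConsI[OF wi j'(3)] reduced_word_ConsI[OF wji' i(3)])
            (simp_all add: inv_s[OF wp] inv_s[OF wi] Transposition.transpose_def)
        then have 1: "prod_list (map g is') = g (Suc i) * (g i * prod_list (map g ks))"
          using IH[OF that(2) i(1)] by simp
        have "reduced_word r (adj (Suc i) \<circ> w) (i # Suc i # ks)"
          using i(2) j'(2) ks[unfolded eq]
          by (intro reduced_word_ConsI[OF wj' i(3)] reduced_word_ConsI[OF wij' j'(3)])
            (simp_all add: inv_s[OF wp] inv_s[OF wj'] Transposition.transpose_def)
        then have 2: "prod_list (map g js') = g i * (g (Suc i) * prod_list (map g ks))"
          using IH[OF that(3) j'(1)] by simp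
        show ?thesis
          using braid[OF i(3) j'(3)] by (simp add: 1 2 3 mult.assoc[symmetric])
      qed
    qed
    have lt: "length is' < length is" "length js' < length is" using Cons js lens by auto
    show ?thesis
    proof (cases "i \<le> j")
      case True
      show ?thesis
        using *[OF True lt] less.prems unfolding Cons js by simp
    next
      case False
      show ?thesis
        using *[of j i js' is'] False lt less.prems unfolding Cons js by simp
    qed
  qed
qed

section \<open>Structure of the Hecke--Clifford superalgebra\<close>

lemma hc_free_induct [case_names single add]:
  fixes x :: hc_free
  assumes single: "\<And>w a. P (Poly_Mapping.single w a)"
    and add: "\<And>x y. P x \<Longrightarrow> P y \<Longrightarrow> P (x + y)"
  shows "P x"
proof (induction x rule: Poly_Mapping.update_induct)
  case const
  show ?case using single[of 0 0] by simp
next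
  case (update f k a)
  have "Poly_Mapping.update k a f = f + Poly_Mapping.single k a"
    using update.hyps
    by (intro poly_mapping_eqI)
      (auto simp: lookup_update lookup_add lookup_single in_keys_iff when_def)
  then show ?case using add[OF update.IH single] by simp
qed

lemma free_scalar_commute: "x * free_scalar a = free_scalar a * x"
proof (induction x rule: hc_free_induct)
  case (single w b)
  then show ?case by (simp add: free_scalar_def mult_single mult.commute)
qed (simp add: distrib_left distrib_right)

interpretation hc: vector_space "hc_scale :: qv \<Rightarrow> 'r hc \<Rightarrow> 'r hc"
  by (rule hc_vector_space)

lemma hc_scale_mult_left: "hc_scale a x * y = hc_scale a (x * y)"
  by transfer (simp add: mult.assoc hc_ideal.zero)

lemma hc_scale_mult_right: "x * hc_scale a y = hc_scale a (x * y)"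
proof (transfer fixing: a)
  fix x y :: hc_free
  have "x * (free_scalar a * y) = free_scalar a * (x * y)"
    by (simp add: mult.assoc[symmetric] free_scalar_commute)
  then show "x * (free_scalar a * y) - free_scalar a * (x * y) \<in> hc_ideal CARD('a)"
    by (simp add: hc_ideal.zero)
qed

lemmas hc_scale_mult = hc_scale_mult_left hc_scale_mult_right

lemma abs_hc_eq_0: "x \<in> hc_ideal CARD('r) \<Longrightarrow> (abs_hc x :: 'r hc) = 0"
  by (simp add: zero_hc_def hc.abs_eq_iff)

lemma abs_hc_hom:
  "(abs_hc (x + y) :: 'r hc) = abs_hc x + abs_hc y"
  "(abs_hc (x - y) :: 'r hc) = abs_hc x - abs_hc y"
  "(abs_hc (x * y) :: 'r hc) = abs_hc x * abs_hc y"
  "(abs_hc (- x) :: 'r hc) = - abs_hc x"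
  "(abs_hc 1 :: 'r hc) = 1" "(abs_hc 0 :: 'r hc) = 0"
  "(abs_hc (free_scalar a * x) :: 'r hc) = hc_scale a (abs_hc x)"
  "(abs_hc (free_scalar a) :: 'r hc) = hc_scale a 1"
  "(abs_hc (free_T i) :: 'r hc) = T_gen i"
  "(abs_hc (free_c i) :: 'r hc) = c_gen i"
  by (simp_all add: plus_hc.abs_eq minus_hc.abs_eq times_hc.abs_eq uminus_hc.abs_eq one_hc_def
      zero_hc_def hc_scale.abs_eq T_gen_def c_gen_def)

text \<open>The presentation read in the quotient. The facts come in the order of the clauses of
  \<open>hc_relators\<close> and are used below by position.\<close>

lemmas hc_relation = hc_relators.intros[THEN hc_ideal.relator, THEN abs_hc_eq_0,
  unfolded abs_hc_hom]

lemma T_gen_out: "i \<notin> {1..<CARD('r)} \<Longrightarrow> (T_gen i :: 'r hc) = 0"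
  by (rule hc_relation)

lemma c_gen_out: "i \<notin> {1..CARD('r)} \<Longrightarrow> (c_gen i :: 'r hc) = 0"
  by (rule hc_relation)

lemma T_gen_square:
  assumes "i \<in> {1..<CARD('r)}"
  shows "(T_gen i :: 'r hc) * T_gen i = hc_scale (qq - 1) (T_gen i) + hc_scale qq 1"
  using hc_relation(3)[OF assms]
  by (simp add: algebra_simps hc_scale_mult hc.scale_left_diff_distrib)

lemma T_gen_commute:
  assumes "i \<in> {1..<CARD('r)}" "j \<in> {1..<CARD('r)}" "Suc i < j"
  shows "(T_gen i :: 'r hc) * T_gen j = T_gen j * T_gen i"
  using hc_relation(4)[OF assms(1,2)] assms(3) by simp

lemma T_gen_braid:
  assumes "i \<in> {1..<CARD('r)}" "Suc i \<in> {1..<CARD('r)}"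
  shows "(T_gen i :: 'r hc) * T_gen (Suc i) * T_gen i = T_gen (Suc i) * T_gen i * T_gen (Suc i)"
  using hc_relation(5)[OF assms(1)] assms(2) by simp

lemma c_gen_square: "i \<in> {1..CARD('r)} \<Longrightarrow> (c_gen i :: 'r hc) * c_gen i = - 1"
  using hc_relation(6)[of i, where 'r = 'r] by (simp add: eq_neg_iff_add_eq_0)

lemma c_gen_anticommute:
  assumes "i \<noteq> j"
  shows "(c_gen i :: 'r hc) * c_gen j = - (c_gen j * c_gen i)"
proof (cases "i \<in> {1..CARD('r)} \<and> j \<in> {1..CARD('r)}")
  case True
  then show ?thesis using hc_relation(7)[of i j, where 'r = 'r] assms by (simp add: eq_neg_iff_add_eq_0)
qed (auto simp: c_gen_out)

lemma T_c_commute: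
  assumes "j \<noteq> i" "j \<noteq> Suc i"
  shows "(T_gen i :: 'r hc) * c_gen j = c_gen j * T_gen i"
proof (cases "i \<in> {1..<CARD('r)} \<and> j \<in> {1..CARD('r)}")
  case True
  then show ?thesis using hc_relation(8)[of i j, where 'r = 'r] assms by simp
qed (auto simp: c_gen_out T_gen_out)

lemma T_c_same: "i \<in> {1..<CARD('r)} \<Longrightarrow> (T_gen i :: 'r hc) * c_gen i = c_gen (Suc i) * T_gen i"
  using hc_relation(9)[of i, where 'r = 'r] by simp

lemma T_c_next:
  assumes "i \<in> {1..<CARD('r)}"
  shows "(T_gen i :: 'r hc) * c_gen (Suc i) =
    c_gen i * T_gen i - hc_scale (qq - 1) (c_gen i - c_gen (Suc i))"
  using hc_relation(10)[OF assms] by (simp add: hc_scale_mult)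

lemma c_T_same:
  assumes "i \<in> {1..<CARD('r)}"
  shows "(c_gen i :: 'r hc) * T_gen i =
    T_gen i * c_gen (Suc i) + hc_scale (qq - 1) (c_gen i - c_gen (Suc i))"
  using T_c_next[OF assms] by simp

lemma word_hc_mult:
  "(abs_hc (Poly_Mapping.single (Word (gs @ [g])) a) :: 'r hc) =
    abs_hc (Poly_Mapping.single (Word gs) a) * (case g of GenT i \<Rightarrow> T_gen i | GenC i \<Rightarrow> c_gen i)"
proof -
  have "Poly_Mapping.single (Word (gs @ [g])) a =
      Poly_Mapping.single (Word gs) a * Poly_Mapping.single (Word [g]) 1"
    by (simp add: mult_single plus_hc_word_def)
  then show ?thesis
    by (cases g) (simp_all add: abs_hc_hom(3) flip: abs_hc_hom(9,10) free_T_def free_c_def)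
qed

text \<open>Words are extended by a letter on the right, so closure under right multiplication by
  the generators suffices, the form suited to the spanning sets below. Letters out of range
  contribute zero, which is covered by \<open>scale\<close> with the scalar 0.\<close>

lemma hc_induct [case_names one scale add T c]:
  fixes h :: "'r hc"
  assumes one: "P 1"
    and scale: "\<And>a h. P h \<Longrightarrow> P (hc_scale a h)"
    and add: "\<And>h h'. P h \<Longrightarrow> P h' \<Longrightarrow> P (h + h')"
    and T: "\<And>h i. i \<in> {1..<CARD('r)} \<Longrightarrow> P h \<Longrightarrow> P (h * T_gen i)"
    and c: "\<And>h i. i \<in> {1..CARD('r)} \<Longrightarrow> P h \<Longrightarrow> P (h * c_gen i)"
  shows "P h"
proof (induction h rule: hc.abs_induct)
  fix x
  have "P 0" using scale[OF one, of 0] by simp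
  show "P (abs_hc x)"
  proof (induction x rule: hc_free_induct)
    case (single w a)
    obtain gs where w: "w = Word gs" by (cases w)
    have "P (abs_hc (Poly_Mapping.single (Word gs) a))"
    proof (induction gs rule: rev_induct)
      case Nil
      have "Poly_Mapping.single (Word []) a = free_scalar a"
        by (simp add: free_scalar_def zero_hc_word_def)
      then show ?case using scale[OF one] by (simp add: abs_hc_hom)
    next
      case (snoc g gs)
      then show ?case
        unfolding word_hc_mult using T c \<open>P 0\<close>
        by (cases g) (metis T_gen_out c_gen_out hc_gen.simps(5,6) mult_zero_right)+
    qed
    then show ?case by (simp add: w)
  qed (simp add: abs_hc_hom add)
qed

section \<open>The grading as an involutive automorphism\<close>

definition free_grade :: "hc_free \<Rightarrow> hc_free" where
  "free_grade = Poly_Mapping.mapp (\<lambda>w a. (-1) ^ word_parity w * a)"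

lemma lookup_free_grade:
  "Poly_Mapping.lookup (free_grade x) w = (-1) ^ word_parity w * Poly_Mapping.lookup x w"
  by (simp add: free_grade_def lookup_mapp in_keys_iff when_def)

lemma free_grade_add: "free_grade (x + y) = free_grade x + free_grade y"
  by (rule poly_mapping_eqI) (simp add: lookup_free_grade lookup_add algebra_simps)

lemma free_grade_uminus: "free_grade (- x) = - free_grade x"
  by (rule poly_mapping_eqI) (simp add: lookup_free_grade)

lemma free_grade_diff: "free_grade (x - y) = free_grade x - free_grade y"
  by (rule poly_mapping_eqI) (simp add: lookup_free_grade lookup_minus algebra_simps)

lemma free_grade_single:
  "free_grade (Poly_Mapping.single w a) = Poly_Mapping.single w ((-1) ^ word_parity w * a)"
  by (rule poly_mapping_eqI) (simp add: lookup_free_grade lookup_single when_def)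

lemma minus_one_power_mod2: "(-1 :: 'a::ring_1) ^ (k mod 2) = (-1) ^ k"
  by (simp add: minus_one_power_iff)

lemma minus_one_power_word_parity_add:
  "(-1 :: qv) ^ word_parity (w + u) = (-1) ^ word_parity w * (-1) ^ word_parity u"
  by (simp add: word_parity_def plus_hc_word_def minus_one_power_mod2 power_add)

lemma free_grade_mult: "free_grade (x * y) = free_grade x * free_grade y"
proof (induction x rule: hc_free_induct)
  case (single w a)
  show ?case
  proof (induction y rule: hc_free_induct)
    case (single u b)
    then show ?case
      by (simp add: mult_single free_grade_single minus_one_power_word_parity_add algebra_simps)
  qed (simp add: distrib_left free_grade_add)
qed (simp add: distrib_right free_grade_add)

lemma free_grade_free_scalar: "free_grade (free_scalar a) = free_scalar a"
  by (simp add: free_scalar_def free_grade_single word_parity_def zero_hc_word_def)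

lemma free_grade_one: "free_grade 1 = 1"
  using free_grade_free_scalar[of 1] by (simp add: free_scalar_def)

lemma free_grade_T: "free_grade (free_T i) = free_T i"
  by (simp add: free_T_def free_grade_single word_parity_def)

lemma free_grade_c: "free_grade (free_c i) = - free_c i"
  by (simp add: free_c_def free_grade_single word_parity_def single_uminus)

lemmas free_grade_simps = free_grade_add free_grade_diff free_grade_uminus free_grade_mult
  free_grade_free_scalar free_grade_one free_grade_T free_grade_c

text \<open>Every relator is homogeneous for the parity of words, hence is sent to itself or to its
  negative. This is what lets the involution descend to the quotient.\<close>

lemma free_grade_relator: "x \<in> hc_relators r \<Longrightarrow> free_grade x \<in> hc_ideal r"
proof (induction rule: hc_relators.induct)
  case (T_c_same i)
  from hc_ideal_uminus[OF hc_ideal.relator[OF hc_relators.T_c_same[OF this]]]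
  show ?case by (simp add: free_grade_simps)
next
  case (T_c_commute i j)
  from hc_ideal_uminus[OF hc_ideal.relator[OF hc_relators.T_c_commute[OF this]]]
  show ?case by (simp add: free_grade_simps)
next
  case (T_c_next i)
  from hc_ideal_uminus[OF hc_ideal.relator[OF hc_relators.T_c_next[OF this]]]
  show ?case by (simp add: free_grade_simps algebra_simps)
qed (simp_all add: free_grade_simps hc_ideal_uminus hc_ideal.relator hc_relators.intros
    del: One_nat_def)

lemma free_grade_ideal: "x \<in> hc_ideal r \<Longrightarrow> free_grade x \<in> hc_ideal r"
proof (induction rule: hc_ideal.induct)
  case zero
  have "free_grade 0 = 0" by (rule poly_mapping_eqI) (simp add: lookup_free_grade)
  then show ?case by (simp add: hc_ideal.zero)
qed (simp_all add: free_grade_relator free_grade_add free_grade_mult hc_ideal.intros)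

lift_definition grade_inv :: "'r hc \<Rightarrow> 'r hc" is free_grade
  using free_grade_ideal by (simp flip: free_grade_diff)

lemma grade_inv_hom:
  "grade_inv (x + y) = grade_inv x + grade_inv y"
  "grade_inv (x - y) = grade_inv x - grade_inv y"
  "grade_inv (- x) = - grade_inv x"
  "grade_inv (x * y) = grade_inv x * grade_inv y"
  "grade_inv (hc_scale a x) = hc_scale a (grade_inv x)"
  "grade_inv 1 = 1"
  "grade_inv (T_gen i) = T_gen i"
  "grade_inv (c_gen i) = - c_gen i"
  by (transfer, simp add: free_grade_simps hc_ideal.zero)+

lemma grade_inv_0 [simp]: "grade_inv 0 = 0"
  using grade_inv_hom(2)[of 0 0] by simp

lemma grade_inv_sum: "grade_inv (sum f A) = (\<Sum>x\<in>A. grade_inv (f x))"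
  by (induction A rule: infinite_finite_induct) (simp_all add: grade_inv_hom)

lemma grade_inv_prod_list: "grade_inv (prod_list xs) = prod_list (map grade_inv xs)"
  by (induction xs) (simp_all add: grade_inv_hom)

lemma grade_inv_grade_inv [simp]: "grade_inv (grade_inv h) = h"
  by (induction h rule: hc_induct) (simp_all add: grade_inv_hom)

text \<open>Replaces the existence of a homogeneous representative by an eigenvalue equation that
  can be checked by calculation. For the converse an arbitrary representative is averaged with its
  signed graded image: this keeps the class and cancels all words of the wrong parity.\<close>

lemma hc_homogeneous_iff:
  fixes h :: "'r hc"
  assumes "p < 2"
  shows "h \<in> hc_homogeneous p \<longleftrightarrow> grade_inv h = hc_scale ((-1) ^ p) h"
proof
  assume "h \<in> hc_homogeneous p"
  then obtain x where h: "h = abs_hc x" and x: "\<forall>w \<in> Poly_Mapping.keys x. word_parity w = p"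
    by (auto simp: hc_homogeneous_def)
  have "free_grade x = free_scalar ((-1) ^ p) * x"
    unfolding free_scalar_def mult_map_scale_conv_mult[symmetric]
    by (rule poly_mapping_eqI)
      (use x in \<open>auto simp: lookup_free_grade Poly_Mapping.map.rep_eq when_def in_keys_iff\<close>)
  then show "grade_inv h = hc_scale ((-1) ^ p) h"
    by (simp add: h grade_inv.abs_eq hc_scale.abs_eq)
next
  assume *: "grade_inv h = hc_scale ((-1) ^ p) h"
  obtain x where h: "h = abs_hc x" by (induction h rule: hc.abs_induct) blast
  define y where "y = free_scalar (1/2) * (x + free_scalar ((-1) ^ p) * free_grade x)"
  have "abs_hc y = hc_scale (1/2) (h + hc_scale ((-1) ^ p) (grade_inv h))"
    by (simp add: y_def h abs_hc_hom hc_scale_mult grade_inv.abs_eq)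
  also have "\<dots> = h"
    unfolding * by (simp add: hc.scale_right_distrib flip: power_add mult_2 hc.scale_left_distrib)
  finally have "h = abs_hc y" by simp
  moreover have "word_parity w = p" if "w \<in> Poly_Mapping.keys y" for w
  proof (rule ccontr)
    assume "word_parity w \<noteq> p"
    then have "word_parity w = 1 - p" using assms
      by (auto simp: word_parity_def less_2_cases_iff)
    then have "Poly_Mapping.lookup y w = 0"
      using assms unfolding y_def free_scalar_def mult_map_scale_conv_mult[symmetric]
      by (auto simp: Poly_Mapping.map.rep_eq lookup_add lookup_free_grade less_2_cases_iff when_def)
    then show False using that by (simp add: in_keys_iff)
  qed
  ultimately show "h \<in> hc_homogeneous p" by (auto simp: hc_homogeneous_def)
qed

lemma hc_homogeneous_decomp:
  fixes h :: "'r hc"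
  obtains h0 h1 where "h = h0 + h1" "h0 \<in> hc_homogeneous 0" "h1 \<in> hc_homogeneous 1"
proof
  show "h = hc_scale (1/2) (h + grade_inv h) + hc_scale (1/2) (h - grade_inv h)"
    by (simp add: hc.scale_right_distrib hc.scale_right_diff_distrib flip: hc.scale_left_distrib)
qed (simp_all add: hc_homogeneous_iff grade_inv_hom hc.scale_minus_right[symmetric] add.commute
  del: hc.scale_minus_right)

lemma grade_inv_T_perm:
  "grade_inv (T_perm w) = T_perm w"
proof -
  have "prod_list (map (\<lambda>i. grade_inv (T_gen i)) xs) = prod_list (map T_gen xs)" for xs
    by (simp add: grade_inv_hom)
  then show ?thesis by (simp add: T_perm_def grade_inv_prod_list o_def)
qed

lemma grade_inv_x_comp: "grade_inv (x_comp \<kappa>) = x_comp \<kappa>"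
  by (simp add: x_comp_def grade_inv_sum grade_inv_T_perm)

lemma T_perm_reduced_word:
  assumes "reduced_word CARD('r) w is"
  shows "(T_perm w :: 'r hc) = prod_list (map T_gen is)"
proof -
  have "reduced_word CARD('r) w (SOME is. reduced_word CARD('r) w is)"
    using assms by (rule someI)
  from matsumoto_symmetric[where g = "T_gen :: nat \<Rightarrow> 'r hc", OF T_gen_commute T_gen_braid this assms] show ?thesis
    unfolding T_perm_def by simp
qed

lemma T_perm_id [simp]: "(T_perm id :: 'r hc) = 1"
  using T_perm_reduced_word[where w = id, of "[]"]
  by (simp add: reduced_word_def)

lemma T_perm_mult_T:
  assumes "w permutes {1..CARD('r)}" "i \<in> {1..<CARD('r)}" "w i < w (Suc i)"
  shows "(T_perm w :: 'r hc) * T_gen i = T_perm (w \<circ> adj i)"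
proof -
  obtain "is" where red: "reduced_word CARD('r) w is" using ex_reduced_word[OF assms(1)] by blast
  show ?thesis
    by (simp add: T_perm_reduced_word[OF red] T_perm_reduced_word[OF reduced_word_snocI[OF assms red]])
qed

lemma T_mult_T_perm:
  assumes w: "w permutes {1..CARD('r)}" and i: "i \<in> {1..<CARD('r)}" and "inv w i < inv w (Suc i)"
  shows "T_gen i * (T_perm w :: 'r hc) = T_perm (adj i \<circ> w)"
proof -
  obtain "is" where red: "reduced_word CARD('r) w is" using ex_reduced_word[OF w] by blast
  have "reduced_word CARD('r) (adj i \<circ> w) (i # is)"
    by (rule reduced_word_ConsI[OF permutes_compose[OF w transpose_Suc_permutes[OF i]] i])
      (use assms red in \<open>simp_all add: inv_transpose_comp[OF w]\<close>)
  then show ?thesis by (simp add: T_perm_reduced_word[OF red] T_perm_reduced_word)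
qed

section \<open>Young subgroups and symmetrizers\<close>

lemma sum_list_take_mono: "k \<le> l \<Longrightarrow> sum_list (take k \<nu>) \<le> sum_list (take l (\<nu> :: nat list))"
  using take_add[of k "l - k" \<nu>] by simp

lemma sum_list_take_le: "sum_list (take k \<nu>) \<le> sum_list (\<nu> :: nat list)"
  by (metis append_take_drop_id le_add1 sum_list.append)

lemma block_less:
  assumes "a \<in> block \<nu> k" "b \<in> block \<nu> l" "k < l"
  shows "a < b"
  using assms sum_list_take_mono[of "Suc k" l \<nu>] by (auto simp: block_def)

lemma block_unique: "a \<in> block \<nu> k \<Longrightarrow> a \<in> block \<nu> l \<Longrightarrow> k = l"
  using block_less[of a \<nu> k a l] block_less[of a \<nu> l a k] by (cases k l rule: linorder_cases) auto

lemma block_subset: "block \<nu> k \<subseteq> {1..sum_list \<nu>}"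
  using sum_list_take_le[of "Suc k" \<nu>] by (auto simp: block_def)

lemma block_cover:
  assumes "a \<in> {1..sum_list \<nu>}"
  shows "\<exists>k < length \<nu>. a \<in> block \<nu> k"
proof -
  have ex: "a \<le> sum_list (take (length \<nu>) \<nu>)" using assms by simp
  define k where "k = (LEAST k. a \<le> sum_list (take k \<nu>))"
  have le: "a \<le> sum_list (take k \<nu>)" unfolding k_def using ex by (rule LeastI)
  have "k \<le> length \<nu>" unfolding k_def using ex by (rule Least_le)
  have "k \<noteq> 0" using le assms by (cases k) auto
  then have "\<not> a \<le> sum_list (take (k - 1) \<nu>)"
    unfolding k_def by (intro not_less_Least) auto
  then have "a \<in> block \<nu> (k - 1)" using le \<open>k \<noteq> 0\<close> by (simp add: block_def)
  then show ?thesis using \<open>k \<noteq> 0\<close> \<open>k \<le> length \<nu>\<close> by (intro exI[of _ "k - 1"]) auto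
qed

lemma card_block: "k < length \<nu> \<Longrightarrow> card (block \<nu> k) = \<nu> ! k"
  by (simp add: block_def take_Suc_conv_app_nth)

text \<open>Says that s_i is a simple reflection of the Young subgroup of \<nu>; the invariance
  conditions below are imposed at exactly these i.\<close>

definition same_block :: "nat list \<Rightarrow> nat \<Rightarrow> bool" where
  "same_block \<nu> i \<longleftrightarrow> (\<exists>k < length \<nu>. i \<in> block \<nu> k \<and> Suc i \<in> block \<nu> k)"

lemma same_block_range: "same_block \<nu> i \<Longrightarrow> i \<in> {1..<sum_list \<nu>}"
  using block_subset by (fastforce simp: same_block_def)

lemma increasing_on_block:
  fixes f :: "nat \<Rightarrow> nat"
  assumes asc: "\<And>i. same_block \<nu> i \<Longrightarrow> f i < f (Suc i)"
    and "k < length \<nu>" "a \<in> block \<nu> k" "b \<in> block \<nu> k" "a < b"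
  shows "f a < f b"
  using \<open>a < b\<close> \<open>b \<in> block \<nu> k\<close>
proof (induction b)
  case (Suc b)
  have b: "b \<in> block \<nu> k" if "a < Suc b"
    using that Suc.prems(2) assms(3) by (auto simp: block_def)
  have "f b < f (Suc b)"
    using b[OF Suc.prems(1)] Suc.prems(2) assms(2) by (intro asc) (auto simp: same_block_def)
  with Suc.IH b Suc.prems(1) show ?case by (cases "a = b") auto
qed simp

lemma young_permutes: "w \<in> young \<nu> \<Longrightarrow> w permutes {1..sum_list \<nu>}"
  by (simp add: young_def)

lemma finite_young [simp]: "finite (young \<nu>)"
  by (rule finite_subset[OF _ finite_permutations[of "{1..sum_list \<nu>}"]]) (auto simp: young_def)

lemma id_young [simp]: "id \<in> young \<nu>"
  by (simp add: young_def permutes_id)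

lemma young_comp:
  assumes "w \<in> young \<nu>" "u \<in> young \<nu>"
  shows "w \<circ> u \<in> young \<nu>"
proof -
  have "(w \<circ> u) ` block \<nu> k = block \<nu> k" if "k < length \<nu>" for k
    using assms that by (simp only: image_comp[symmetric]) (simp add: young_def)
  then show ?thesis using assms by (simp add: young_def permutes_compose)
qed

lemma young_inv:
  assumes "w \<in> young \<nu>"
  shows "inv w \<in> young \<nu>"
proof -
  have "inj w" using permutes_inj[OF young_permutes[OF assms]] .
  then have "inv w ` block \<nu> k = block \<nu> k" if "k < length \<nu>" for k
    using assms that image_inv_f_f[of w "block \<nu> k"] by (simp add: young_def)
  then show ?thesis using assms by (simp add: young_def permutes_inv)
qed

lemma transpose_young: "same_block \<nu> i \<Longrightarrow> adj i \<in> young \<nu>"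
proof -
  assume i: "same_block \<nu> i"
  then have "i \<in> block \<nu> k \<longleftrightarrow> Suc i \<in> block \<nu> k" for k
    using block_unique unfolding same_block_def by blast
  then show ?thesis
    using transpose_Suc_permutes[OF same_block_range[OF i]] by (auto simp: young_def)
qed

lemma young_block_mem: "w \<in> young \<nu> \<Longrightarrow> k < length \<nu> \<Longrightarrow> a \<in> block \<nu> k \<Longrightarrow> w a \<in> block \<nu> k"
  by (auto simp: young_def)

text \<open>Blocks are consecutive intervals preserved by w, so w cannot reverse the order across a
  block border. Inductions on the length therefore stay in the Young subgroup: the letter to be
  removed belongs to it.\<close>

lemma young_descent:
  assumes "w \<in> young \<nu>" "i \<in> {1..<sum_list \<nu>}" "w (Suc i) < w i"
  shows "same_block \<nu> i"
proof -
  obtain k l where kl: "k < length \<nu>" "l < length \<nu>" "i \<in> block \<nu> k" "Suc i \<in> block \<nu> l"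
    using block_cover[of i \<nu>] block_cover[of "Suc i" \<nu>] assms(2) by auto
  have "\<not> k < l"
    using block_less young_block_mem[OF assms(1) kl(1,3)] young_block_mem[OF assms(1) kl(2,4)]
      assms(3) by (meson not_less_iff_gr_or_eq)
  moreover have "\<not> l < k" using block_less[OF kl(4,3)] by auto
  ultimately show ?thesis using kl by (auto simp: same_block_def intro!: exI[of _ k])
qed

lemma T_sym_mult:
  assumes "i \<in> {1..<CARD('r)}"
  shows "(1 + T_gen i :: 'r hc) * T_gen i = hc_scale qq (1 + T_gen i)"
    "T_gen i * (1 + T_gen i :: 'r hc) = hc_scale qq (1 + T_gen i)"
  by (simp_all add: distrib_left distrib_right T_gen_square[OF assms] hc.scale_left_diff_distrib
      hc.scale_right_distrib)

text \<open>Applied with \<phi> the multiplication by a simple reflection and P the ascents, where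
  each pair w, \<phi> w yields a factor 1 + T_i.\<close>

lemma sum_pair_involution:
  fixes f :: "'b \<Rightarrow> 'c::comm_monoid_add"
  assumes "finite Y" and Y: "\<And>w. w \<in> Y \<Longrightarrow> \<phi> w \<in> Y" and \<phi>: "\<And>w. \<phi> (\<phi> w) = w"
    and P: "\<And>w. w \<in> Y \<Longrightarrow> P (\<phi> w) \<longleftrightarrow> \<not> P w"
  shows "sum f Y = (\<Sum>w | w \<in> Y \<and> P w. f w + f (\<phi> w))"
proof -
  let ?U = "{w \<in> Y. P w}"
  have "\<phi> ` ?U = {w \<in> Y. \<not> P w}" using Y P \<phi> by (force intro: rev_image_eqI)
  moreover have "sum f (\<phi> ` ?U) = (\<Sum>w\<in>?U. f (\<phi> w))"
    by (rule sum.reindex_cong[of \<phi>]) (auto intro: inj_on_inverseI[where g = \<phi>] simp: \<phi>)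
  moreover have "sum f Y = sum f ?U + sum f {w \<in> Y. \<not> P w}"
    by (subst sum.union_disjoint[symmetric]) (use assms(1) in \<open>auto intro!: sum.cong\<close>)
  ultimately show ?thesis by (simp add: sum.distrib)
qed

context
  fixes \<nu> :: "nat list" and ty :: "'r itself"
  assumes sum_\<nu>: "sum_list \<nu> = CARD('r)"
begin

lemma same_block_range': "same_block \<nu> i \<Longrightarrow> i \<in> {1..<CARD('r)}"
  using same_block_range[of \<nu> i] sum_\<nu> by auto

lemma young_permutes': "w \<in> young \<nu> \<Longrightarrow> w permutes {1..CARD('r)}"
  using young_permutes[of w \<nu>] sum_\<nu> by auto

text \<open>Pairing w with w s_i factors x_\<nu> as a sum over ascents times 1 + T_i, and (1 + T_i)
  T_i = q (1 + T_i) is the quadratic relation.\<close>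

lemma x_comp_mult_T:
  assumes i: "same_block \<nu> i"
  shows "(x_comp \<nu> :: 'r hc) * T_gen i = hc_scale qq (x_comp \<nu>)"
proof -
  let ?s = "adj i" and ?P = "\<lambda>w. w i < w (Suc i) :: bool"
  have "(x_comp \<nu> :: 'r hc) = (\<Sum>w | w \<in> young \<nu> \<and> ?P w. T_perm w + T_perm (w \<circ> ?s))"
    unfolding x_comp_def
  proof (rule sum_pair_involution)
    fix w assume w: "w \<in> young \<nu>"
    show "w \<circ> ?s \<in> young \<nu>" by (rule young_comp[OF w transpose_young[OF i]])
    show "?P (w \<circ> ?s) \<longleftrightarrow> \<not> ?P w"
      using permutes_Suc_neq[OF young_permutes[OF w], of i] by auto
  qed simp_all
  also have "\<dots> = (\<Sum>w | w \<in> young \<nu> \<and> ?P w. T_perm w) * (1 + T_gen i)"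
    using T_perm_mult_T[OF young_permutes' same_block_range'[OF i]]
    by (simp add: distrib_left sum_distrib_right sum.distrib)
  finally show ?thesis
    by (simp add: mult.assoc T_sym_mult[OF same_block_range'[OF i]] hc_scale_mult)
qed

lemma T_mult_x_comp:
  assumes i: "same_block \<nu> i"
  shows "T_gen i * (x_comp \<nu> :: 'r hc) = hc_scale qq (x_comp \<nu>)"
proof -
  let ?s = "adj i" and ?P = "\<lambda>w. inv w i < inv w (Suc i) :: bool"
  have "(x_comp \<nu> :: 'r hc) = (\<Sum>w | w \<in> young \<nu> \<and> ?P w. T_perm w + T_perm (?s \<circ> w))"
    unfolding x_comp_def
  proof (rule sum_pair_involution)
    fix w assume w: "w \<in> young \<nu>"
    show "?s \<circ> w \<in> young \<nu>" by (rule young_comp[OF transpose_young[OF i] w])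
    show "?P (?s \<circ> w) \<longleftrightarrow> \<not> ?P w"
      using permutes_Suc_neq[OF permutes_inv[OF young_permutes[OF w]], of i]
      by (auto simp: inv_transpose_comp[OF young_permutes[OF w]])
  qed simp_all
  also have "\<dots> = (1 + T_gen i) * (\<Sum>w | w \<in> young \<nu> \<and> ?P w. T_perm w)"
    using T_mult_T_perm[OF young_permutes' same_block_range'[OF i]]
    by (simp add: distrib_right sum_distrib_left sum.distrib)
  finally show ?thesis
    by (simp add: mult.assoc[symmetric] T_sym_mult[OF same_block_range'[OF i]] hc_scale_mult)
qed

end

section \<open>The Poincare polynomial and right invariants\<close>

definition poincare :: "nat list \<Rightarrow> qv" where
  "poincare \<nu> = (\<Sum>w\<in>young \<nu>. qq ^ perm_length (sum_list \<nu>) w)"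

lemma vv_power: "vv ^ k = Fract ([:0, 1:] ^ k) 1"
  by (induction k) (simp_all add: vv_def One_fract_def)

text \<open>A sum of powers of q is a polynomial in v whose value at v = 1 is the number of
  summands. This one positivity argument serves for the Poincare polynomials, for q + 1 and for the
  sums of powers of q over a block.\<close>

lemma sum_qq_power_neq_0:
  assumes "finite A" "A \<noteq> {}"
  shows "(\<Sum>a\<in>A. qq ^ f a) \<noteq> 0"
proof -
  have qpower: "qq ^ k = Fract ([:0, 1:] ^ (2 * k)) 1" for k
    using vv_power[of "2 * k"] by (simp only: qq_def power_mult)
  have "(\<Sum>a\<in>A. qq ^ f a) = Fract (\<Sum>a\<in>A. [:0, 1:] ^ (2 * f a)) 1"
    using assms(1)
    by (induction A rule: finite_induct)
      (simp_all add: qpower Zero_fract_def)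
  moreover have "(\<Sum>a\<in>A. [:0, 1 :: rat:] ^ (2 * f a)) \<noteq> 0"
  proof
    assume "(\<Sum>a\<in>A. [:0, 1 :: rat:] ^ (2 * f a)) = 0"
    then have "poly (\<Sum>a\<in>A. [:0, 1 :: rat:] ^ (2 * f a)) 1 = 0" by simp
    then show False using assms by (simp add: poly_sum)
  qed
  ultimately show ?thesis by (simp add: Zero_fract_def eq_fract)
qed

lemma poincare_neq_0: "poincare \<nu> \<noteq> 0"
  unfolding poincare_def using id_young by (intro sum_qq_power_neq_0) (simp, blast)

lemma qq_plus_1_neq_0: "qq + 1 \<noteq> 0"
  using sum_qq_power_neq_0[of "{0, 1 :: nat}" "\<lambda>k. k"] by (simp add: add.commute)

lemma qq_neq_0: "qq \<noteq> 0"
  using sum_qq_power_neq_0[of "{0 :: nat}" "\<lambda>k. 1"] by simp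

definition right_invariant :: "nat list \<Rightarrow> 'r hc \<Rightarrow> bool" where
  "right_invariant \<nu> z \<longleftrightarrow> (\<forall>i. same_block \<nu> i \<longrightarrow> z * T_gen i = hc_scale qq z)"

lemma right_invariantD: "right_invariant \<nu> z \<Longrightarrow> same_block \<nu> i \<Longrightarrow> z * T_gen i = hc_scale qq z"
  by (simp add: right_invariant_def)

lemma right_invariant_mult: "right_invariant \<nu> z \<Longrightarrow> right_invariant \<nu> (h * z)"
  by (simp add: right_invariant_def mult.assoc hc_scale_mult)

lemma right_invariant_scale: "right_invariant \<nu> z \<Longrightarrow> right_invariant \<nu> (hc_scale a z)"
  by (simp add: right_invariant_def hc_scale_mult mult.commute)

context
  fixes \<nu> :: "nat list" and ty :: "'r itself"
  assumes sum_\<nu>: "sum_list \<nu> = CARD('r)"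
begin

lemma right_invariant_x_comp: "right_invariant \<nu> (x_comp \<nu> :: 'r hc)"
  by (simp add: right_invariant_def x_comp_mult_T[OF sum_\<nu>])

text \<open>A descent of w lies in the Young subgroup, so a reduced word can be shortened from the
  right inside it; each letter contributes a factor q.\<close>

lemma right_invariant_mult_T_perm:
  assumes "right_invariant \<nu> (z :: 'r hc)" "w \<in> young \<nu>"
  shows "z * T_perm w = hc_scale (qq ^ perm_length CARD('r) w) z"
  using assms(2)
proof (induction "perm_length CARD('r) w" arbitrary: w)
  case 0
  then have "w = id" using perm_length_eq_0[OF young_permutes'[OF sum_\<nu>]] by metis
  show ?case unfolding \<open>w = id\<close> T_perm_id perm_length_id by simp
next
  case (Suc l)
  note wp = young_permutes'[OF sum_\<nu> Suc.prems]
  have "w \<noteq> id" using Suc.hyps(2) by auto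
  then obtain i where i: "i \<in> {1..<CARD('r)}" "\<not> w i < w (Suc i)"
    using permutes_increasing_eq_id[OF wp] by blast
  then have desc: "w (Suc i) < w i" using permutes_Suc_neq[OF wp, of i] by linarith
  then have sb: "same_block \<nu> i" using young_descent[OF Suc.prems] i(1) sum_\<nu> by simp
  let ?u = "w \<circ> adj i"
  have u: "?u \<in> young \<nu>" by (rule young_comp[OF Suc.prems transpose_young[OF sb]])
  have len: "perm_length CARD('r) ?u = l"
    using perm_length_comp_transpose_desc[OF wp i(1) desc] Suc.hyps(2) by simp
  have "T_perm w = (T_perm ?u :: 'r hc) * T_gen i"
    using T_perm_mult_T[OF young_permutes'[OF sum_\<nu> u] i(1)] desc by simp
  then have "z * T_perm w = z * T_perm ?u * T_gen i" by (simp add: mult.assoc)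
  also have "\<dots> = hc_scale (qq ^ l) (z * T_gen i)"
    using Suc.hyps(1)[OF len[symmetric] u] len by (simp add: hc_scale_mult)
  also have "\<dots> = hc_scale (qq ^ Suc l) z"
    by (simp add: right_invariantD[OF assms(1) sb] mult.commute)
  finally show ?case by (simp flip: Suc.hyps(2))
qed

lemma right_invariant_mult_x_comp:
  assumes "right_invariant \<nu> (z :: 'r hc)"
  shows "z * x_comp \<nu> = hc_scale (poincare \<nu>) z"
  by (simp add: x_comp_def poincare_def sum_distrib_left hc.scale_sum_left sum_\<nu>
      right_invariant_mult_T_perm[OF assms])

section \<open>Factoring a Young symmetrizer through a smaller Young subgroup\<close>

lemma right_coset_reps_ascent:
  assumes "\<sigma> \<in> right_coset_reps CARD('r) \<nu>" "same_block \<nu> i"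
  shows "inv \<sigma> i < inv \<sigma> (Suc i)"
proof (rule ccontr)
  have \<sigma>: "\<sigma> permutes {1..CARD('r)}" using assms(1) by (simp add: right_coset_reps_def)
  assume "\<not> ?thesis"
  then have "inv \<sigma> (Suc i) < inv \<sigma> i"
    using permutes_Suc_neq[OF permutes_inv[OF \<sigma>], of i] by linarith
  from perm_length_transpose_comp_desc[OF \<sigma> same_block_range'[OF sum_\<nu> assms(2)] this]
  show False using assms(1) transpose_young[OF assms(2)] by (force simp: right_coset_reps_def)
qed

text \<open>Lengths add: u is peeled off letter by letter from the left. The descents of inv u lie
  inside blocks of \<nu>, which inv u preserves, and inv \<sigma> is increasing on each block
  because \<sigma> is shortest in its coset; so composing with \<sigma> does not disturb these
  descents.\<close>

lemma T_perm_mult_right_coset_rep: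
  assumes \<sigma>: "\<sigma> \<in> right_coset_reps CARD('r) \<nu>" and "u \<in> young \<nu>"
  shows "(T_perm u :: 'r hc) * T_perm \<sigma> = T_perm (u \<circ> \<sigma>)"
  using assms(2)
proof (induction "perm_length CARD('r) u" arbitrary: u)
  case 0
  then have "u = id" using perm_length_eq_0[OF young_permutes'[OF sum_\<nu>]] by metis
  show ?case unfolding \<open>u = id\<close> T_perm_id by simp
next
  case (Suc l)
  have \<sigma>p: "\<sigma> permutes {1..CARD('r)}" using \<sigma> by (simp add: right_coset_reps_def)
  note up = young_permutes'[OF sum_\<nu> Suc.prems]
  have "inv u \<noteq> id" using Suc.hyps(2) permutes_inv_inv[OF up] by (metis inv_id nat.distinct(1) perm_length_id)
  then obtain i where i: "i \<in> {1..<CARD('r)}" "\<not> inv u i < inv u (Suc i)"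
    using permutes_increasing_eq_id[OF permutes_inv[OF up]] by blast
  then have desc: "inv u (Suc i) < inv u i"
    using permutes_Suc_neq[OF permutes_inv[OF up], of i] by linarith
  then have sb: "same_block \<nu> i"
    using young_descent[OF young_inv[OF Suc.prems]] i(1) sum_\<nu> by simp
  let ?s = "adj i"
  let ?u = "?s \<circ> u"
  have u: "?u \<in> young \<nu>" by (rule young_comp[OF transpose_young[OF sb] Suc.prems])
  note up' = young_permutes'[OF sum_\<nu> u]
  have len: "perm_length CARD('r) ?u = l"
    using perm_length_transpose_comp_desc[OF up i(1) desc] Suc.hyps(2) by simp
  obtain k where k: "k < length \<nu>" "i \<in> block \<nu> k" "Suc i \<in> block \<nu> k"
    using sb by (auto simp: same_block_def)
  have mem: "inv u i \<in> block \<nu> k" "inv u (Suc i) \<in> block \<nu> k"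
    using young_block_mem[OF young_inv[OF Suc.prems] k(1)] k by auto
  have "inv \<sigma> (inv u (Suc i)) < inv \<sigma> (inv u i)"
    by (rule increasing_on_block[where f = "inv \<sigma>", OF right_coset_reps_ascent[OF \<sigma>] k(1) mem(2,1) desc])
  moreover have "inv (?u \<circ> \<sigma>) = inv \<sigma> \<circ> inv u \<circ> ?s"
    using up up' \<sigma>p by (simp add: o_inv_distrib permutes_bij inv_transpose_comp[OF up] o_assoc)
  ultimately have asc: "inv (?u \<circ> \<sigma>) i < inv (?u \<circ> \<sigma>) (Suc i)" by simp
  have "(T_perm u :: 'r hc) = T_gen i * T_perm ?u"
    using T_mult_T_perm[OF up' i(1)] desc by (simp add: inv_transpose_comp[OF up])
  then have "(T_perm u :: 'r hc) * T_perm \<sigma> = T_gen i * T_perm (?u \<circ> \<sigma>)"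
    using Suc.hyps(1)[OF len[symmetric] u] by (simp add: mult.assoc)
  also have "\<dots> = T_perm (?s \<circ> (?u \<circ> \<sigma>))"
    by (rule T_mult_T_perm[OF permutes_compose[OF \<sigma>p up'] i(1) asc])
  finally show ?case by (simp add: o_assoc[symmetric])
qed

text \<open>If t were not the identity, inv t would have a descent inside a block. As inv \<sigma>
  is increasing there, the descent would survive in the inverse of t \<circ> \<sigma>, which is
  increasing on blocks as well.\<close>

lemma right_coset_reps_unique:
  assumes "\<sigma> \<in> right_coset_reps CARD('r) \<nu>" "t \<circ> \<sigma> \<in> right_coset_reps CARD('r) \<nu>" "t \<in> young \<nu>"
  shows "t = id"
proof -
  note tp = young_permutes'[OF sum_\<nu> assms(3)]
  have \<sigma>p: "\<sigma> permutes {1..CARD('r)}" using assms(1) by (simp add: right_coset_reps_def)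
  have inv_t: "inv (t \<circ> \<sigma>) = inv \<sigma> \<circ> inv t"
    using tp \<sigma>p by (simp add: o_inv_distrib permutes_bij)
  have "inv t = id"
  proof (rule permutes_increasing_eq_id[OF permutes_inv[OF tp]], rule ccontr)
    fix i assume i: "i \<in> {1..<CARD('r)}" "\<not> inv t i < inv t (Suc i)"
    then have desc: "inv t (Suc i) < inv t i"
      using permutes_Suc_neq[OF permutes_inv[OF tp], of i] by linarith
    then have sb: "same_block \<nu> i"
      using young_descent[OF young_inv[OF assms(3)]] i(1) sum_\<nu> by simp
    then obtain k where k: "k < length \<nu>" "i \<in> block \<nu> k" "Suc i \<in> block \<nu> k"
      by (auto simp: same_block_def)
    have mem: "inv t i \<in> block \<nu> k" "inv t (Suc i) \<in> block \<nu> k"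
      using young_block_mem[OF young_inv[OF assms(3)] k(1)] k by auto
    have "inv \<sigma> (inv t (Suc i)) < inv \<sigma> (inv t i)"
      by (rule increasing_on_block[where f = "inv \<sigma>", OF right_coset_reps_ascent[OF assms(1)] k(1) mem(2,1) desc])
    then show False using right_coset_reps_ascent[OF assms(2) sb] by (simp add: inv_t)
  qed
  then show ?thesis using permutes_inv_inv[OF tp] by (metis inv_id)
qed

text \<open>Every element of S_\<mu> factors uniquely as u \<circ> \<sigma> with u in S_\<nu> and
  \<sigma> a shortest representative, and for such a product T_u T_\<sigma> is the basis element of
  u \<circ> \<sigma>.\<close>

lemma x_comp_mult_right_coset_reps:
  assumes sub: "young \<nu> \<subseteq> young \<mu>" and sum_\<mu>: "sum_list \<mu> = CARD('r)"
  shows "(x_comp \<nu> :: 'r hc) * (\<Sum>\<sigma> \<in> right_coset_reps CARD('r) \<nu> \<inter> young \<mu>. T_perm \<sigma>) = x_comp \<mu>"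
proof -
  let ?D = "right_coset_reps CARD('r) \<nu> \<inter> young \<mu>"
  let ?f = "\<lambda>(u, \<sigma>). u \<circ> \<sigma> :: nat \<Rightarrow> nat"
  have inj: "inj_on ?f (young \<nu> \<times> ?D)"
  proof (intro inj_onI, clarify)
    fix u \<sigma> u' \<sigma>'
    assume *: "u \<in> young \<nu>" "\<sigma> \<in> right_coset_reps CARD('r) \<nu>" "\<sigma> \<in> young \<mu>"
      "u' \<in> young \<nu>" "\<sigma>' \<in> right_coset_reps CARD('r) \<nu>" "u \<circ> \<sigma> = u' \<circ> \<sigma>'"
    note up = young_permutes'[OF sum_\<nu> *(1)]
    have eq: "\<sigma> = (inv u \<circ> u') \<circ> \<sigma>'"
      using *(6) permutes_inv_o(2)[OF up] by (metis id_comp o_assoc)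
    have "inv u \<circ> u' = id"
      by (rule right_coset_reps_unique[OF *(5)]) (use * eq young_comp young_inv in auto)
    then show "u = u' \<and> \<sigma> = \<sigma>'"
      using eq permutes_inv_o(1)[OF up] by (metis comp_id id_comp o_assoc)
  qed
  have "?f ` (young \<nu> \<times> ?D) = young \<mu>"
  proof (intro equalityI subsetI)
    fix w assume w: "w \<in> young \<mu>"
    \<comment> \<open>u makes u \<circ> w as short as possible in the coset S_\<nu> w; w is
      recovered from this representative by composing with inv u.\<close>
    obtain u where u: "u \<in> young \<nu>"
      and min: "\<And>u'. u' \<in> young \<nu> \<Longrightarrow> perm_length CARD('r) (u \<circ> w) \<le> perm_length CARD('r) (u' \<circ> w)"
      using ex_has_least_nat[of "\<lambda>u. u \<in> young \<nu>" id "\<lambda>u. perm_length CARD('r) (u \<circ> w)"]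
      by auto
    note up = young_permutes'[OF sum_\<nu> u] and wp = young_permutes'[OF sum_\<mu> w]
    have "u \<circ> w \<in> right_coset_reps CARD('r) \<nu>"
      using permutes_compose[OF wp up] min young_comp u
      by (auto simp: right_coset_reps_def o_assoc)
    moreover have "u \<circ> w \<in> young \<mu>" using u w sub by (auto intro: young_comp)
    moreover have "w = ?f (inv u, u \<circ> w)" using permutes_inv_o(2)[OF up] by (simp add: o_assoc)
    ultimately show "w \<in> ?f ` (young \<nu> \<times> ?D)" using young_inv[OF u] by blast
  qed (use sub young_comp in auto)
  then have "(x_comp \<mu> :: 'r hc) = (\<Sum>(u, \<sigma>) \<in> young \<nu> \<times> ?D. T_perm (u \<circ> \<sigma>))"
    using sum.reindex[OF inj, of "T_perm :: _ \<Rightarrow> 'r hc"] by (simp add: x_comp_def case_prod_unfold o_def)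
  also have "\<dots> = (\<Sum>(u, \<sigma>) \<in> young \<nu> \<times> ?D. T_perm u * T_perm \<sigma>)"
    by (rule sum.cong) (auto simp: T_perm_mult_right_coset_rep)
  finally show ?thesis
    by (simp add: x_comp_def sum_product sum.cartesian_product)
qed

end

section \<open>Clifford elements between invariants\<close>

lemma mult_rewrite_assoc: "a * b = c \<Longrightarrow> a * (b * z) = c * (z :: 'a::semigroup_mult)"
  by (simp flip: mult.assoc)

lemma hc_span_mult_right:
  assumes "x \<in> hc.span A" "hc.subspace V" "\<And>a. a \<in> A \<Longrightarrow> a * y \<in> V"
  shows "x * y \<in> V"
  using assms(1)
proof (induction rule: hc.span_induct_alt)
  case base
  then show ?case using hc.subspace_0[OF assms(2)] by simp
next
  case (step c a z)
  then show ?case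
    using assms(3) hc.subspace_add[OF assms(2) hc.subspace_scale[OF assms(2)]]
    by (simp add: distrib_right hc_scale_mult)
qed

lemma hc_span_mult_left:
  assumes "y \<in> hc.span A" "hc.subspace V" "\<And>a. a \<in> A \<Longrightarrow> x * a \<in> V"
  shows "x * y \<in> V"
  using assms(1)
proof (induction rule: hc.span_induct_alt)
  case base
  then show ?case using hc.subspace_0[OF assms(2)] by simp
next
  case (step c a z)
  then show ?case
    using assms(3) hc.subspace_add[OF assms(2) hc.subspace_scale[OF assms(2)]]
    by (simp add: distrib_left hc_scale_mult)
qed

section \<open>Clifford words and straightening\<close>

definition c_word :: "nat list \<Rightarrow> 'r hc" where
  "c_word l = prod_list (map c_gen l)"

lemma c_word_simps [simp]:
  "c_word [] = 1" "c_word (p # l) = c_gen p * c_word l"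
  "c_word (l @ l') = c_word l * c_word l'"
  by (simp_all add: c_word_def)

definition clifford :: "'r hc set" where
  "clifford = hc.span (range c_word)"

lemma subspace_clifford [simp]: "hc.subspace clifford"
  by (simp add: clifford_def)

lemmas clifford_add = hc.subspace_add[OF subspace_clifford]
lemmas clifford_diff = hc.subspace_diff[OF subspace_clifford]
lemmas clifford_scale = hc.subspace_scale[OF subspace_clifford]
lemmas clifford_zero = hc.subspace_0[OF subspace_clifford]

lemma c_word_clifford [simp]: "c_word l \<in> clifford"
  by (simp add: clifford_def hc.span_base)

lemma c_gen_clifford [simp]: "c_gen i \<in> clifford"
  using c_word_clifford[of "[i]"] by simp

lemma one_clifford [simp]: "1 \<in> clifford"
  using c_word_clifford[of "[]"] by simp

lemma clifford_mult: "a \<in> clifford \<Longrightarrow> b \<in> clifford \<Longrightarrow> a * b \<in> clifford"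
  unfolding clifford_def
  by (erule hc_span_mult_right, simp, clarify, erule hc_span_mult_left, simp)
    (auto intro!: hc.span_base simp flip: c_word_simps(3))

text \<open>T_i passes to the left of a Clifford generator at the price of a remainder without T_i.
  Of a and b only the membership in \<open>clifford\<close> is recorded, which is what survives
  iteration along a word.\<close>

lemma c_gen_T_straighten:
  "\<exists>a \<in> clifford. \<exists>b \<in> clifford. (c_gen p :: 'r hc) * T_gen i = T_gen i * a + b"
proof (cases "i \<in> {1..<CARD('r)}")
  case True
  consider "p = i" | "p = Suc i" | "p \<noteq> i" "p \<noteq> Suc i" by blast
  then show ?thesis
  proof cases
    case 1
    then show ?thesis unfolding 1
      by (intro bexI[of _ "c_gen (Suc i)"] bexI[of _ "hc_scale (qq - 1) (c_gen i - c_gen (Suc i))"])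
        (simp_all add: c_T_same[OF True] clifford_scale clifford_diff)
  next
    case 2
    then show ?thesis unfolding 2
      by (intro bexI[of _ "c_gen i"] bexI[of _ 0]) (simp_all add: T_c_same[OF True] clifford_zero)
  next
    case 3
    then show ?thesis
      by (intro bexI[of _ "c_gen p"] bexI[of _ 0]) (simp_all add: T_c_commute clifford_zero)
  qed
qed (auto simp: T_gen_out intro!: bexI[of _ 0] clifford_zero)

lemma T_c_gen_straighten:
  "\<exists>a \<in> clifford. \<exists>b \<in> clifford. T_gen i * (c_gen p :: 'r hc) = a * T_gen i + b"
proof (cases "i \<in> {1..<CARD('r)}")
  case True
  consider "p = i" | "p = Suc i" | "p \<noteq> i" "p \<noteq> Suc i" by blast
  then show ?thesis
  proof cases
    case 1
    then show ?thesis unfolding 1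
      by (intro bexI[of _ "c_gen (Suc i)"] bexI[of _ 0]) (simp_all add: T_c_same[OF True] clifford_zero)
  next
    case 2
    show ?thesis unfolding 2
      by (intro bexI[of _ "c_gen i"] bexI[of _ "hc_scale (1 - qq) (c_gen i - c_gen (Suc i))"])
        (simp_all add: T_c_next[OF True] clifford_scale clifford_diff
          hc.scale_left_diff_distrib)
  next
    case 3
    then show ?thesis
      by (intro bexI[of _ "c_gen p"] bexI[of _ 0]) (simp_all add: T_c_commute clifford_zero)
  qed
qed (auto simp: T_gen_out intro!: bexI[of _ 0] clifford_zero)

lemma c_word_T_straighten:
  "\<exists>a \<in> clifford. \<exists>b \<in> clifford. (c_word l :: 'r hc) * T_gen i = T_gen i * a + b"
proof (induction l rule: rev_induct)
  case Nil
  show ?case by (intro bexI[of _ 1] bexI[of _ 0]) (simp_all add: clifford_zero)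
next
  case (snoc p l)
  obtain a b :: "'r hc" where ab: "a \<in> clifford" "b \<in> clifford" "c_gen p * T_gen i = T_gen i * a + b"
    using c_gen_T_straighten by metis
  obtain a' b' :: "'r hc" where ab': "a' \<in> clifford" "b' \<in> clifford"
    "c_word l * T_gen i = T_gen i * a' + b'" using snoc by metis
  have "c_word (l @ [p]) * T_gen i = c_word l * T_gen i * a + c_word l * b"
    by (simp add: mult.assoc ab distrib_left)
  also have "\<dots> = T_gen i * (a' * a) + (b' * a + c_word l * b)"
    by (simp add: ab' distrib_right mult.assoc add.assoc)
  finally show ?case
    by (intro bexI[of _ "a' * a"] bexI[of _ "b' * a + c_word l * b"])
      (simp_all add: ab ab' clifford_mult clifford_add)
qed

lemma T_c_word_straighten:
  "\<exists>a \<in> clifford. \<exists>b \<in> clifford. T_gen i * (c_word l :: 'r hc) = a * T_gen i + b"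
proof (induction l)
  case Nil
  show ?case by (intro bexI[of _ 1] bexI[of _ 0]) (simp_all add: clifford_zero)
next
  case (Cons p l)
  obtain a b :: "'r hc" where ab: "a \<in> clifford" "b \<in> clifford" "T_gen i * c_gen p = a * T_gen i + b"
    using T_c_gen_straighten by metis
  obtain a' b' :: "'r hc" where ab': "a' \<in> clifford" "b' \<in> clifford"
    "T_gen i * c_word l = a' * T_gen i + b'" using Cons by metis
  have "T_gen i * c_word (p # l) = a * (T_gen i * c_word l) + b * c_word l"
    by (simp add: ab distrib_right flip: mult.assoc)
  also have "\<dots> = a * a' * T_gen i + (a * b' + b * c_word l)"
    by (simp add: ab' distrib_left mult.assoc add.assoc)
  finally show ?case
    by (intro bexI[of _ "a * a'"] bexI[of _ "a * b' + b * c_word l"])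
      (simp_all add: ab ab' clifford_mult clifford_add)
qed

text \<open>The span is stable under right multiplication by the generators: T_i is moved left past
  the Clifford word, and T_w T_i is either the element of w s_i or, at a descent, (q - 1) T_w plus q
  times that element.\<close>

lemma hc_span_T_perm_c_word:
  "(h :: 'r hc) \<in> hc.span {T_perm w * c_word l | w l. w permutes {1..CARD('r)}}"
  (is "h \<in> hc.span ?B")
proof -
  have clifford: "z * a \<in> hc.span ?B" if "z \<in> hc.span ?B" "a \<in> clifford" for z a
  proof (rule hc_span_mult_right[OF that(1)], simp, clarify)
    fix w l assume w: "w permutes {1..CARD('r)}"
    show "T_perm w * c_word l * a \<in> hc.span ?B"
    proof (rule hc_span_mult_left[OF that(2)[unfolded clifford_def]], simp, clarify)
      fix m
      show "T_perm w * c_word l * c_word m \<in> hc.span ?B"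
        using w by (intro hc.span_base CollectI exI[of _ w] exI[of _ "l @ m"]) (simp add: mult.assoc)
    qed
  qed
  have base: "T_perm w \<in> hc.span ?B" if "w permutes {1..CARD('r)}" for w
    using that by (intro hc.span_base CollectI exI[of _ w] exI[of _ "[]"]) simp
  have T_perm_T: "T_perm w * T_gen i \<in> hc.span ?B"
    if w: "w permutes {1..CARD('r)}" and i: "i \<in> {1..<CARD('r)}" for w i
  proof -
    let ?u = "w \<circ> adj i"
    have u: "?u permutes {1..CARD('r)}" by (rule permutes_compose[OF transpose_Suc_permutes[OF i] w])
    consider "w i < w (Suc i)" | "w (Suc i) < w i" using permutes_Suc_neq[OF w, of i] by linarith
    then show ?thesis
    proof cases
      case 1
      show ?thesis unfolding T_perm_mult_T[OF w i 1] by (rule base[OF u])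
    next
      case 2
      then have "(T_perm w :: 'r hc) = T_perm ?u * T_gen i" using T_perm_mult_T[OF u i] by simp
      then have "(T_perm w :: 'r hc) * T_gen i = hc_scale (qq - 1) (T_perm ?u * T_gen i) + hc_scale qq (T_perm ?u)"
        by (simp add: mult.assoc T_gen_square[OF i] distrib_left hc_scale_mult)
      also have "T_perm ?u * T_gen i = (T_perm w :: 'r hc)" using 2 T_perm_mult_T[OF u i] by simp
      finally have eq: "T_perm w * T_gen i =
          hc_scale (qq - 1) (T_perm w :: 'r hc) + hc_scale qq (T_perm ?u)" .
      show ?thesis unfolding eq by (intro hc.span_add hc.span_scale base u w)
    qed
  qed
  show ?thesis
  proof (induction h rule: hc_induct)
    case one
    show ?case using base[OF permutes_id] by simp
  next
    case (T h i)
    show ?case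
    proof (rule hc_span_mult_right[OF T(2)], simp, clarify)
      fix w l assume w: "w permutes {1..CARD('r)}"
      obtain a b :: "'r hc" where ab: "a \<in> clifford" "b \<in> clifford"
        "c_word l * T_gen i = T_gen i * a + b" using c_word_T_straighten by metis
      have "T_perm w * c_word l * T_gen i = T_perm w * T_gen i * a + T_perm w * b"
        by (simp add: ab mult.assoc distrib_left)
      then show "T_perm w * c_word l * T_gen i \<in> hc.span ?B"
        using clifford[OF T_perm_T[OF w T(1)] ab(1)] clifford[OF base[OF w] ab(2)]
        by (simp add: hc.span_add)
    qed
  next
    case (c h i)
    then show ?case using clifford[OF _ c_gen_clifford] by blast
  qed (simp_all add: hc.span_add hc.span_scale)
qed

text \<open>A letter passes a different one with a sign and an equal one without. The sign is kept
  existential because the words serve as members of spanning sets.\<close>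

lemma c_word_move:
  "\<exists>\<epsilon> \<in> {1, -1}. (c_word (l @ p # l') :: 'r hc) = hc_scale \<epsilon> (c_word (l @ l' @ [p]))"
proof (induction l' arbitrary: l)
  case Nil
  show ?case by (intro bexI[of _ 1]) auto
next
  case (Cons m l')
  obtain \<epsilon> where \<epsilon>: "\<epsilon> \<in> {1, -1}" "(c_word ((l @ [m]) @ p # l') :: 'r hc) = hc_scale \<epsilon> (c_word ((l @ [m]) @ l' @ [p]))"
    using Cons by metis
  show ?case
  proof (cases "m = p")
    case True
    then show ?thesis using \<epsilon> by (intro bexI[of _ \<epsilon>]) simp_all
  next
    case False
    have "(c_word (l @ p # m # l') :: 'r hc) = - c_word ((l @ [m]) @ p # l')"
      using c_gen_anticommute[of p m] False
      by (simp add: mult.assoc mult_rewrite_assoc[OF c_gen_anticommute[of p m]])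
    then show ?thesis using \<epsilon> by (intro bexI[of _ "- \<epsilon>"]) (auto simp: mult.assoc)
  qed
qed

lemma c_word_mset:
  assumes "mset l = mset l'"
  shows "\<exists>\<epsilon> \<in> {1, -1}. (c_word l :: 'r hc) = hc_scale \<epsilon> (c_word l')"
  using assms
proof (induction l' arbitrary: l rule: rev_induct)
  case Nil
  then show ?case by (intro bexI[of _ 1]) auto
next
  case (snoc p l')
  have "p \<in> set l" using mset_eq_setD[OF snoc.prems] by auto
  then obtain l1 l2 where l: "l = l1 @ p # l2" by (auto dest: split_list)
  have "mset (l1 @ l2) = mset l'" using snoc.prems l by simp
  from snoc.IH[OF this] obtain \<epsilon> where \<epsilon>: "\<epsilon> \<in> {1, -1}" "(c_word (l1 @ l2) :: 'r hc) = hc_scale \<epsilon> (c_word l')"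
    by blast
  obtain \<delta> where \<delta>: "\<delta> \<in> {1, -1}" "(c_word l :: 'r hc) = hc_scale \<delta> (c_word (l1 @ l2 @ [p]))"
    using c_word_move l by metis
  have "(c_word (l1 @ l2 @ [p]) :: 'r hc) = c_word (l1 @ l2) * c_gen p" by (simp add: mult.assoc)
  then have "(c_word l :: 'r hc) = hc_scale (\<delta> * \<epsilon>) (c_word (l' @ [p]))"
    using \<epsilon> \<delta> by (simp add: hc_scale_mult)
  then show ?case using \<epsilon>(1) \<delta>(1) by (intro bexI[of _ "\<delta> * \<epsilon>"]) auto
qed

lemma T_c_word_commute:
  assumes "i \<notin> set l" "Suc i \<notin> set l"
  shows "T_gen i * (c_word l :: 'r hc) = c_word l * T_gen i"
  using assms
proof (induction l)
  case (Cons p l)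
  have "T_gen i * (c_word (p # l) :: 'r hc) = c_gen p * (T_gen i * c_word l)"
    using Cons.prems by (simp add: mult.assoc mult_rewrite_assoc[OF T_c_commute])
  then show ?case using Cons by (simp add: mult.assoc)
qed simp

section \<open>The elements c_{q,i,j} and invariance\<close>

lemma T_c_q_commute:
  assumes "i \<notin> {a..b}" "Suc i \<notin> {a..b}"
  shows "T_gen i * (c_q a b :: 'r hc) = c_q a b * T_gen i"
proof -
  have "T_gen i * (c_gen t :: 'r hc) = c_gen t * T_gen i" if "t \<in> {a..b}" for t
    using that assms by (intro T_c_commute) auto
  then show ?thesis
    unfolding c_q_def sum_distrib_left sum_distrib_right
    by (intro sum.cong) (simp_all add: hc_scale_mult)
qed

text \<open>This is where the weights q^(j-t) come from. T_i commutes with all terms except those at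
  i and i+1, which together are a power of q times f = q c_i + c_{i+1}. The relations give f T_i =
  T_i (q c_{i+1} + c_i) + q (q - 1) (c_i - c_{i+1}), and behind y, where T_i acts as q, the
  right-hand side collapses to q f.\<close>

lemma invariant_mult_c_q:
  assumes i: "i \<in> {1..<CARD('r)}" "i \<in> {a..b}" "Suc i \<in> {a..b}"
    and y: "(y :: 'r hc) * T_gen i = hc_scale qq y"
  shows "y * c_q a b * T_gen i = hc_scale qq (y * c_q a b)"
proof -
  define e :: "'r hc" where "e = (\<Sum>t \<in> {a..b} - {i, Suc i}. hc_scale (qq ^ (b - t)) (c_gen t))"
  define f :: "'r hc" where "f = hc_scale qq (c_gen i) + c_gen (Suc i)"
  have "(c_q a b :: 'r hc) = e + (\<Sum>t \<in> {i, Suc i}. hc_scale (qq ^ (b - t)) (c_gen t))"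
    unfolding c_q_def e_def using i by (intro sum.subset_diff) auto
  also have "\<dots> = e + hc_scale (qq ^ (b - Suc i)) f"
    using i by (simp add: f_def hc.scale_right_distrib Suc_diff_Suc flip: power_Suc2)
  finally have c_q: "(c_q a b :: 'r hc) = e + hc_scale (qq ^ (b - Suc i)) f" .
  have "T_gen i * e = e * T_gen i"
    unfolding e_def sum_distrib_left sum_distrib_right
    by (intro sum.cong) (auto simp: hc_scale_mult T_c_commute)
  then have "y * e * T_gen i = y * T_gen i * e" by (simp add: mult.assoc)
  then have e: "y * e * T_gen i = hc_scale qq (y * e)" by (simp add: y hc_scale_mult)
  have "f * T_gen i = T_gen i * (hc_scale qq (c_gen (Suc i)) + c_gen i) +
      hc_scale (qq * (qq - 1)) (c_gen i - c_gen (Suc i))"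
    by (simp add: f_def distrib_right distrib_left hc_scale_mult c_T_same[OF i(1)]
        T_c_same[OF i(1)] hc.scale_right_distrib add_ac)
  then have "y * f * T_gen i = y * T_gen i * (hc_scale qq (c_gen (Suc i)) + c_gen i) +
      y * hc_scale (qq * (qq - 1)) (c_gen i - c_gen (Suc i))"
    by (simp add: mult.assoc distrib_left)
  also have "\<dots> = hc_scale qq (y * f)"
    by (simp add: y f_def hc_scale_mult distrib_left right_diff_distrib hc.scale_right_distrib
        hc.scale_left_diff_distrib hc.scale_right_diff_distrib algebra_simps)
  finally have "y * f * T_gen i = hc_scale qq (y * f)" .
  then show ?thesis
    by (simp add: c_q distrib_left distrib_right hc_scale_mult e hc.scale_right_distrib mult.commute)
qed

definition c_block :: "nat list \<Rightarrow> nat \<Rightarrow> 'r hc" where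
  "c_block \<nu> k = c_q (sum_list (take k \<nu>) + 1) (sum_list (take (Suc k) \<nu>))"

text \<open>The element c_\<nu>^\<alpha>, encoded by the list of the blocks in which \<alpha> is 1;
  a list, because the order of the factors matters.\<close>

definition c_blocks :: "nat list \<Rightarrow> nat list \<Rightarrow> 'r hc" where
  "c_blocks \<nu> K = prod_list (map (c_block \<nu>) K)"

lemma c_blocks_simps [simp]:
  "c_blocks \<nu> [] = 1" "c_blocks \<nu> (k # K) = c_block \<nu> k * c_blocks \<nu> K"
  "c_blocks \<nu> (K @ K') = c_blocks \<nu> K * c_blocks \<nu> K'"
  by (simp_all add: c_blocks_def)

lemma prod_list_map_power_01:
  assumes "\<And>k. k \<in> set K \<Longrightarrow> \<alpha> k \<in> {0, 1 :: nat}"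
  shows "prod_list (map (\<lambda>k. f k ^ \<alpha> k) K) = prod_list (map f (filter (\<lambda>k. \<alpha> k = 1) K))"
  using assms
proof (induction K)
  case (Cons k K)
  then have "\<alpha> k = 0 \<or> \<alpha> k = 1" by auto
  then show ?case using Cons.IH Cons.prems by (elim disjE) simp_all
qed simp

lemma c_comp_eq_c_blocks:
  assumes "\<And>k. k < length \<nu> \<Longrightarrow> \<alpha> ! k \<in> {0, 1}"
  shows "c_comp \<nu> \<alpha> = c_blocks \<nu> (filter (\<lambda>k. \<alpha> ! k = 1) [0..<length \<nu>])"
  unfolding c_comp_def c_blocks_def c_block_def
  by (rule prod_list_map_power_01) (use assms in auto)

lemma T_c_block_commute:
  assumes "i \<in> block \<nu> k" "Suc i \<in> block \<nu> k" "j \<noteq> k"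
  shows "T_gen i * (c_block \<nu> j :: 'r hc) = c_block \<nu> j * T_gen i"
  unfolding c_block_def using assms block_unique[of _ \<nu> k j]
  by (intro T_c_q_commute; fold block_def; blast)

lemma T_c_blocks_commute:
  assumes "i \<in> block \<nu> k" "Suc i \<in> block \<nu> k" "k \<notin> set K"
  shows "T_gen i * (c_blocks \<nu> K :: 'r hc) = c_blocks \<nu> K * T_gen i"
  using assms(3)
proof (induction K)
  case (Cons j K)
  have "T_gen i * (c_blocks \<nu> (j # K) :: 'r hc) = c_block \<nu> j * (T_gen i * c_blocks \<nu> K)"
    using Cons.prems by (simp add: mult.assoc mult_rewrite_assoc[OF T_c_block_commute[OF assms(1,2)]])
  then show ?case using Cons by (simp add: mult.assoc)
qed simp

text \<open>A simple reflection of S_\<nu> moves points of exactly one block k, and T_i commutes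
  with the factors of all other blocks. So it travels left until it meets y or, if k occurs in K,
  the single factor of block k, whose weights are made to let it act as q.\<close>

lemma right_invariant_c_blocks:
  assumes sum_\<nu>: "sum_list \<nu> = CARD('r)" and y: "right_invariant \<nu> (y :: 'r hc)" and "distinct K"
  shows "right_invariant \<nu> (y * c_blocks \<nu> K)"
  unfolding right_invariant_def
proof (intro allI impI)
  fix i assume sb: "same_block \<nu> i"
  then obtain k where k: "k < length \<nu>" "i \<in> block \<nu> k" "Suc i \<in> block \<nu> k"
    by (auto simp: same_block_def)
  note yT = right_invariantD[OF y sb]
  show "y * c_blocks \<nu> K * T_gen i = hc_scale qq (y * c_blocks \<nu> K)"
  proof (cases "k \<in> set K")
    case False
    have "y * c_blocks \<nu> K * T_gen i = y * T_gen i * c_blocks \<nu> K"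
      by (simp add: mult.assoc T_c_blocks_commute[OF k(2,3) False])
    then show ?thesis by (simp add: yT hc_scale_mult)
  next
    case True
    then obtain K1 K2 where K: "K = K1 @ k # K2" by (auto dest: split_list)
    then have nin: "k \<notin> set K1" "k \<notin> set K2" using assms(3) by auto
    define z where "z = y * c_blocks \<nu> K1"
    have "z * T_gen i = y * T_gen i * c_blocks \<nu> K1"
      by (simp add: z_def mult.assoc T_c_blocks_commute[OF k(2,3) nin(1)])
    then have zT: "z * T_gen i = hc_scale qq z" by (simp add: yT hc_scale_mult z_def)
    have "z * c_block \<nu> k * T_gen i = hc_scale qq (z * c_block \<nu> k)"
      unfolding c_block_def
      by (rule invariant_mult_c_q[OF same_block_range'[OF sum_\<nu> sb] _ _ zT])
        (use k in \<open>simp_all add: block_def\<close>)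
    moreover have "y * c_blocks \<nu> K * T_gen i = z * c_block \<nu> k * T_gen i * c_blocks \<nu> K2"
      by (simp add: K z_def mult.assoc T_c_blocks_commute[OF k(2,3) nin(2)])
    ultimately show ?thesis by (simp add: K z_def hc_scale_mult mult.assoc)
  qed
qed

section \<open>Clifford words between a right and a left invariant\<close>

locale invariant_pair =
  fixes \<nu> :: "nat list" and y x :: "'r hc"
  assumes sum_\<nu>: "sum_list \<nu> = CARD('r)"
    and right_inv: "right_invariant \<nu> y"
    and left_inv: "\<And>i. same_block \<nu> i \<Longrightarrow> T_gen i * x = hc_scale qq x"
begin

text \<open>A factor q at x is written as T_i, moved left through b, turned into the lower index by
  c_{i+1} T_i = T_i c_i, moved through a and absorbed by y as q again; finally q is divided
  out.\<close>

lemma shift_index: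
  assumes sb: "same_block \<nu> i" and "T_gen i * a = a * T_gen i" "T_gen i * b = b * T_gen i"
  shows "y * a * c_gen (Suc i) * b * x = y * a * c_gen i * b * x"
proof -
  have "hc_scale qq (y * a * c_gen (Suc i) * b * x) = y * a * c_gen (Suc i) * b * (T_gen i * x)"
    by (simp add: left_inv[OF sb] hc_scale_mult)
  also have "\<dots> = y * a * (c_gen (Suc i) * T_gen i) * b * x"
    using assms(3) by (simp add: mult.assoc[symmetric]) (simp add: mult.assoc assms(3))
  also have "\<dots> = y * (a * T_gen i) * c_gen i * b * x"
    using T_c_same[OF same_block_range'[OF sum_\<nu> sb]] by (simp add: mult.assoc[symmetric])
      (simp add: mult.assoc)
  also have "\<dots> = (y * T_gen i) * a * c_gen i * b * x"
    using assms(2) by (simp add: mult.assoc)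
  also have "\<dots> = hc_scale qq (y * a * c_gen i * b * x)"
    by (simp add: right_invariantD[OF right_inv sb] hc_scale_mult)
  finally show ?thesis using qq_neq_0 by simp
qed

text \<open>For P = c_i c_{i+1} the relations give P T_i = - T_i P + (q - 1) (P - 1). Between y and
  x, where T_i counts as q, this reads q P = - q P + (q - 1) (P - 1), so (q + 1) P = - (q - 1):
  hence the constant.\<close>

lemma cancel_pair:
  assumes sb: "same_block \<nu> i" and "T_gen i * a = a * T_gen i"
  shows "y * a * c_gen i * c_gen (Suc i) * x = hc_scale (- (qq - 1) / (qq + 1)) (y * a * x)"
proof -
  have i: "i \<in> {1..<CARD('r)}" by (rule same_block_range'[OF sum_\<nu> sb])
  let ?P = "c_gen i * c_gen (Suc i) :: 'r hc"
  have "?P * T_gen i = c_gen i * (c_gen (Suc i) * T_gen i)" by (simp add: mult.assoc)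
  also have "\<dots> = c_gen i * T_gen i * c_gen i" by (simp add: T_c_same[OF i] flip: mult.assoc)
      (simp add: mult.assoc T_c_same[OF i])
  also have "\<dots> = T_gen i * (c_gen (Suc i) * c_gen i) +
      hc_scale (qq - 1) (c_gen i * c_gen i - c_gen (Suc i) * c_gen i)"
    by (simp add: c_T_same[OF i] distrib_right left_diff_distrib hc_scale_mult mult.assoc)
  also have "\<dots> = - (T_gen i * ?P) + hc_scale (qq - 1) (?P - 1)"
    using i by (simp add: c_gen_anticommute[of "Suc i" i] c_gen_square algebra_simps)
  finally have PT: "?P * T_gen i = - (T_gen i * ?P) + hc_scale (qq - 1) (?P - 1)" .
  have "hc_scale qq (y * a * ?P * x) = y * a * (?P * T_gen i) * x"
    using left_inv[OF sb] by (simp add: mult.assoc hc_scale_mult)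
  also have "\<dots> = - (y * (a * T_gen i) * ?P * x) + hc_scale (qq - 1) (y * a * ?P * x - y * a * x)"
    unfolding PT by (simp add: distrib_left distrib_right left_diff_distrib right_diff_distrib
        hc_scale_mult mult.assoc)
  also have "y * (a * T_gen i) * ?P * x = hc_scale qq (y * a * ?P * x)"
    using right_invariantD[OF right_inv sb]
    by (simp add: assms(2)[symmetric] mult.assoc[symmetric] hc_scale_mult)
  finally have "hc_scale qq (y * a * ?P * x) =
      - hc_scale qq (y * a * ?P * x) + hc_scale (qq - 1) (y * a * ?P * x - y * a * x)" .
  then have "hc_scale (qq + 1) (y * a * ?P * x) = hc_scale (- (qq - 1)) (y * a * x)"
    by (simp add: hc.scale_left_distrib hc.scale_left_diff_distrib hc.scale_right_diff_distrib
        algebra_simps)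
  then have "hc_scale (1 / (qq + 1)) (hc_scale (qq + 1) (y * a * ?P * x)) =
      hc_scale (1 / (qq + 1)) (hc_scale (- (qq - 1)) (y * a * x))" by simp
  then show ?thesis using qq_plus_1_neq_0 by (simp add: mult.assoc)
qed

text \<open>This index lies in block k only if the block is nonempty; otherwise it points behind it.
  Membership is therefore stated as a condition wherever the index stands for its block.\<close>

definition first_index :: "nat \<Rightarrow> nat" where
  "first_index k = sum_list (take k \<nu>) + 1"

lemma shift_to_first:
  assumes k: "k < length \<nu>" and t: "t \<in> block \<nu> k"
    and comm: "\<And>i. i \<in> block \<nu> k \<Longrightarrow> Suc i \<in> block \<nu> k \<Longrightarrow>
      T_gen i * a = a * T_gen i \<and> T_gen i * b = b * T_gen i"
  shows "y * a * c_gen t * b * x = y * a * c_gen (first_index k) * b * x"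
  using t
proof (induction t)
  case (Suc t)
  show ?case
  proof (cases "t \<in> block \<nu> k")
    case True
    then have "same_block \<nu> t" using k Suc.prems by (auto simp: same_block_def)
    then show ?thesis using shift_index comm[OF True Suc.prems] Suc.IH[OF True] by metis
  next
    case False
    then have "Suc t = first_index k" using Suc.prems by (auto simp: block_def first_index_def)
    then show ?thesis by simp
  qed
qed (simp add: block_def)

text \<open>Every c_t of a block may be lowered to the first index, so between y and x the factor of
  a block is a single Clifford generator times a nonzero sum of powers of q. The factors are
  replaced from left to right; K1 holds those already done.\<close>

lemma c_blocks_proportional:
  assumes "distinct (K1 @ K2)"
    "\<And>k. k \<in> set (K1 @ K2) \<Longrightarrow> k < length \<nu> \<and> first_index k \<in> block \<nu> k"
  shows "\<exists>a. a \<noteq> 0 \<and> y * c_word (map first_index K1) * c_blocks \<nu> K2 * x =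
    hc_scale a (y * c_word (map first_index (K1 @ K2)) * x)"
  using assms
proof (induction K2 arbitrary: K1)
  case Nil
  show ?case by (intro exI[of _ 1]) simp
next
  case (Cons k K2)
  have k: "k < length \<nu>" "first_index k \<in> block \<nu> k" using Cons.prems by auto
  have nin: "k \<notin> set K1" "k \<notin> set K2" using Cons.prems(1) by auto
  let ?a = "c_word (map first_index K1) :: 'r hc" and ?b = "c_blocks \<nu> K2 :: 'r hc"
  have "T_gen i * ?a = ?a * T_gen i \<and> T_gen i * ?b = ?b * T_gen i"
    if i: "i \<in> block \<nu> k" "Suc i \<in> block \<nu> k" for i
  proof
    have "first_index j \<notin> block \<nu> k" if "j \<in> set K1" for j
      using that block_unique[of "first_index j" \<nu> j k] Cons.prems(2)[of j] nin by auto
    then show "T_gen i * ?a = ?a * T_gen i" using i by (intro T_c_word_commute) auto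
  qed (rule T_c_blocks_commute[OF i nin(2)])
  from shift_to_first[OF k(1) _ this]
  have shift: "y * ?a * c_gen t * ?b * x = y * ?a * c_gen (first_index k) * ?b * x"
    if "t \<in> block \<nu> k" for t using that by blast
  define s where "s = sum_list (take (Suc k) \<nu>)"
  have "y * ?a * c_blocks \<nu> (k # K2) * x = y * ?a * c_block \<nu> k * ?b * x"
    by (simp add: mult.assoc)
  also have "\<dots> = (\<Sum>t \<in> block \<nu> k. hc_scale (qq ^ (s - t)) (y * ?a * c_gen t * ?b * x))"
    by (simp add: c_block_def c_q_def block_def s_def sum_distrib_left sum_distrib_right hc_scale_mult)
  also have "\<dots> = hc_scale (\<Sum>t \<in> block \<nu> k. qq ^ (s - t)) (y * ?a * c_gen (first_index k) * ?b * x)"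
    by (simp add: shift hc.scale_sum_left)
  also have "y * ?a * c_gen (first_index k) * ?b * x = y * c_word (map first_index (K1 @ [k])) * ?b * x"
    by (simp add: mult.assoc)
  finally have 1: "y * ?a * c_blocks \<nu> (k # K2) * x = hc_scale (\<Sum>t \<in> block \<nu> k. qq ^ (s - t))
      (y * c_word (map first_index (K1 @ [k])) * ?b * x)" .
  obtain a where a: "a \<noteq> 0" "y * c_word (map first_index (K1 @ [k])) * ?b * x =
      hc_scale a (y * c_word (map first_index ((K1 @ [k]) @ K2)) * x)"
    using Cons.IH[of "K1 @ [k]"] Cons.prems by auto
  have "(\<Sum>t \<in> block \<nu> k. qq ^ (s - t)) \<noteq> 0"
    by (rule sum_qq_power_neq_0) (use k(2) in \<open>auto simp: block_def\<close>)
  then show ?case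
    unfolding 1 a by (intro exI[of _ "(\<Sum>t \<in> block \<nu> k. qq ^ (s - t)) * a"]) (simp add: a(1))
qed

text \<open>A generator is a choice S of blocks, multiplied in increasing order. Only nonempty
  blocks may be chosen: they correspond to the positive matrix entries, which are the ones that can
  have an odd part.\<close>

definition block_span :: "'r hc set" where
  "block_span = hc.span {y * c_blocks \<nu> (filter S [0..<length \<nu>]) * x | S.
    \<forall>k < length \<nu>. S k \<longrightarrow> block \<nu> k \<noteq> {}}"

text \<open>Induction on the length plus the sum of the letters. A repeated letter is removed by
  c_p^2 = -1, a pair p, p+1 within a block by \<open>cancel_pair\<close>, and a letter p+1 whose
  predecessor lies in the same block but is absent from the word is lowered to p. When none of this
  applies, each letter is the first index of its block and the word is proportional to a product of
  the c_{q,i,j}.\<close>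

lemma c_word_block_span:
  assumes "set l \<subseteq> {1..CARD('r)}"
  shows "y * c_word l * x \<in> block_span"
  using assms
proof (induction "length l + sum_list l" arbitrary: l rule: less_induct)
  case less
  have scale: "y * hc_scale \<epsilon> h * x \<in> block_span" if "y * h * x \<in> block_span" for \<epsilon> h
    using that by (simp add: hc_scale_mult block_span_def hc.span_scale)
  have perm: "y * c_word l * x \<in> block_span"
    if "mset l = mset l'" "y * c_word l' * x \<in> block_span" for l'
    using c_word_mset[OF that(1)] scale[OF that(2)] by (metis (no_types, lifting))
  have measure: "length l + sum_list l = length l' + sum_list l'" "set l = set l'"
    if "mset l = mset l'" for l'
    using that mset_eq_length mset_eq_setD sum_mset_sum_list by metis+
  consider (dup) "\<not> distinct l" | (pair) p where "same_block \<nu> p" "p \<in> set l" "Suc p \<in> set l" "distinct l"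
    | (shift) p where "same_block \<nu> p" "p \<notin> set l" "Suc p \<in> set l" "distinct l"
    | (first) "distinct l" "\<And>p. Suc p \<in> set l \<Longrightarrow> \<not> same_block \<nu> p"
    by blast
  then show ?case
  proof cases
    case dup
    then obtain l1 l2 l3 p where l: "l = l1 @ [p] @ l2 @ [p] @ l3"
      using not_distinct_decomp by blast
    define l' where "l' = l1 @ l2 @ l3"
    have m: "mset l = mset (l' @ [p, p])" by (simp add: l l'_def)
    have p: "p \<in> {1..CARD('r)}" "set l' \<subseteq> {1..CARD('r)}" using less.prems by (auto simp: l l'_def)
    have "c_word (l' @ [p, p]) = hc_scale (- 1) (c_word l' :: 'r hc)"
      using c_gen_square[OF p(1)] by (simp add: hc.scale_minus_left)
    moreover have "y * c_word l' * x \<in> block_span"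
      by (rule less.hyps[OF _ p(2)]) (simp add: measure(1)[OF m])
    ultimately show ?thesis using perm[OF m] scale by metis
  next
    case pair
    define l' where "l' = remove1 (Suc p) (remove1 p l)"
    have m: "mset l = mset (l' @ [p, Suc p])"
    proof -
      have 1: "add_mset p (mset l - {#p#}) = mset l" using pair(2) by (simp add: insert_DiffM)
      have 2: "add_mset (Suc p) (mset l - {#p#} - {#Suc p#}) = mset l - {#p#}"
        by (rule insert_DiffM) (use pair(3) in \<open>simp add: in_diff_count\<close>)
      have "mset l' = mset l - {#p#} - {#Suc p#}" by (simp only: l'_def mset_remove1)
      moreover have "mset (l' @ [p, Suc p]) = add_mset p (add_mset (Suc p) (mset l'))" by simp
      ultimately show ?thesis by (simp only: 1 2)
    qed
    have l': "set l' \<subseteq> {1..CARD('r)}" "p \<notin> set l'" "Suc p \<notin> set l'"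
      using measure(2)[OF m] less.prems pair(4) by (auto simp: l'_def)
    have "y * c_word (l' @ [p, Suc p]) * x = hc_scale (- (qq - 1) / (qq + 1)) (y * c_word l' * x)"
      using cancel_pair[OF pair(1) T_c_word_commute[OF l'(2,3)]] by (simp add: mult.assoc)
    moreover have "y * c_word l' * x \<in> block_span"
      by (rule less.hyps[OF _ l'(1)]) (simp add: measure(1)[OF m])
    ultimately show ?thesis using perm[OF m] by (simp add: block_span_def hc.span_scale)
  next
    case shift
    define l' where "l' = remove1 (Suc p) l"
    have m: "mset l = mset (l' @ [Suc p])"
      using shift by (simp add: l'_def)
    have l': "set l' \<subseteq> {1..CARD('r)}" "p \<notin> set l'" "Suc p \<notin> set l'"
      using measure(2)[OF m] less.prems shift(2,4) by (auto simp: l'_def)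
    have "y * c_word (l' @ [Suc p]) * x = y * c_word (l' @ [p]) * x"
      using shift_index[OF shift(1) T_c_word_commute[OF l'(2,3)], of 1] by (simp add: mult.assoc)
    moreover have "y * c_word (l' @ [p]) * x \<in> block_span"
      by (rule less.hyps) (use same_block_range'[OF sum_\<nu> shift(1)] l'(1) in
          \<open>simp_all add: measure(1)[OF m]\<close>)
    ultimately show ?thesis using perm[OF m] by simp
  next
    case first
    define S where "S k \<longleftrightarrow> first_index k \<in> block \<nu> k \<and> first_index k \<in> set l" for k
    define K where "K = filter S [0..<length \<nu>]"
    have inj: "inj_on first_index (set K)"
    proof (rule inj_onI)
      fix j k assume "j \<in> set K" "k \<in> set K" "first_index j = first_index k"
      then have "first_index j \<in> block \<nu> j" "first_index j \<in> block \<nu> k" by (simp_all add: K_def S_def)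
      then show "j = k" by (rule block_unique)
    qed
    have "set (map first_index K) = set l"
    proof (intro equalityI subsetI)
      fix p assume p: "p \<in> set l"
      then have "p \<in> {1..sum_list \<nu>}" using less.prems sum_\<nu> by auto
      then obtain k where k: "k < length \<nu>" "p \<in> block \<nu> k" using block_cover by blast
      have "p = first_index k"
      proof (rule ccontr)
        assume "p \<noteq> first_index k"
        then have "p - 1 \<in> block \<nu> k" "Suc (p - 1) = p" using k by (auto simp: block_def first_index_def)
        then have "same_block \<nu> (p - 1)" using k by (auto simp: same_block_def)
        then show False using first(2)[of "p - 1"] p \<open>Suc (p - 1) = p\<close> by simp
      qed
      then show "p \<in> set (map first_index K)" using k p by (auto simp: K_def S_def)
    qed (auto simp: K_def S_def)
    then have m: "mset l = mset (map first_index K)"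
      using first(1) inj by (subst set_eq_iff_mset_eq_distinct[symmetric]) (auto simp: distinct_map K_def)
    have "distinct ([] @ K)" "\<And>k. k \<in> set ([] @ K) \<Longrightarrow> k < length \<nu> \<and> first_index k \<in> block \<nu> k"
      by (simp_all add: K_def S_def)
    from c_blocks_proportional[OF this] obtain a where
      a: "a \<noteq> 0" "y * c_blocks \<nu> K * x = hc_scale a (y * c_word (map first_index K) * x)"
      unfolding list.map(1) c_word_simps(1) mult_1_right append_Nil by blast
    have "y * c_blocks \<nu> K * x \<in> block_span"
      unfolding K_def block_span_def by (rule hc.span_base) (auto simp: S_def)
    then have "hc_scale (1 / a) (y * c_blocks \<nu> K * x) \<in> block_span"
      by (simp add: block_span_def hc.span_scale)
    then have "y * c_word (map first_index K) * x \<in> block_span"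
      by (simp add: a)
    then show ?thesis by (rule perm[OF m])
  qed
qed

lemma clifford_block_span:
  assumes "h \<in> clifford"
  shows "y * h * x \<in> block_span"
proof -
  have "y * c_word l * x \<in> block_span" for l
  proof (cases "set l \<subseteq> {1..CARD('r)}")
    case False
    then obtain p where "p \<in> set l" "p \<notin> {1..CARD('r)}" by blast
    then have "(c_word l :: 'r hc) = 0" by (auto simp: c_gen_out dest!: split_list)
    then show ?thesis by (simp add: block_span_def hc.span_zero)
  qed (rule c_word_block_span)
  then have "y * h \<in> {z. z * x \<in> block_span}"
    using assms unfolding clifford_def
    by (intro hc_span_mult_left[OF assms[unfolded clifford_def]])
      (auto simp: hc.subspace_def block_span_def distrib_right hc_scale_mult hc.span_zero
        hc.span_add hc.span_scale)
  then show ?thesis by simp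
qed

end

section \<open>Minimal double coset representatives\<close>

lemma downward_closed_eq_interval:
  fixes D :: "nat set"
  assumes "D \<subseteq> {m + 1..M}" "\<And>x y. x \<in> D \<Longrightarrow> y \<in> {m + 1..x} \<Longrightarrow> y \<in> D"
  shows "D = {m + 1..m + card D}"
proof (cases "D = {}")
  case False
  have fin: "finite D" using assms(1) finite_subset by blast
  have "D = {m + 1..Max D}"
  proof (intro equalityI subsetI)
    fix x assume "x \<in> D"
    then show "x \<in> {m + 1..Max D}" using assms(1) Max_ge[OF fin] by auto
  next
    fix x assume "x \<in> {m + 1..Max D}"
    then show "x \<in> D" using assms(2)[OF Max_in[OF fin False]] by simp
  qed
  moreover from this have "card D = Max D - m" by (metis card_atLeastAtMost add_diff_cancel_right diff_Suc_Suc Suc_eq_plus1)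
  moreover have "Max D > m" using assms(1) Max_in[OF fin False] by auto
  ultimately show ?thesis by simp
qed simp

text \<open>The union of the first k sets is an initial segment of the interval, hence known from
  its cardinality; X i is the difference of two of these segments.\<close>

lemma ordered_partition_interval:
  fixes X :: "nat \<Rightarrow> nat set"
  assumes union: "(\<Union>i<N. X i) = {m + 1..M}"
    and less: "\<And>i j x y. i < j \<Longrightarrow> j < N \<Longrightarrow> x \<in> X i \<Longrightarrow> y \<in> X j \<Longrightarrow> x < y"
    and i: "i < N"
  shows "X i = {m + (\<Sum>j<i. card (X j)) + 1..m + (\<Sum>j<Suc i. card (X j))}"
proof -
  have sub: "X j \<subseteq> {m + 1..M}" if "j < N" for j using union that by auto
  have D: "(\<Union>j<k. X j) = {m + 1..m + (\<Sum>j<k. card (X j))}" if k: "k \<le> N" for k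
  proof -
    have "(\<Union>j<k. X j) = {m + 1..m + card (\<Union>j<k. X j)}"
    proof (rule downward_closed_eq_interval)
      show "(\<Union>j<k. X j) \<subseteq> {m + 1..M}" by (rule UN_least, rule sub) (use k in simp)
      fix x y assume "x \<in> (\<Union>j<k. X j)" and y: "y \<in> {m + 1..x}"
      then obtain j where j: "j < k" "x \<in> X j" by auto
      then have "y \<in> {m + 1..M}" using sub[of j] y k by fastforce
      then obtain l where l: "l < N" "y \<in> X l" using union by blast
      have "l < k"
      proof (rule ccontr)
        assume "\<not> l < k"
        then have "x < y" using less[of j l x y] j l by auto
        then show False using y by auto
      qed
      then show "y \<in> (\<Union>j<k. X j)" using l by auto
    qed
    moreover have "card (\<Union>j<k. X j) = (\<Sum>j<k. card (X j))"
    proof (rule card_UN_disjoint)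
      show "\<forall>j\<in>{..<k}. finite (X j)"
      proof
        fix j assume "j \<in> {..<k}"
        then have "X j \<subseteq> {m + 1..M}" using k by (intro sub) simp
        then show "finite (X j)" by (rule finite_subset) simp
      qed
      show "\<forall>j\<in>{..<k}. \<forall>l\<in>{..<k}. j \<noteq> l \<longrightarrow> X j \<inter> X l = {}"
      proof (intro ballI impI)
        fix j l assume *: "j \<in> {..<k}" "l \<in> {..<k}" "j \<noteq> l"
        have "x \<notin> X l" if "x \<in> X j" for x
        proof
          assume "x \<in> X l"
          then show False
            using less[of j l x x] less[of l j x x] that * k by (cases j l rule: linorder_cases) auto
        qed
        then show "X j \<inter> X l = {}" by blast
      qed
    qed simp
    ultimately show ?thesis by simp
  qed
  have "x \<notin> X j" if "x \<in> X i" "j < i" for x j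
    using less[OF that(2) i, of x x] that(1) by auto
  then have "X i \<inter> (\<Union>j<i. X j) = {}" by blast
  then have "X i = (\<Union>j<Suc i. X j) - (\<Union>j<i. X j)"
    by (simp add: lessThan_Suc Un_Diff Diff_triv)
  also have "\<dots> = {m + 1..m + (\<Sum>j<Suc i. card (X j))} - {m + 1..m + (\<Sum>j<i. card (X j))}"
    using D[of "Suc i"] D[of i] i by (simp only: Suc_leI less_imp_le)
  also have "\<dots> = {m + (\<Sum>j<i. card (X j)) + 1..m + (\<Sum>j<Suc i. card (X j))}"
    by auto
  finally show ?thesis .
qed

text \<open>No descent at a simple reflection of S_\<mu> on the right nor of S_\<kappa> on the left:
  a local condition that shortest double coset elements satisfy and that can be checked at single
  reflections.\<close>

definition doubly_reduced :: "nat list \<Rightarrow> nat list \<Rightarrow> (nat \<Rightarrow> nat) \<Rightarrow> bool" where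
  "doubly_reduced \<kappa> \<mu> d \<longleftrightarrow> d permutes {1..sum_list \<mu>} \<and>
    (\<forall>i. same_block \<mu> i \<longrightarrow> d i < d (Suc i)) \<and>
    (\<forall>i. same_block \<kappa> i \<longrightarrow> inv d i < inv d (Suc i))"

text \<open>d is increasing on the block of \<mu>, so points sent to an earlier block of \<kappa>
  precede those sent to a later one, and an ordered partition of an interval is fixed by the sizes
  of its parts.\<close>

lemma doubly_reduced_fibre:
  assumes d: "doubly_reduced \<kappa> \<mu> d" and sums: "sum_list \<kappa> = sum_list \<mu>"
    and i: "i < length \<kappa>" and j: "j < length \<mu>"
  defines "a \<equiv> \<lambda>i. card (block \<kappa> i \<inter> d ` block \<mu> j)"
  shows "{x \<in> block \<mu> j. d x \<in> block \<kappa> i} =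
    {sum_list (take j \<mu>) + (\<Sum>i'<i. a i') + 1..sum_list (take j \<mu>) + (\<Sum>i'<Suc i. a i')}"
proof -
  define X where "X i = {x \<in> block \<mu> j. d x \<in> block \<kappa> i}" for i
  have dp: "d permutes {1..sum_list \<mu>}" using d by (simp add: doubly_reduced_def)
  have "card (X i) = a i" for i
  proof -
    have "d ` X i = block \<kappa> i \<inter> d ` block \<mu> j" by (auto simp: X_def)
    moreover have "card (d ` X i) = card (X i)"
      by (rule card_image[OF inj_on_subset[OF permutes_inj[OF dp]]]) simp
    ultimately show ?thesis by (simp add: a_def)
  qed
  moreover have "X i = {sum_list (take j \<mu>) + (\<Sum>i'<i. card (X i')) + 1
      ..sum_list (take j \<mu>) + (\<Sum>i'<Suc i. card (X i'))}"
  proof (rule ordered_partition_interval[OF _ _ i])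
    have "x \<in> (\<Union>i<length \<kappa>. X i)" if x: "x \<in> block \<mu> j" for x
    proof -
      have "d x \<in> {1..sum_list \<kappa>}"
        using block_subset x permutes_in_image[OF dp] sums by fastforce
      then show ?thesis using block_cover x by (auto simp: X_def)
    qed
    then show "(\<Union>i<length \<kappa>. X i) = {sum_list (take j \<mu>) + 1..sum_list (take (Suc j) \<mu>)}"
      by (auto simp: X_def block_def)
  next
    fix i i' x y assume *: "i < i'" "i' < length \<kappa>" "x \<in> X i" "y \<in> X i'"
    show "x < y"
    proof (rule ccontr)
      assume "\<not> x < y"
      moreover have "x \<noteq> y"
      proof
        assume "x = y"
        then have "d x \<in> block \<kappa> i" "d x \<in> block \<kappa> i'" using * by (simp_all add: X_def)
        then show False using block_unique \<open>i < i'\<close> by blast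
      qed
      ultimately have gt: "y < x" by simp
      have asc: "same_block \<mu> i \<Longrightarrow> d i < d (Suc i)" for i
        using d by (simp add: doubly_reduced_def)
      have xy: "x \<in> block \<mu> j" "y \<in> block \<mu> j" using * by (simp_all add: X_def)
      have "d y < d x"
        by (rule increasing_on_block[where f = d, OF asc j xy(2,1) gt])
      then show False using block_less[of "d x" \<kappa> i "d y" i'] * by (auto simp: X_def)
    qed
  qed
  ultimately show ?thesis by (simp add: X_def)
qed

text \<open>By the fibres, d x and d' x always lie in the same block of \<kappa>. Inside such a
  block the values are ordered like their preimages, for both permutations; so d' composed with the
  inverse of d is increasing, thus the identity.\<close>

lemma doubly_reduced_unique:
  assumes d: "doubly_reduced \<kappa> \<mu> d" and d': "doubly_reduced \<kappa> \<mu> d'"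
    and sums: "sum_list \<kappa> = sum_list \<mu>"
    and counts: "\<And>i j. i < length \<kappa> \<Longrightarrow> j < length \<mu> \<Longrightarrow>
      card (block \<kappa> i \<inter> d ` block \<mu> j) = card (block \<kappa> i \<inter> d' ` block \<mu> j)"
  shows "d = d'"
proof -
  have dp: "d permutes {1..sum_list \<mu>}" and dp': "d' permutes {1..sum_list \<mu>}"
    using d d' by (simp_all add: doubly_reduced_def)
  have row: "d x \<in> block \<kappa> i \<longleftrightarrow> d' x \<in> block \<kappa> i" if x: "x \<in> {1..sum_list \<mu>}" and i: "i < length \<kappa>" for x i
  proof -
    obtain j where j: "j < length \<mu>" "x \<in> block \<mu> j" using block_cover x by blast
    have "{x \<in> block \<mu> j. d x \<in> block \<kappa> i} = {x \<in> block \<mu> j. d' x \<in> block \<kappa> i}"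
      unfolding doubly_reduced_fibre[OF d sums i j(1)] doubly_reduced_fibre[OF d' sums i j(1)]
      using counts[OF _ j(1)] i by simp
    then show ?thesis using j by blast
  qed
  have less: "d' x < d' y" if x: "x \<in> {1..sum_list \<mu>}" and y: "y \<in> {1..sum_list \<mu>}" and "d x < d y" for x y
  proof -
    have "d x \<in> {1..sum_list \<kappa>}" "d y \<in> {1..sum_list \<kappa>}"
      using permutes_in_image[OF dp] x y sums by metis+
    then obtain k l where k: "k < length \<kappa>" "d x \<in> block \<kappa> k" and l: "l < length \<kappa>" "d y \<in> block \<kappa> l"
      using block_cover by metis
    have k': "d' x \<in> block \<kappa> k" and l': "d' y \<in> block \<kappa> l" using row x y k l by blast+
    consider "k < l" | "l < k" | "k = l" by linarith
    then show ?thesis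
    proof cases
      case 1
      then show ?thesis using block_less[OF k' l'] by simp
    next
      case 2
      then show ?thesis using block_less[OF l(2) k(2)] \<open>d x < d y\<close> by simp
    next
      case 3
      have asc: "same_block \<kappa> i \<Longrightarrow> inv d i < inv d (Suc i)" for i
        using d by (simp add: doubly_reduced_def)
      have "inv d (d x) < inv d (d y)"
        by (rule increasing_on_block[where f = "inv d", OF asc k l(2)[folded 3] \<open>d x < d y\<close>])
      then have xy: "x < y" using permutes_inverses(2)[OF dp] by simp
      show ?thesis
      proof (rule ccontr)
        assume "\<not> d' x < d' y"
        moreover have "d' x \<noteq> d' y" using xy permutes_inj[OF dp'] by (simp add: inj_eq)
        ultimately have gt: "d' y < d' x" by simp
        have asc: "same_block \<kappa> i \<Longrightarrow> inv d' i < inv d' (Suc i)" for i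
          using d' by (simp add: doubly_reduced_def)
        have "inv d' (d' y) < inv d' (d' x)"
          by (rule increasing_on_block[where f = "inv d'", OF asc k(1) l'[folded 3] k' gt])
        then show False using xy permutes_inverses(2)[OF dp'] by simp
      qed
    qed
  qed
  have "d' \<circ> inv d = id"
  proof (rule permutes_increasing_eq_id[OF permutes_compose[OF permutes_inv[OF dp] dp']])
    fix i assume "i \<in> {1..<sum_list \<mu>}"
    then have "inv d i \<in> {1..sum_list \<mu>}" "inv d (Suc i) \<in> {1..sum_list \<mu>}"
      unfolding permutes_in_image[OF permutes_inv[OF dp]] by auto
    from less[OF this] show "(d' \<circ> inv d) i < (d' \<circ> inv d) (Suc i)"
      by (simp add: permutes_inverses(1)[OF dp])
  qed
  then have "(d' \<circ> inv d) \<circ> d = d" by simp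
  then show ?thesis using permutes_inv_o(2)[OF dp] by (simp add: o_assoc[symmetric])
qed

lemma double_coset_self: "d \<in> double_coset \<kappa> d \<mu>"
  unfolding double_coset_def by (intro CollectI exI[of _ id]) simp

lemma double_coset_trans:
  assumes "d \<in> double_coset \<kappa> w \<mu>"
  shows "double_coset \<kappa> d \<mu> \<subseteq> double_coset \<kappa> w \<mu>"
proof
  fix e assume "e \<in> double_coset \<kappa> d \<mu>"
  then obtain a b a' b' where *: "a \<in> young \<kappa>" "b \<in> young \<mu>" "e = a \<circ> d \<circ> b"
    "a' \<in> young \<kappa>" "b' \<in> young \<mu>" "d = a' \<circ> w \<circ> b'"
    using assms by (auto simp: double_coset_def)
  have "e = (a \<circ> a') \<circ> w \<circ> (b' \<circ> b)" by (simp add: * o_assoc)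
  then show "e \<in> double_coset \<kappa> w \<mu>"
    using young_comp[OF *(1,4)] young_comp[OF *(5,2)] unfolding double_coset_def by blast
qed

lemma double_coset_permutes:
  assumes "sum_list \<kappa> = r" "sum_list \<mu> = r" "w permutes {1..r}" "d \<in> double_coset \<kappa> w \<mu>"
  shows "d permutes {1..r}"
proof -
  obtain a b where "a \<in> young \<kappa>" "b \<in> young \<mu>" "d = a \<circ> w \<circ> b"
    using assms(4) by (auto simp: double_coset_def)
  then show ?thesis
    using young_permutes[of a \<kappa>] young_permutes[of b \<mu>] assms(1-3) by (simp add: permutes_compose)
qed

lemma double_coset_counts:
  assumes w: "w permutes {1..r}" and d: "d \<in> double_coset \<kappa> w \<mu>"
    and i: "i < length \<kappa>" and j: "j < length \<mu>"
  shows "card (block \<kappa> i \<inter> d ` block \<mu> j) = card (block \<kappa> i \<inter> w ` block \<mu> j)"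
proof -
  obtain a b where *: "a \<in> young \<kappa>" "b \<in> young \<mu>" "d = a \<circ> w \<circ> b"
    using d by (auto simp: double_coset_def)
  have inj: "inj a" using permutes_inj[OF young_permutes[OF *(1)]] .
  have "d ` block \<mu> j = a ` w ` b ` block \<mu> j" by (simp only: * image_comp o_assoc)
  also have "b ` block \<mu> j = block \<mu> j" using *(2) j by (simp add: young_def)
  finally have "block \<kappa> i \<inter> d ` block \<mu> j = a ` block \<kappa> i \<inter> a ` w ` block \<mu> j"
    using *(1) i by (simp add: young_def)
  also have "\<dots> = a ` (block \<kappa> i \<inter> w ` block \<mu> j)" by (rule image_Int[OF inj, symmetric])
  finally show ?thesis using inj by (simp add: card_image inj_on_subset)
qed

lemma doubly_reduced_if_minimal:
  assumes sums: "sum_list \<kappa> = r" "sum_list \<mu> = r" and d: "d permutes {1..r}"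
    and min: "\<forall>w \<in> double_coset \<kappa> d \<mu>. perm_length r d \<le> perm_length r w"
  shows "doubly_reduced \<kappa> \<mu> d"
  unfolding doubly_reduced_def
proof (intro conjI allI impI)
  show "d permutes {1..sum_list \<mu>}" using d sums by simp
next
  fix i assume i: "same_block \<mu> i"
  have "d \<circ> adj i \<in> double_coset \<kappa> d \<mu>"
    unfolding double_coset_def using transpose_young[OF i] id_young
    by (intro CollectI exI[of _ id] exI[of _ "adj i"]) simp
  then have le: "perm_length r d \<le> perm_length r (d \<circ> adj i)" using min by blast
  have "i \<in> {1..<r}" using same_block_range[OF i] sums by simp
  from perm_length_comp_transpose_desc[OF d this] le permutes_Suc_neq[OF d, of i]
  show "d i < d (Suc i)" by (cases "d (Suc i)" "d i" rule: linorder_cases) auto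
next
  fix i assume i: "same_block \<kappa> i"
  have "adj i \<circ> d \<in> double_coset \<kappa> d \<mu>"
    unfolding double_coset_def using transpose_young[OF i] id_young
    by (intro CollectI exI[of _ "adj i"] exI[of _ id]) simp
  then have le: "perm_length r d \<le> perm_length r (adj i \<circ> d)" using min by blast
  have "i \<in> {1..<r}" using same_block_range[OF i] sums by simp
  from perm_length_transpose_comp_desc[OF d this] le permutes_Suc_neq[OF permutes_inv[OF d], of i]
  show "inv d i < inv d (Suc i)" by (cases "inv d (Suc i)" "inv d i" rule: linorder_cases) auto
qed

text \<open>The fibres of \<rho> have the sizes of the blocks, so bijections between them glue to a
  permutation.\<close>

lemma ex_permutation_into_blocks:
  assumes card: "\<And>i. i < length \<kappa> \<Longrightarrow> card {x \<in> {1..sum_list \<kappa>}. \<rho> x = i} = card (block \<kappa> i)"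
    and \<rho>: "\<And>x. x \<in> {1..sum_list \<kappa>} \<Longrightarrow> \<rho> x < length \<kappa>"
  obtains w where "w permutes {1..sum_list \<kappa>}" "\<And>x. x \<in> {1..sum_list \<kappa>} \<Longrightarrow> w x \<in> block \<kappa> (\<rho> x)"
proof -
  let ?S = "{1..sum_list \<kappa>}"
  have "\<exists>h. bij_betw h {x \<in> ?S. \<rho> x = i} (block \<kappa> i)" if "i < length \<kappa>" for i
    using card[OF that] by (intro finite_same_card_bij) (auto simp: block_def)
  then obtain h where h: "\<And>i. i < length \<kappa> \<Longrightarrow> bij_betw (h i) {x \<in> ?S. \<rho> x = i} (block \<kappa> i)"
    by metis
  define w where "w x = (if x \<in> ?S then h (\<rho> x) x else x)" for x
  have mem: "w x \<in> block \<kappa> (\<rho> x)" if "x \<in> ?S" for x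
    using bij_betwE[OF h[OF \<rho>[OF that]]] that by (simp add: w_def)
  have "inj_on w ?S"
  proof (rule inj_onI)
    fix x y assume xy: "x \<in> ?S" "y \<in> ?S" "w x = w y"
    then have eq: "\<rho> x = \<rho> y" using mem block_unique by metis
    then have "h (\<rho> x) x = h (\<rho> x) y" using xy by (simp add: w_def)
    then show "x = y" using bij_betw_imp_inj_on[OF h[OF \<rho>[OF xy(1)]]] xy eq by (auto dest: inj_onD)
  qed
  moreover have "w ` ?S \<subseteq> ?S" using mem block_subset by blast
  ultimately have "bij_betw w ?S ?S" by (auto simp: bij_betw_def endo_inj_surj)
  then have "w permutes ?S" by (rule bij_imp_permutes) (use w_def in presburger)
  then show ?thesis using mem that by blast
qed

lemma mod_div_less_square:
  fixes k n :: nat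
  assumes "k < n * n"
  shows "k mod n < n" "k div n < n"
proof -
  have "n > 0" using assms by (cases n) auto
  then show "k mod n < n" "k div n < n" using assms by (simp_all add: less_mult_imp_div_less)
qed

lemma nth_concat_uniform:
  assumes "\<And>xs. xs \<in> set xss \<Longrightarrow> length xs = n" "i < n" "j < length xss"
  shows "concat xss ! (j * n + i) = xss ! j ! i"
  using assms
proof (induction xss arbitrary: j)
  case (Cons xs xss)
  then have len: "length xs = n" by simp
  show ?case
  proof (cases j)
    case 0
    then show ?thesis using len Cons.prems by (simp add: nth_append)
  next
    case (Suc j')
    have "concat (xs # xss) ! (j * n + i) = concat xss ! (j' * n + i)"
      using Suc len by (simp add: nth_append add.assoc)
    then show ?thesis using Cons Suc by simp
  qed
qed simp

section \<open>Row sums, column sums, the column reading and d_A\<close>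

context
  fixes n :: nat and B :: "nat mat"
  assumes B: "B \<in> carrier_mat n n"
begin

lemma length_ro [simp]: "length (ro B) = n" and length_co [simp]: "length (co B) = n"
  using B by (auto simp: ro_def co_def)

lemma nth_ro: "i < n \<Longrightarrow> ro B ! i = (\<Sum>j<n. B $$ (i, j))"
  and nth_co: "j < n \<Longrightarrow> co B ! j = (\<Sum>i<n. B $$ (i, j))"
  using B by (auto simp: ro_def co_def)

lemma sum_list_ro: "sum_list (ro B) = entry_sum B"
  using B by (simp add: sum_list_sum_nth nth_ro entry_sum_def atLeast0LessThan)

lemma sum_list_co: "sum_list (co B) = entry_sum B"
  using B sum.swap[of "\<lambda>i j. B $$ (i, j)" "{..<n}" "{..<n}"]
  by (simp add: sum_list_sum_nth nth_co entry_sum_def atLeast0LessThan)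

lemma length_nu [simp]: "length (nu B) = n * n"
  using B by (simp add: nu_def length_concat o_def sum_list_triv)

lemma nth_nu: "i < n \<Longrightarrow> j < n \<Longrightarrow> nu B ! (j * n + i) = B $$ (i, j)"
  using B unfolding nu_def by (subst nth_concat_uniform[where n = n]) auto

lemma nu_index:
  assumes "i < n" "j < n"
  shows "j * n + i < n * n"
proof -
  have "j * n + i < j * n + n" using assms by simp
  also have "\<dots> = Suc j * n" by simp
  also have "\<dots> \<le> n * n" using assms by (intro mult_le_mono1) simp
  finally show ?thesis .
qed

lemma sum_list_take_nu:
  "j < n \<Longrightarrow> i \<le> n \<Longrightarrow>
    sum_list (take (j * n + i) (nu B)) = sum_list (take (j * n) (nu B)) + (\<Sum>i'<i. B $$ (i', j))"
proof (induction i)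
  case (Suc i)
  then show ?case using nu_index[of i j] nth_nu[of i j]
    by (simp add: take_Suc_conv_app_nth)
qed simp

lemma sum_list_take_nu_col: "j \<le> n \<Longrightarrow> sum_list (take (j * n) (nu B)) = sum_list (take j (co B))"
proof (induction j)
  case (Suc j)
  have "sum_list (take (Suc j * n) (nu B)) = sum_list (take (j * n + n) (nu B))"
    by (simp add: add.commute)
  also have "\<dots> = sum_list (take j (co B)) + co B ! j"
    using sum_list_take_nu[of j n] Suc nth_co[of j] by simp
  also have "\<dots> = sum_list (take (Suc j) (co B))" using Suc.prems by (simp add: take_Suc_conv_app_nth)
  finally show ?case .
qed simp

lemma sum_list_nu: "sum_list (nu B) = entry_sum B"
  using sum_list_take_nu_col[of n] sum_list_co by simp

text \<open>With indices from 0 the entry (i, j) has position j * n + i in the column reading; its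
  block is one of the consecutive pieces into which the entries of column j cut the j-th block of
  the column sums.\<close>

lemma block_nu:
  assumes "i < n" "j < n"
  shows "block (nu B) (j * n + i) = {sum_list (take j (co B)) + (\<Sum>i'<i. B $$ (i', j)) + 1
    ..sum_list (take j (co B)) + (\<Sum>i'<Suc i. B $$ (i', j))}"
proof -
  have "Suc (j * n + i) = j * n + Suc i" by simp
  then show ?thesis
    using assms sum_list_take_nu[of j i] sum_list_take_nu[of j "Suc i"] sum_list_take_nu_col[of j]
    unfolding block_def by simp
qed

lemma block_nu_subset: 
  assumes "i < n" "j < n"
  shows "block (nu B) (j * n + i) \<subseteq> block (co B) j"
proof -
  have "(\<Sum>i'<Suc i. B $$ (i', j)) \<le> (\<Sum>i'<n. B $$ (i', j))"
    using assms by (intro sum_mono2) auto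
  then have "sum_list (take j (co B)) + (\<Sum>i'<Suc i. B $$ (i', j)) \<le> sum_list (take (Suc j) (co B))"
    using assms by (simp add: take_Suc_conv_app_nth nth_co)
  then show ?thesis unfolding block_nu[OF assms] by (auto simp: block_def)
qed

definition has_counts :: "(nat \<Rightarrow> nat) \<Rightarrow> bool" where
  "has_counts d \<longleftrightarrow> (\<forall>i<n. \<forall>j<n. card (block (ro B) i \<inter> d ` block (co B) j) = B $$ (i, j))"

text \<open>Each point lies in the block of exactly one entry (i, j) of the column reading. Sending
  it into row block i is possible for all points at once because the entries of row i add up to the
  size of that block, and the counts then hold by construction.\<close>

lemma ex_permutation_has_counts: "\<exists>w. w permutes {1..entry_sum B} \<and> has_counts w"
proof -
  let ?S = "{1..entry_sum B}"
  define k where "k x = (SOME k. k < n * n \<and> x \<in> block (nu B) k)" for x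
  have k: "k x < n * n" "x \<in> block (nu B) (k x)" if "x \<in> ?S" for x
    using someI_ex[OF block_cover[of x "nu B"]] that sum_list_nu by (simp_all add: k_def)
  \<comment> \<open>The block number has the form j * n + i, so its remainder is the row
    index.\<close>
  define \<rho> where "\<rho> x = k x mod n" for x
  have \<rho>: "\<rho> x < n" if "x \<in> ?S" for x
    using mod_div_less_square(1)[OF k(1)[OF that]] by (simp add: \<rho>_def)
  have fibre: "x \<in> ?S \<and> \<rho> x = i \<and> x \<in> block (co B) j \<longleftrightarrow> x \<in> block (nu B) (j * n + i)"
    if ij: "i < n" "j < n" for x i j
  proof
    assume x: "x \<in> ?S \<and> \<rho> x = i \<and> x \<in> block (co B) j"
    have kx: "k x = (k x div n) * n + i" using x div_mult_mod_eq[of "k x" n] by (simp add: \<rho>_def)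
    have div: "k x div n < n" using mod_div_less_square(2) k(1) x by blast
    have "x \<in> block (nu B) ((k x div n) * n + i)" using k(2) x kx by simp
    then have "x \<in> block (co B) (k x div n)" using block_nu_subset[OF ij(1) div] by blast
    then have "k x div n = j" using x block_unique by blast
    with kx have "k x = j * n + i" by simp
    moreover have "x \<in> block (nu B) (k x)" using k(2) x by blast
    ultimately show "x \<in> block (nu B) (j * n + i)" by simp
  next
    assume x: "x \<in> block (nu B) (j * n + i)"
    then have S: "x \<in> ?S" using block_subset[of "nu B"] unfolding sum_list_nu by blast
    have "k x = j * n + i" using block_unique[OF x k(2)[OF S]] by simp
    then show "x \<in> ?S \<and> \<rho> x = i \<and> x \<in> block (co B) j"
      using S ij x block_nu_subset[OF ij] by (auto simp: \<rho>_def)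
  qed
  have "card {x \<in> ?S. \<rho> x = i} = card (block (ro B) i)" if i: "i < n" for i
  proof -
    have "{x \<in> ?S. \<rho> x = i} = (\<Union>j<n. block (nu B) (j * n + i))"
    proof (intro equalityI subsetI)
      fix x assume x: "x \<in> {x \<in> ?S. \<rho> x = i}"
      then obtain j where "j < n" "x \<in> block (co B) j"
        using block_cover[of x "co B"] sum_list_co by auto
      then show "x \<in> (\<Union>j<n. block (nu B) (j * n + i))" using fibre[OF i, of j x] x by auto
    qed (use fibre[OF i] in blast)
    also have "card \<dots> = (\<Sum>j<n. card (block (nu B) (j * n + i)))"
    proof (rule card_UN_disjoint)
      show "\<forall>j\<in>{..<n}. \<forall>l\<in>{..<n}. j \<noteq> l \<longrightarrow> block (nu B) (j * n + i) \<inter> block (nu B) (l * n + i) = {}"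
        using block_unique i by fastforce
    qed (simp_all add: block_def)
    also have "\<dots> = (\<Sum>j<n. B $$ (i, j))" using nu_index[OF i] nth_nu[OF i] by (simp add: card_block)
    also have "\<dots> = card (block (ro B) i)" using i by (simp add: card_block nth_ro)
    finally show ?thesis .
  qed
  then obtain w where w: "w permutes ?S" "\<And>x. x \<in> ?S \<Longrightarrow> w x \<in> block (ro B) (\<rho> x)"
    using ex_permutation_into_blocks[of "ro B" \<rho>] \<rho> by (auto simp: sum_list_ro)
  have "card (block (ro B) i \<inter> w ` block (co B) j) = B $$ (i, j)" if ij: "i < n" "j < n" for i j
  proof -
    have "block (ro B) i \<inter> w ` block (co B) j = w ` block (nu B) (j * n + i)"
    proof -
      have "w x \<in> block (ro B) i \<longleftrightarrow> \<rho> x = i" if "x \<in> ?S" for x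
        using w(2)[OF that] block_unique by blast
      moreover have "block (co B) j \<subseteq> ?S" using block_subset sum_list_co by metis
      ultimately show ?thesis using fibre[OF ij] by blast
    qed
    moreover have "inj_on w (block (nu B) (j * n + i))"
      using permutes_inj[OF w(1)] by (rule inj_on_subset) simp
    ultimately show ?thesis using ij by (simp add: card_image card_block nu_index nth_nu)
  qed
  then show ?thesis using w(1) by (auto simp: has_counts_def)
qed

lemma d_mat_unique:
  assumes "doubly_reduced (ro B) (co B) d" "has_counts d"
    "doubly_reduced (ro B) (co B) d'" "has_counts d'"
  shows "d = d'"
  by (rule doubly_reduced_unique[OF assms(1,3)])
    (use assms in \<open>simp_all add: has_counts_def sum_list_ro sum_list_co\<close>)

text \<open>Justifies the definite description. Counts are constant on double cosets, so a shortest
  element in the double coset of any permutation with the right counts is a candidate; every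
  candidate is doubly reduced, hence unique.\<close>

lemma d_mat_spec:
  "d_mat B permutes {1..entry_sum B}" "has_counts (d_mat B)" "doubly_reduced (ro B) (co B) (d_mat B)"
proof -
  let ?r = "entry_sum B"
  let ?P = "\<lambda>d. d permutes {1..?r} \<and>
    (\<forall>i < dim_row B. \<forall>j < dim_col B. card (block (ro B) i \<inter> d ` block (co B) j) = B $$ (i, j)) \<and>
    (\<forall>w \<in> double_coset (ro B) d (co B). perm_length ?r d \<le> perm_length ?r w)"
  have P: "d permutes {1..?r} \<and> has_counts d \<and> doubly_reduced (ro B) (co B) d" if "?P d" for d
    using that doubly_reduced_if_minimal[OF sum_list_ro sum_list_co] B
    by (simp add: has_counts_def)
  obtain w where w: "w permutes {1..?r}" "has_counts w" using ex_permutation_has_counts by blast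
  obtain d where d: "d \<in> double_coset (ro B) w (co B)"
    and min: "\<And>e. e \<in> double_coset (ro B) w (co B) \<Longrightarrow> perm_length ?r d \<le> perm_length ?r e"
    using ex_has_least_nat[of "\<lambda>d. d \<in> double_coset (ro B) w (co B)" w "perm_length ?r"]
      double_coset_self by blast
  have "?P d"
    using double_coset_permutes[OF sum_list_ro sum_list_co w(1) d] double_coset_counts[OF w(1) d]
      min double_coset_trans[OF d] w(2) B by (auto simp: has_counts_def)
  moreover have "e = d" if "?P e" for e
    using d_mat_unique P[OF that] P[OF \<open>?P d\<close>] by blast
  ultimately have "?P (d_mat B)" unfolding d_mat_def by (rule theI)
  from P[OF this] show "d_mat B permutes {1..entry_sum B}" "has_counts (d_mat B)"
    "doubly_reduced (ro B) (co B) (d_mat B)" by auto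
qed

lemma d_mat_eqI: "doubly_reduced (ro B) (co B) d \<Longrightarrow> has_counts d \<Longrightarrow> d_mat B = d"
  using d_mat_unique d_mat_spec(2,3) by blast

text \<open>The combinatorial form of S_\<nu> = S_\<mu> \<inter> d^-1 S_\<lambda> d: the column
  reading lists exactly the pieces on which d leads from one column block into one row
  block.\<close>

lemma block_nu_eq_fibre:
  assumes "i < n" "j < n"
  shows "block (nu B) (j * n + i) = {x \<in> block (co B) j. d_mat B x \<in> block (ro B) i}"
  unfolding block_nu[OF assms]
  using doubly_reduced_fibre[OF d_mat_spec(3), of i j] assms d_mat_spec(2)
  by (simp add: sum_list_ro sum_list_co has_counts_def)

lemma block_co_eq_Union:
  assumes "j < n"
  shows "block (co B) j = (\<Union>i<n. block (nu B) (j * n + i))"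
proof -
  have "\<exists>i<n. d_mat B x \<in> block (ro B) i" if "x \<in> block (co B) j" for x
  proof -
    have "x \<in> {1..entry_sum B}" using that block_subset[of "co B" j] unfolding sum_list_co by blast
    then have "d_mat B x \<in> {1..sum_list (ro B)}"
      using permutes_in_image[OF d_mat_spec(1)] sum_list_ro by simp
    then show ?thesis using block_cover[of "d_mat B x" "ro B"] by simp
  qed
  then show ?thesis using assms by (auto simp: block_nu_eq_fibre)
qed

lemma young_nu_subset: "young (nu B) \<subseteq> young (co B)"
proof
  fix w assume w: "w \<in> young (nu B)"
  have "w ` block (co B) j = block (co B) j" if "j < n" for j
    using w that nu_index by (simp add: block_co_eq_Union image_UN young_def)
  then show "w \<in> young (co B)" using w by (simp add: young_def sum_list_nu sum_list_co)
qed

text \<open>d and its inverse are increasing on the blocks concerned, so a value strictly between d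
  p and d (p+1) would have a preimage strictly between p and p+1. Consequently d turns s_p in
  S_\<mu> into a simple reflection of S_\<lambda>.\<close>

lemma same_block_nu_d_mat:
  assumes "same_block (nu B) p"
  shows "same_block (co B) p" "same_block (ro B) (d_mat B p)" "d_mat B (Suc p) = Suc (d_mat B p)"
proof -
  let ?d = "d_mat B"
  obtain k where k: "k < n * n" "p \<in> block (nu B) k" "Suc p \<in> block (nu B) k"
    using assms by (auto simp: same_block_def)
  define i j where "i = k mod n" and "j = k div n"
  have ij: "i < n" "j < n" "k = j * n + i"
    using mod_div_less_square[OF k(1)] by (simp_all add: i_def j_def)
  have mem: "p \<in> block (co B) j" "Suc p \<in> block (co B) j"
    "?d p \<in> block (ro B) i" "?d (Suc p) \<in> block (ro B) i"
    using k(2,3) ij block_nu_eq_fibre[OF ij(1,2)] by auto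
  show 1: "same_block (co B) p" using mem ij by (auto simp: same_block_def)
  then have less: "?d p < ?d (Suc p)" using d_mat_spec(3) by (simp add: doubly_reduced_def)
  note inv = permutes_inverses(2)[OF d_mat_spec(1)]
  show eq: "?d (Suc p) = Suc (?d p)"
  proof (rule ccontr)
    assume "\<not> ?thesis"
    then have gt: "Suc (?d p) < ?d (Suc p)" using less by simp
    then have y: "Suc (?d p) \<in> block (ro B) i" using mem(3,4) by (auto simp: block_def)
    have asc: "same_block (ro B) l \<Longrightarrow> inv ?d l < inv ?d (Suc l)" for l
      using d_mat_spec(3) by (simp add: doubly_reduced_def)
    have "inv ?d (?d p) < inv ?d (Suc (?d p))"
      by (rule increasing_on_block[where f = "inv ?d", OF asc _ mem(3) y]) (use ij in auto)
    moreover have "inv ?d (Suc (?d p)) < inv ?d (?d (Suc p))"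
      by (rule increasing_on_block[where f = "inv ?d", OF asc _ y mem(4) gt]) (use ij in auto)
    ultimately show False by (simp add: inv)
  qed
  show "same_block (ro B) (?d p)" using mem(3,4) ij(1) by (auto simp: same_block_def eq)
qed

text \<open>Conjugation by d takes s_p to the simple reflection at d p, and both products with d
  raise the length; so T_d T_p equals the generator at d p times T_d, and the symmetrizer of the row
  sums absorbs that generator as q.\<close>

lemma right_invariant_x_comp_d_mat:
  assumes r: "entry_sum B = CARD('r)"
  shows "right_invariant (nu B) (x_comp (ro B) * T_perm (d_mat B) :: 'r hc)"
  unfolding right_invariant_def
proof (intro allI impI)
  fix p assume p: "same_block (nu B) p"
  let ?d = "d_mat B"
  note sb = same_block_nu_d_mat[OF p]
  have dp: "?d permutes {1..CARD('r)}" using d_mat_spec(1) r by simp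
  note ro = sum_list_ro[unfolded r] and co = sum_list_co[unfolded r]
  have less: "?d p < ?d (Suc p)" using sb(3) by simp
  have "?d \<circ> transpose p (Suc p) = adj (?d p) \<circ> ?d"
    using permutes_inj[OF dp]
    by (auto simp: fun_eq_iff Transposition.transpose_def inj_eq simp flip: sb(3))
  moreover have "inv ?d (?d p) < inv ?d (Suc (?d p))"
    unfolding sb(3)[symmetric] by (simp add: permutes_inverses(2)[OF dp])
  ultimately have "(T_perm ?d :: 'r hc) * T_gen p = T_gen (?d p) * T_perm ?d"
    using T_perm_mult_T[OF dp same_block_range'[OF co sb(1)] less]
      T_mult_T_perm[OF dp same_block_range'[OF ro sb(2)]] by simp
  then have "x_comp (ro B) * T_perm ?d * T_gen p = x_comp (ro B) * T_gen (?d p) * (T_perm ?d :: 'r hc)"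
    by (simp add: mult.assoc)
  then show "x_comp (ro B) * T_perm ?d * T_gen p = hc_scale qq (x_comp (ro B) * T_perm ?d :: 'r hc)"
    by (simp add: x_comp_mult_T[OF ro sb(2)] hc_scale_mult)
qed

end

section \<open>A spanning set of the invariants\<close>

lemma smatsD:
  assumes "A \<in> smats n r"
  shows "fst A \<in> carrier_mat n n" "snd A \<in> carrier_mat n n" "total A \<in> carrier_mat n n"
    "entry_sum (total A) = r" "\<And>i j. i < n \<Longrightarrow> j < n \<Longrightarrow> snd A $$ (i, j) \<in> {0, 1}"
  using assms elements_matI[of "snd A" n n] by (auto simp: smats_def)

lemma nu_01:
  assumes "A \<in> smats n r" "k < n * n"
  shows "nu (snd A) ! k \<in> {0, 1}"
proof -
  note ij = mod_div_less_square[OF assms(2)]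
  have "nu (snd A) ! ((k div n) * n + k mod n) = snd A $$ (k mod n, k div n)"
    by (rule nth_nu[OF smatsD(2)[OF assms(1)] ij])
  then show ?thesis using smatsD(5)[OF assms(1) ij] by simp
qed

definition odd_blocks :: "smat \<Rightarrow> nat list" where
  "odd_blocks A = filter (\<lambda>k. nu (snd A) ! k = 1) [0..<length (nu (total A))]"

lemma T_mat_c_blocks:
  assumes "A \<in> smats n CARD('r)"
  shows "(T_mat A :: 'r hc) = x_comp (ro (total A)) * T_perm (d_mat (total A)) *
    c_blocks (nu (total A)) (odd_blocks A) *
    (\<Sum>\<sigma> \<in> right_coset_reps CARD('r) (nu (total A)) \<inter> young (co (total A)). T_perm \<sigma>)"
  unfolding T_mat_def odd_blocks_def
  using nu_01[OF assms] length_nu[OF smatsD(3)[OF assms]]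
  by (subst c_comp_eq_c_blocks) simp_all

lemma right_invariant_before_reps:
  assumes "A \<in> smats n CARD('r)"
  shows "right_invariant (nu (total A)) (x_comp (ro (total A)) * T_perm (d_mat (total A)) *
    c_blocks (nu (total A)) (odd_blocks A) :: 'r hc)"
  by (rule right_invariant_c_blocks)
    (use right_invariant_x_comp_d_mat[OF smatsD(3,4)[OF assms]]
      sum_list_nu[OF smatsD(3)[OF assms]] smatsD(4)[OF assms] in \<open>simp_all add: odd_blocks_def\<close>)

lemma x_comp_nu_mult_reps:
  assumes "B \<in> carrier_mat n n" "entry_sum B = CARD('r)"
  shows "(x_comp (nu B) :: 'r hc) * (\<Sum>\<sigma> \<in> right_coset_reps CARD('r) (nu B) \<inter> young (co B). T_perm \<sigma>) =
    x_comp (co B)"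
  by (rule x_comp_mult_right_coset_reps)
    (use sum_list_nu[OF assms(1)] sum_list_co[OF assms(1)] young_nu_subset[OF assms(1)] assms(2)
      in simp_all)

text \<open>
  Multiplying by the symmetrizer of \<open>\<nu>\<close>, which acts on right invariants by a nonzero scalar,
  replaces the sum over coset representatives in \<^term>\<open>T_mat A\<close> by \<open>x\<^sub>\<mu>\<close>.
\<close>

lemma poincare_T_mat:
  assumes A: "A \<in> smats n CARD('r)"
  shows "hc_scale (poincare (nu (total A))) (T_mat A :: 'r hc) =
    x_comp (ro (total A)) * T_perm (d_mat (total A)) * c_blocks (nu (total A)) (odd_blocks A) *
      x_comp (co (total A))"
proof -
  let ?B = "total A"
  define z where "z = (x_comp (ro ?B) * T_perm (d_mat ?B) * c_blocks (nu ?B) (odd_blocks A) :: 'r hc)"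
  note B = smatsD(3,4)[OF A]
  have "z * x_comp (nu ?B) = hc_scale (poincare (nu ?B)) z"
    unfolding z_def
    by (rule right_invariant_mult_x_comp[OF _ right_invariant_before_reps[OF A]])
      (simp add: sum_list_nu[OF B(1)] B(2))
  then have "hc_scale (poincare (nu ?B)) (T_mat A) = z * x_comp (nu ?B) *
      (\<Sum>\<sigma> \<in> right_coset_reps CARD('r) (nu ?B) \<inter> young (co ?B). T_perm \<sigma>)"
    unfolding T_mat_c_blocks[OF A] by (simp add: z_def hc_scale_mult)
  then show ?thesis by (simp add: mult.assoc x_comp_nu_mult_reps[OF B] z_def)
qed

text \<open>After multiplication by P_\<nu> the element ends in x_\<mu>, where the invariance is
  evident; then P_\<nu> is divided out. This invariance is what makes a homomorphism sending x_\<mu>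
  to T_A exist.\<close>

lemma right_invariant_T_mat:
  assumes A: "A \<in> smats n CARD('r)"
  shows "right_invariant (co (total A)) (T_mat A :: 'r hc)"
proof -
  note B = smatsD(3,4)[OF A]
  have "right_invariant (co (total A)) (hc_scale (poincare (nu (total A))) (T_mat A :: 'r hc))"
    unfolding poincare_T_mat[OF A]
    by (intro right_invariant_mult right_invariant_x_comp) (simp add: sum_list_co[OF B(1)] B(2))
  from right_invariant_scale[OF this, of "1 / poincare (nu (total A))"] show ?thesis
    using poincare_neq_0 by simp
qed

lemma T_mat_range: "T_mat A \<in> range (\<lambda>h. x_comp (ro (total A)) * h)"
  unfolding T_mat_def mult.assoc by (rule rangeI)

lemma grade_inv_c_blocks:
  "grade_inv (c_blocks \<kappa> K :: 'r hc) = hc_scale ((-1) ^ length K) (c_blocks \<kappa> K)"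
proof (induction K)
  case (Cons k K)
  have "grade_inv (c_block \<kappa> k :: 'r hc) = - c_block \<kappa> k"
    by (simp add: c_block_def c_q_def grade_inv_sum grade_inv_hom sum_negf)
  with Cons show ?case by (simp add: grade_inv_hom hc_scale_mult)
qed (simp add: grade_inv_hom)

lemma length_filter_eq_sum_list:
  "(\<And>k. k < length xs \<Longrightarrow> xs ! k \<in> {0, 1}) \<Longrightarrow>
    length (filter (\<lambda>k. xs ! k = 1) [0..<length xs]) = sum_list (xs :: nat list)"
proof (induction xs rule: rev_induct)
  case (snoc x xs)
  have "xs ! k \<in> {0, 1}" if "k < length xs" for k
    using snoc.prems[of k] that by (simp add: nth_append)
  moreover have "x \<in> {0, 1}" using snoc.prems[of "length xs"] by (simp add: nth_append)
  moreover have "filter (\<lambda>k. (xs @ [x]) ! k = 1) [0..<length xs] = filter (\<lambda>k. xs ! k = 1) [0..<length xs]"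
    by (rule filter_cong) (simp_all add: nth_append)
  ultimately show ?case using snoc.IH by (auto simp: nth_append)
qed simp

text \<open>Only the Clifford factors are odd, and their number is the entry sum of
  \<open>snd A\<close> because its entries are 0 or 1.\<close>

lemma grade_inv_T_mat:
  assumes A: "A \<in> smats n CARD('r)"
  shows "grade_inv (T_mat A :: 'r hc) = hc_scale ((-1) ^ parity A) (T_mat A)"
proof -
  note len = length_nu[OF smatsD(3)[OF A]] length_nu[OF smatsD(2)[OF A]]
  have "length (odd_blocks A) = entry_sum (snd A)"
    using length_filter_eq_sum_list[of "nu (snd A)"] nu_01[OF A] sum_list_nu[OF smatsD(2)[OF A]]
    by (simp add: odd_blocks_def len)
  then show ?thesis
    unfolding T_mat_c_blocks[OF A]
    by (simp add: grade_inv_hom grade_inv_x_comp grade_inv_T_perm grade_inv_sum grade_inv_c_blocks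
        hc_scale_mult parity_def minus_one_power_mod2)
qed

definition count_mat :: "nat \<Rightarrow> nat list \<Rightarrow> nat list \<Rightarrow> (nat \<Rightarrow> nat) \<Rightarrow> nat mat" where
  "count_mat n \<kappa> \<mu> d = mat n n (\<lambda>(i, j). card (block \<kappa> i \<inter> d ` block \<mu> j))"

lemma Union_block: "(\<Union>k<length \<kappa>. block \<kappa> k) = {1..sum_list \<kappa>}"
  using block_cover block_subset by fastforce

lemma card_eq_sum_card_Int:
  fixes N :: nat
  assumes "finite S" "S \<subseteq> (\<Union>j<N. X j)" "\<And>i j. i < N \<Longrightarrow> j < N \<Longrightarrow> i \<noteq> j \<Longrightarrow> X i \<inter> X j = {}"
  shows "card S = (\<Sum>j<N. card (S \<inter> X j))"
proof -
  have "S = (\<Union>j<N. S \<inter> X j)" using assms(2) by blast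
  moreover have "card (\<Union>j\<in>{..<N}. S \<inter> X j) = (\<Sum>j<N. card (S \<inter> X j))"
    by (rule card_UN_disjoint) (use assms in auto)
  ultimately show ?thesis by simp
qed

lemma count_mat:
  assumes \<kappa>: "\<kappa> \<in> compositions n r" and \<mu>: "\<mu> \<in> compositions n r" and d: "d permutes {1..r}"
  shows "count_mat n \<kappa> \<mu> d \<in> carrier_mat n n" "ro (count_mat n \<kappa> \<mu> d) = \<kappa>"
    "co (count_mat n \<kappa> \<mu> d) = \<mu>"
proof -
  have len: "length \<kappa> = n" "length \<mu> = n" "sum_list \<kappa> = r" "sum_list \<mu> = r"
    using \<kappa> \<mu> by (simp_all add: compositions_def)
  have fin: "finite (block \<kappa>' k)" for \<kappa>' k by (simp add: block_def)
  show B: "count_mat n \<kappa> \<mu> d \<in> carrier_mat n n" by (simp add: count_mat_def)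
  have Un: "(\<Union>j<n. d ` block \<mu> j) = {1..r}"
    using Union_block[of \<mu>] permutes_image[OF d] len by (simp add: image_UN[symmetric])
  have disj: "block \<nu> i \<inter> block \<nu> j = {}" if "i \<noteq> j" for \<nu> i j using that block_unique by blast
  then have disj': "d ` block \<mu> i \<inter> d ` block \<mu> j = {}" if "i \<noteq> j" for i j
    using that image_Int[OF permutes_inj[OF d], of "block \<mu> i" "block \<mu> j"] by simp
  have "\<kappa> ! i = (\<Sum>j<n. card (block \<kappa> i \<inter> d ` block \<mu> j))" if "i < n" for i
    using card_eq_sum_card_Int[of "block \<kappa> i" "\<lambda>j. d ` block \<mu> j" n] disj' fin Un
      block_subset[of \<kappa> i] that len by (simp add: card_block)
  then show "ro (count_mat n \<kappa> \<mu> d) = \<kappa>"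
    by (intro nth_equalityI) (simp_all add: length_ro[OF B] nth_ro[OF B] len, simp add: count_mat_def)
  have "\<mu> ! j = (\<Sum>i<n. card (block \<kappa> i \<inter> d ` block \<mu> j))" if "j < n" for j
  proof -
    have "\<mu> ! j = card (d ` block \<mu> j)"
      using that len permutes_inj[OF d] by (simp add: card_image inj_on_subset card_block)
    also have "\<dots> = (\<Sum>i<n. card (d ` block \<mu> j \<inter> block \<kappa> i))"
    proof (rule card_eq_sum_card_Int)
      show "d ` block \<mu> j \<subseteq> (\<Union>i<n. block \<kappa> i)"
        using Un Union_block[of \<kappa>] len that by blast
    qed (use fin disj in auto)
    finally show ?thesis by (simp add: Int_commute)
  qed
  then show "co (count_mat n \<kappa> \<mu> d) = \<mu>"
    by (intro nth_equalityI) (simp_all add: length_co[OF B] nth_co[OF B] len, simp add: count_mat_def)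
qed

section \<open>Straightening between two symmetrizers\<close>

definition T_mat_span :: "nat \<Rightarrow> nat list \<Rightarrow> nat list \<Rightarrow> 'r hc set" where
  "T_mat_span n \<kappa> \<mu> =
    hc.span {T_mat A | A. A \<in> smats n CARD('r) \<and> ro (total A) = \<kappa> \<and> co (total A) = \<mu>}"

lemma subspace_T_mat_span: "hc.subspace (T_mat_span n \<kappa> \<mu>)"
  by (simp add: T_mat_span_def)

context
  fixes n :: nat and \<kappa> \<mu> :: "nat list" and ty :: "'r itself"
  assumes \<kappa>: "\<kappa> \<in> compositions n CARD('r)" and \<mu>: "\<mu> \<in> compositions n CARD('r)"
begin

lemma sum_\<kappa>: "sum_list \<kappa> = CARD('r)" and sum_\<mu>: "sum_list \<mu> = CARD('r)"
  using \<kappa> \<mu> by (simp_all add: compositions_def)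

text \<open>With \<nu> the column reading of the count matrix, x_\<mu> is x_\<nu> times a sum over
  coset representatives. So a stands between x_\<kappa> T_d, which is right invariant for \<nu>, and
  x_\<nu>; it reduces to products over chosen blocks, and each of these yields a nonzero multiple of
  some T_A.\<close>

lemma doubly_reduced_T_mat_span:
  assumes d: "doubly_reduced \<kappa> \<mu> d" and a: "a \<in> clifford"
  shows "(x_comp \<kappa> * T_perm d * a * x_comp \<mu> :: 'r hc) \<in> T_mat_span n \<kappa> \<mu>"
proof -
  have dp: "d permutes {1..CARD('r)}" using d sum_\<mu> by (simp add: doubly_reduced_def)
  define B where "B = count_mat n \<kappa> \<mu> d"
  note B = count_mat[OF \<kappa> \<mu> dp, folded B_def]
  have r: "entry_sum B = CARD('r)" using sum_list_co[OF B(1)] B(3) sum_\<mu> by simp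
  have "has_counts n B d"
    unfolding has_counts_def[OF B(1)] B(2,3) by (simp add: B_def count_mat_def)
  then have dB: "d_mat B = d" using d_mat_eqI[OF B(1)] d B(2,3) by simp
  let ?y = "x_comp \<kappa> * T_perm d :: 'r hc"
  let ?D = "\<Sum>\<sigma> \<in> right_coset_reps CARD('r) (nu B) \<inter> young (co B). T_perm \<sigma> :: 'r hc"
  have sum_nu: "sum_list (nu B) = CARD('r)" using sum_list_nu[OF B(1)] r by simp
  interpret invariant_pair "nu B" ?y "x_comp (nu B) :: 'r hc"
    by standard (use sum_nu right_invariant_x_comp_d_mat[OF B(1) r] B(2) dB T_mult_x_comp[OF sum_nu]
      in simp_all)
  have "?y * a * x_comp (nu B) * ?D \<in> T_mat_span n \<kappa> \<mu>"
  proof (rule hc_span_mult_right[OF clifford_block_span[OF a, unfolded block_span_def] subspace_T_mat_span],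
      clarify)
    fix S assume S: "\<forall>k<length (nu B). S k \<longrightarrow> block (nu B) k \<noteq> {}"
    \<comment> \<open>The chosen blocks become the odd positions. A chosen block is nonempty, so its
      entry of B is positive and the truncated subtraction in the even part \<open>B - A1\<close> is
      exact.\<close>
    define A1 where "A1 = mat n n (\<lambda>(i, j). if S (j * n + i) then 1 else 0 :: nat)"
    define A where "A = (B - A1, A1)"
    have A1: "A1 \<in> carrier_mat n n" by (simp add: A1_def)
    have le: "A1 $$ (i, j) \<le> B $$ (i, j)" if "i < n" "j < n" for i j
    proof (cases "S (j * n + i)")
      case True
      then have "block (nu B) (j * n + i) \<noteq> {}"
        using S nu_index[OF B(1) that] length_nu[OF B(1)] by simp
      then have "card (block (nu B) (j * n + i)) \<noteq> 0" by (simp add: block_def)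
      then have "B $$ (i, j) \<noteq> 0"
        using nu_index[OF B(1) that] nth_nu[OF B(1) that] length_nu[OF B(1)] by (simp add: card_block)
      then show ?thesis using that by (simp add: A1_def)
    qed (use that in \<open>simp add: A1_def\<close>)
    have total: "total A = B"
      using B(1) A1 le by (intro eq_matI) (auto simp: A_def)
    have mem: "A \<in> smats n CARD('r)"
      using B(1) A1 r total by (auto simp: smats_def A_def elements_mat_def A1_def)
    have "filter S [0..<n * n] = filter (\<lambda>k. nu A1 ! k = 1) [0..<n * n]"
    proof (rule filter_cong[OF refl])
      fix k assume "k \<in> set [0..<n * n]"
      then have k: "k < n * n" by simp
      note ij = mod_div_less_square[OF k]
      show "S k \<longleftrightarrow> nu A1 ! k = 1"
        using nth_nu[OF A1 ij] ij by (simp add: A1_def)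
    qed
    then have odd: "odd_blocks A = filter S [0..<length (nu B)]"
      unfolding odd_blocks_def total by (simp add: length_nu[OF B(1)] A_def)
    have "?y * c_blocks (nu B) (filter S [0..<length (nu B)]) * x_comp (nu B) * ?D =
        ?y * c_blocks (nu B) (filter S [0..<length (nu B)]) * x_comp \<mu>"
      using x_comp_nu_mult_reps[OF B(1) r] B(3) by (simp add: mult.assoc)
    also have "\<dots> = hc_scale (poincare (nu B)) (T_mat A)"
      using poincare_T_mat[OF mem] B(2,3) dB by (simp add: total odd)
    also have "\<dots> \<in> T_mat_span n \<kappa> \<mu>"
      using mem total B(2,3) unfolding T_mat_span_def
      by (intro hc.span_scale hc.span_base CollectI exI[of _ A]) simp
    finally show "?y * c_blocks (nu B) (filter S [0..<length (nu B)]) * x_comp (nu B) * ?D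
        \<in> T_mat_span n \<kappa> \<mu>" .
  qed
  then show ?thesis using x_comp_nu_mult_reps[OF B(1) r] B(3) by (simp add: mult.assoc)
qed

lemma clifford_extend:
  assumes "a \<in> clifford" "hc.subspace V" "\<And>l. h * c_word l * h' \<in> V"
  shows "h * a * h' \<in> V"
proof -
  have "h * a \<in> {z. z * h' \<in> V}"
    by (rule hc_span_mult_left[OF assms(1)[unfolded clifford_def]])
      (use assms(2,3) in \<open>auto simp: hc.subspace_def distrib_right hc_scale_mult\<close>)
  then show ?thesis by simp
qed

text \<open>Induction on the length of w, for all Clifford elements a at once. At a descent of w
  inside S_\<mu>, T_i is moved right through a into x_\<mu>, leaving terms with the shorter w s_i
  and new Clifford elements; at a left descent inside S_\<kappa> it is absorbed by x_\<kappa>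
  directly. Without such descents w is doubly reduced.\<close>

lemma T_perm_T_mat_span:
  assumes "w permutes {1..CARD('r)}" "a \<in> clifford"
  shows "(x_comp \<kappa> * T_perm w * a * x_comp \<mu> :: 'r hc) \<in> T_mat_span n \<kappa> \<mu>"
  using assms
proof (induction "perm_length CARD('r) w" arbitrary: w a rule: less_induct)
  case less
  note w = less.prems(1)
  note V = subspace_T_mat_span
  consider "doubly_reduced \<kappa> \<mu> w" | i where "same_block \<mu> i" "\<not> w i < w (Suc i)"
    | i where "same_block \<kappa> i" "\<not> inv w i < inv w (Suc i)"
    using w sum_\<mu> by (auto simp: doubly_reduced_def)
  then show ?case
  proof cases
    case 1
    then show ?thesis by (rule doubly_reduced_T_mat_span[OF _ less.prems(2)])
  next
    case 2
    then have desc: "w (Suc i) < w i" using permutes_Suc_neq[OF w, of i] by linarith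
    note i = same_block_range'[OF sum_\<mu> 2(1)]
    let ?u = "w \<circ> adj i"
    have u: "?u permutes {1..CARD('r)}" by (rule permutes_compose[OF transpose_Suc_permutes[OF i] w])
    have len: "perm_length CARD('r) ?u < perm_length CARD('r) w"
      using perm_length_comp_transpose_desc[OF w i desc] by simp
    have Tw: "(T_perm w :: 'r hc) = T_perm ?u * T_gen i" using T_perm_mult_T[OF u i] desc by simp
    show ?thesis
    proof (rule clifford_extend[OF less.prems(2) V])
      fix l
      obtain a' b' :: "'r hc" where ab: "a' \<in> clifford" "b' \<in> clifford"
        "T_gen i * c_word l = a' * T_gen i + b'" using T_c_word_straighten by metis
      have "(x_comp \<kappa> * T_perm w * c_word l * x_comp \<mu> :: 'r hc) =
          x_comp \<kappa> * T_perm ?u * (T_gen i * c_word l) * x_comp \<mu>"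
        unfolding Tw by (simp only: mult.assoc)
      also have "\<dots> = x_comp \<kappa> * T_perm ?u * a' * (T_gen i * x_comp \<mu>) +
          x_comp \<kappa> * T_perm ?u * b' * x_comp \<mu>"
        by (simp add: ab(3) distrib_left distrib_right mult.assoc)
      also have "\<dots> = hc_scale qq (x_comp \<kappa> * T_perm ?u * a' * x_comp \<mu>) +
          x_comp \<kappa> * T_perm ?u * b' * x_comp \<mu>"
        by (simp add: T_mult_x_comp[OF sum_\<mu> 2(1)] hc_scale_mult)
      finally have eq: "(x_comp \<kappa> * T_perm w * c_word l * x_comp \<mu> :: 'r hc) = \<dots>" .
      show "x_comp \<kappa> * T_perm w * c_word l * x_comp \<mu> \<in> (T_mat_span n \<kappa> \<mu> :: 'r hc set)"
        unfolding eq
        by (intro hc.subspace_add[OF V] hc.subspace_scale[OF V] less.hyps[OF len u] ab)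
    qed
  next
    case 3
    then have desc: "inv w (Suc i) < inv w i"
      using permutes_Suc_neq[OF permutes_inv[OF w], of i] by linarith
    note i = same_block_range'[OF sum_\<kappa> 3(1)]
    let ?u = "adj i \<circ> w"
    have u: "?u permutes {1..CARD('r)}" by (rule permutes_compose[OF w transpose_Suc_permutes[OF i]])
    have len: "perm_length CARD('r) ?u < perm_length CARD('r) w"
      using perm_length_transpose_comp_desc[OF w i desc] by simp
    have Tw: "(T_perm w :: 'r hc) = T_gen i * T_perm ?u"
      using T_mult_T_perm[OF u i] desc by (simp add: inv_transpose_comp[OF w])
    have "x_comp \<kappa> * T_perm w * a * x_comp \<mu> = x_comp \<kappa> * T_gen i * T_perm ?u * a * x_comp \<mu>"
      unfolding Tw by (simp only: mult.assoc)
    also have "\<dots> = hc_scale qq (x_comp \<kappa> * T_perm ?u * a * x_comp \<mu>)"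
      by (simp add: x_comp_mult_T[OF sum_\<kappa> 3(1)] hc_scale_mult)
    finally have eq: "x_comp \<kappa> * T_perm w * a * x_comp \<mu> = \<dots>" .
    show ?thesis
      unfolding eq by (intro hc.subspace_scale[OF V] less.hyps[OF len u] less.prems(2))
  qed
qed

lemma invariants_T_mat_span:
  assumes z: "(z :: 'r hc) \<in> range (\<lambda>h. x_comp \<kappa> * h)" and inv: "right_invariant \<mu> z"
  shows "z \<in> T_mat_span n \<kappa> \<mu>"
proof -
  obtain h where h: "z = x_comp \<kappa> * h" using z by blast
  have "x_comp \<kappa> * h \<in> {y. y * x_comp \<mu> \<in> T_mat_span n \<kappa> \<mu>}"
  proof (rule hc_span_mult_left[OF hc_span_T_perm_c_word])
    show "hc.subspace {y. y * x_comp \<mu> \<in> T_mat_span n \<kappa> \<mu>}"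
      using subspace_T_mat_span[of n \<kappa> \<mu>]
      by (auto simp: hc.subspace_def distrib_right hc_scale_mult)
  next
    fix b :: "'r hc" assume "b \<in> {T_perm w * c_word l | w l. w permutes {1..CARD('r)}}"
    then obtain w l where "b = T_perm w * c_word l" "w permutes {1..CARD('r)}" by blast
    then show "x_comp \<kappa> * b \<in> {y. y * x_comp \<mu> \<in> T_mat_span n \<kappa> \<mu>}"
      using T_perm_T_mat_span[of w "c_word l"] by (simp add: mult.assoc)
  qed
  then have "hc_scale (poincare \<mu>) z \<in> T_mat_span n \<kappa> \<mu>"
    using right_invariant_mult_x_comp[OF sum_\<mu> inv] h by simp
  from hc.subspace_scale[OF subspace_T_mat_span this, of "1 / poincare \<mu>"] show ?thesis
    using poincare_neq_0 by simp
qed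

text \<open>The projection \<pi> onto parity p fixes z and every T_A of parity p and kills the
  others; applied to a combination of all T_A it leaves one of the right parity.\<close>

lemma homogeneous_invariants_span:
  assumes z: "(z :: 'r hc) \<in> range (\<lambda>h. x_comp \<kappa> * h)" and inv: "right_invariant \<mu> z"
    and p: "p < 2" and homog: "z \<in> hc_homogeneous p"
  shows "z \<in> hc.span {T_mat A | A. A \<in> smats n CARD('r) \<and> ro (total A) = \<kappa> \<and>
    co (total A) = \<mu> \<and> parity A = p}" (is "z \<in> hc.span ?S")
proof -
  define \<pi> :: "'r hc \<Rightarrow> 'r hc" where
    "\<pi> h = hc_scale (1/2) (h + hc_scale ((-1) ^ p) (grade_inv h))" for h
  have add: "\<pi> (hc_scale c h + h') = hc_scale c (\<pi> h) + \<pi> h'" for c h h'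
    by (simp add: \<pi>_def grade_inv_hom hc.scale_right_distrib ac_simps)
  have fix_\<pi>: "\<pi> h = h" if "grade_inv h = hc_scale ((-1) ^ p) h" for h
    by (simp add: \<pi>_def that hc.scale_right_distrib flip: power_add mult_2 hc.scale_left_distrib)
  have "\<pi> z \<in> hc.span ?S"
    using invariants_T_mat_span[OF z inv] unfolding T_mat_span_def
  proof (induction rule: hc.span_induct_alt)
    case base
    then show ?case by (simp add: \<pi>_def hc.span_zero)
  next
    case (step c h h')
    then obtain A where A: "h = T_mat A" "A \<in> smats n CARD('r)" "ro (total A) = \<kappa>" "co (total A) = \<mu>"
      by blast
    have "\<pi> h \<in> hc.span ?S"
    proof (cases "parity A = p")
      case True
      then have "\<pi> h = h" using fix_\<pi> grade_inv_T_mat[OF A(2)] A(1) by simp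
      then show ?thesis using A True by (intro hc.span_base CollectI exI[of _ A]) simp
    next
      case False
      then have "parity A = 1 - p" using p by (auto simp: parity_def less_2_cases_iff)
      then have "\<pi> h = 0" using grade_inv_T_mat[OF A(2)] A(1) p
        by (auto simp: \<pi>_def less_2_cases_iff)
      then show ?thesis by (simp add: hc.span_zero)
    qed
    then show ?case unfolding add by (intro hc.span_add hc.span_scale step.IH)
  qed
  moreover have "\<pi> z = z" by (rule fix_\<pi>) (use homog hc_homogeneous_iff[OF p] in blast)
  ultimately show ?thesis by simp
qed

end

section \<open>Homomorphisms between the permutation modules\<close>

declare plus_fun_apply [simp del] zero_fun_apply [simp del]

lemmas fun_simps = fun_eq_iff plus_fun_apply zero_fun_apply

lemma sum_fun_apply: "(\<Sum>i\<in>I. f i) x = (\<Sum>i\<in>I. f i x)"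
  by (induction I rule: infinite_finite_induct) (simp_all add: fun_simps)

lemma finite_compositions [simp]: "finite (compositions n r)"
proof (rule finite_subset)
  show "compositions n r \<subseteq> {xs. set xs \<subseteq> {..r} \<and> length xs = n}"
    using member_le_sum_list by (fastforce simp: compositions_def)
qed (simp add: finite_lists_length_eq)

lemma at_comp_apply: "at_comp \<mu> h \<kappa> = (if \<kappa> = \<mu> then h else 0)"
  by (simp add: at_comp_def)

lemma at_comp_simps:
  "at_comp \<mu> (h + h') = at_comp \<mu> h + at_comp \<mu> h'"
  "at_comp \<mu> (hc_scale a h) = family_scale a (at_comp \<mu> h)"
  "at_comp \<mu> (h * h') = family_act (at_comp \<mu> h) h'"
  "at_comp \<mu> 0 = 0"
  by (auto simp: at_comp_def family_scale_def family_act_def fun_simps)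

lemma family_scale_apply: "family_scale a m \<kappa> = hc_scale a (m \<kappa>)"
  by (simp add: family_scale_def)

lemma perm_module_iff:
  "(m :: 'r family) \<in> perm_module n \<longleftrightarrow>
    (\<forall>\<kappa> \<in> compositions n CARD('r). \<exists>h. m \<kappa> = x_comp \<kappa> * h) \<and>
    (\<forall>\<kappa>. \<kappa> \<notin> compositions n CARD('r) \<longrightarrow> m \<kappa> = 0)"
  by (auto simp: perm_module_def)

lemma perm_module_zero: "0 \<in> perm_module n"
  by (auto simp: perm_module_iff zero_fun_apply intro: exI[of _ 0])

lemma perm_module_add:
  assumes "m \<in> perm_module n" "m' \<in> perm_module n"
  shows "m + m' \<in> perm_module n"
  using assms unfolding perm_module_iff plus_fun_apply by (metis add_0 distrib_left)

lemma perm_module_scale: "m \<in> perm_module n \<Longrightarrow> family_scale a m \<in> perm_module n"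
  unfolding perm_module_iff family_scale_def by (metis hc.scale_zero_right hc_scale_mult_right)

lemma perm_module_act: "m \<in> perm_module n \<Longrightarrow> family_act m h \<in> perm_module n"
  unfolding perm_module_iff family_act_def by (metis mult.assoc mult_zero_left)

lemma perm_module_sum: "(\<And>i. i \<in> I \<Longrightarrow> m i \<in> perm_module n) \<Longrightarrow> (\<Sum>i\<in>I. m i) \<in> perm_module n"
  by (induction I rule: infinite_finite_induct) (auto simp: perm_module_zero perm_module_add)

lemma at_comp_perm_module:
  "\<mu> \<in> compositions n CARD('r) \<Longrightarrow> at_comp \<mu> (x_comp \<mu> * h :: 'r hc) \<in> perm_module n"
  by (auto simp: perm_module_iff at_comp_def intro: exI[of _ 0])

lemma at_comp_component_perm_module:
  "(m :: 'r family) \<in> perm_module n \<Longrightarrow> at_comp \<mu> (m \<mu>) \<in> perm_module n"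
  unfolding perm_module_iff at_comp_apply by (metis mult_zero_right)

lemma perm_module_decomp:
  fixes m :: "'r family"
  assumes "m \<in> perm_module n"
  shows "m = (\<Sum>\<kappa> \<in> compositions n CARD('r). at_comp \<kappa> (m \<kappa>))"
proof
  fix \<kappa>
  show "m \<kappa> = (\<Sum>\<kappa> \<in> compositions n CARD('r). at_comp \<kappa> (m \<kappa>)) \<kappa>"
    using assms by (simp add: sum_fun_apply at_comp_apply perm_module_iff)
qed

lemma linear_maps_mem:
  "f \<in> linear_maps n \<Longrightarrow> f m \<in> perm_module n"
  using perm_module_zero unfolding linear_maps_def by (cases "m \<in> perm_module n") auto

lemma linear_maps_add:
  "f \<in> linear_maps n \<Longrightarrow> m \<in> perm_module n \<Longrightarrow> m' \<in> perm_module n \<Longrightarrow> f (m + m') = f m + f m'"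
  by (simp add: linear_maps_def)

lemma linear_maps_scale:
  "f \<in> linear_maps n \<Longrightarrow> m \<in> perm_module n \<Longrightarrow> f (family_scale a m) = family_scale a (f m)"
  by (simp add: linear_maps_def)

lemma linear_maps_outside: "f \<in> linear_maps n \<Longrightarrow> m \<notin> perm_module n \<Longrightarrow> f m = 0"
  by (simp add: linear_maps_def)

lemma family_scale_0_left: "family_scale 0 m = 0"
  by (simp add: family_scale_def fun_simps)

lemma linear_maps_zero: "f \<in> linear_maps n \<Longrightarrow> f 0 = 0"
  using linear_maps_scale[OF _ perm_module_zero, of f n 0] by (simp add: family_scale_0_left)

lemma linear_maps_sum:
  assumes "f \<in> linear_maps n" "\<And>i. i \<in> I \<Longrightarrow> m i \<in> perm_module n"
  shows "f (\<Sum>i\<in>I. m i) = (\<Sum>i\<in>I. f (m i))"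
  using assms(2)
proof (induction I rule: infinite_finite_induct)
  case (insert i I)
  then show ?case by (simp add: linear_maps_add[OF assms(1)] perm_module_sum)
qed (simp_all add: linear_maps_zero[OF assms(1)])

lemma family_scale_simps:
  "family_scale a (m + m') = family_scale a m + family_scale a m'"
  "family_scale a (family_scale b m) = family_scale (a * b) m"
  "family_scale a 0 = 0"
  by (simp_all add: family_scale_def fun_simps hc.scale_right_distrib)

lemma subspace_linear_maps: "endo_subspace (linear_maps n)"
proof (rule endo.subspaceI)
  show "(0 :: 'r endo) \<in> linear_maps n"
    by (auto simp: linear_maps_def zero_fun_apply perm_module_zero family_scale_simps)
next
  fix f g :: "'r endo" assume "f \<in> linear_maps n" "g \<in> linear_maps n"
  then show "f + g \<in> linear_maps n"
    by (auto simp: linear_maps_def plus_fun_apply[of f g] perm_module_add image_subset_iff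
        family_scale_simps add_ac)
next
  fix a and f :: "'r endo" assume "f \<in> linear_maps n"
  then show "endo_scale a f \<in> linear_maps n"
    by (auto simp: linear_maps_def perm_module_scale image_subset_iff family_scale_simps
        endo_scale_def mult.commute)
qed

text \<open>Every element of the module is a sum of terms x_\<mu> w with w homogeneous, placed in
  component \<mu>. This gives the uniqueness half of the definite description of
  \<open>Phi\<close>.\<close>

lemma linear_maps_eqI:
  fixes f g :: "'r endo"
  assumes f: "f \<in> linear_maps n" and g: "g \<in> linear_maps n"
    and eq: "\<And>\<mu> p w. \<mu> \<in> compositions n CARD('r) \<Longrightarrow> p \<in> {0, 1} \<Longrightarrow> w \<in> hc_homogeneous p \<Longrightarrow>
      f (at_comp \<mu> (x_comp \<mu> * w)) = g (at_comp \<mu> (x_comp \<mu> * w))"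
  shows "f = g"
proof
  fix m show "f m = g m"
  proof (cases "m \<in> perm_module n")
    case True
    have "f (at_comp \<mu> (m \<mu>)) = g (at_comp \<mu> (m \<mu>))" if \<mu>: "\<mu> \<in> compositions n CARD('r)" for \<mu>
    proof -
      obtain h where h: "m \<mu> = x_comp \<mu> * h" using True \<mu> by (auto simp: perm_module_iff)
      obtain h0 h1 where h01: "h = h0 + h1" "h0 \<in> hc_homogeneous 0" "h1 \<in> hc_homogeneous 1"
        by (rule hc_homogeneous_decomp)
      have "at_comp \<mu> (m \<mu>) = at_comp \<mu> (x_comp \<mu> * h0) + at_comp \<mu> (x_comp \<mu> * h1)"
        by (simp add: h h01(1) distrib_left at_comp_simps)
      then show ?thesis
        using eq[OF \<mu> _ h01(2)] eq[OF \<mu> _ h01(3)] at_comp_perm_module[OF \<mu>]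
        by (simp add: linear_maps_add[OF f] linear_maps_add[OF g])
    qed
    then have "f (\<Sum>\<mu> \<in> compositions n CARD('r). at_comp \<mu> (m \<mu>)) =
        g (\<Sum>\<mu> \<in> compositions n CARD('r). at_comp \<mu> (m \<mu>))"
      by (simp add: linear_maps_sum[OF f] linear_maps_sum[OF g] at_comp_component_perm_module[OF True])
    then show ?thesis using perm_module_decomp[OF True] by simp
  qed (simp add: linear_maps_outside[OF f] linear_maps_outside[OF g])
qed

section \<open>Homomorphisms given by the image of one generator\<close>

lemma grade_inv_pow_hom:
  "(grade_inv ^^ p) (x + y) = (grade_inv ^^ p) x + (grade_inv ^^ p) y"
  "(grade_inv ^^ p) (hc_scale a x) = hc_scale a ((grade_inv ^^ p) x)"
  "(grade_inv ^^ p) (x * y) = (grade_inv ^^ p) x * (grade_inv ^^ p) y"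
  "(grade_inv ^^ p) (x_comp \<kappa>) = x_comp \<kappa>"
  "(grade_inv ^^ p) 0 = 0"
  by (induction p) (simp_all add: grade_inv_hom grade_inv_x_comp)

lemma grade_inv_pow_homogeneous:
  "p' \<in> {0, 1} \<Longrightarrow> h \<in> hc_homogeneous p' \<Longrightarrow> (grade_inv ^^ p) h = hc_scale ((-1) ^ (p * p')) h"
proof (induction p)
  case (Suc p)
  then have "grade_inv h = hc_scale ((-1) ^ p') h" using hc_homogeneous_iff[of p' h] by auto
  with Suc show ?case by (simp add: grade_inv_hom power_add mult.commute)
qed simp

lemma homogeneous_endos_linear: "f \<in> homogeneous_endos n p \<Longrightarrow> f \<in> linear_maps n"
  by (simp add: homogeneous_endos_def)

lemma homogeneous_endosI:
  assumes "f \<in> linear_maps n"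
    "\<And>p' m. p' \<in> {0, 1} \<Longrightarrow> m \<in> module_homogeneous n p' \<Longrightarrow>
      f m \<in> module_homogeneous n ((p + p') mod 2)"
    "\<And>p' m h. p' \<in> {0, 1} \<Longrightarrow> m \<in> perm_module n \<Longrightarrow> h \<in> hc_homogeneous p' \<Longrightarrow>
      f (family_act m h) = family_scale ((-1) ^ (p * p')) (family_act (f m) h)"
  shows "f \<in> homogeneous_endos n p"
  unfolding homogeneous_endos_def by (intro CollectI conjI ballI image_subsetI assms)

lemma homogeneous_endos_mem:
  assumes "f \<in> homogeneous_endos n p" "p' \<in> {0, 1}" "m \<in> module_homogeneous n p'"
  shows "f m \<in> module_homogeneous n ((p + p') mod 2)"
proof -
  have "f ` module_homogeneous n p' \<subseteq> module_homogeneous n ((p + p') mod 2)"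
    using assms(1,2) unfolding homogeneous_endos_def by blast
  then show ?thesis using assms(3) by blast
qed

lemma homogeneous_endos_act:
  assumes "f \<in> homogeneous_endos n p" "p' \<in> {0, 1}" "m \<in> perm_module n" "h \<in> hc_homogeneous p'"
  shows "f (family_act m h) = family_scale ((-1) ^ (p * p')) (family_act (f m) h)"
  using assms unfolding homogeneous_endos_def by blast

text \<open>For right invariant z this is the homomorphism of parity p sending x_\<mu> to z in
  component \<kappa>: from z x_\<mu> = P_\<mu> z, the element P_\<mu>^-1 z m_\<mu> equals z h
  whenever m_\<mu> = x_\<mu> h, so no h has to be chosen. The p-th power of \<open>grade_inv\<close>
  supplies the sign (-1)^(p p') on elements of degree p'.\<close>

definition elementary_map ::
    "nat \<Rightarrow> nat list \<Rightarrow> nat list \<Rightarrow> nat \<Rightarrow> 'r hc \<Rightarrow> 'r endo" where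
  "elementary_map n \<kappa> \<mu> p z = (\<lambda>m. if m \<in> perm_module n
    then at_comp \<kappa> (hc_scale (1 / poincare \<mu>) (z * (grade_inv ^^ p) (m \<mu>))) else 0)"

lemma elementary_map_add:
  "elementary_map n \<kappa> \<mu> p (z + z') = elementary_map n \<kappa> \<mu> p z + elementary_map n \<kappa> \<mu> p z'"
  by (auto simp: fun_simps elementary_map_def distrib_right hc.scale_right_distrib at_comp_simps)

lemma elementary_map_scale:
  "elementary_map n \<kappa> \<mu> p (hc_scale a z) = endo_scale a (elementary_map n \<kappa> \<mu> p z)"
  by (auto simp: fun_simps elementary_map_def hc_scale_mult at_comp_simps endo_scale_def
      family_scale_simps mult.commute)

lemma elementary_map_zero: "elementary_map n \<kappa> \<mu> p 0 = 0"
  by (auto simp: fun_simps elementary_map_def at_comp_simps)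

lemma elementary_map_span:
  assumes "z \<in> hc.span S"
  shows "elementary_map n \<kappa> \<mu> p z \<in> endo_span (elementary_map n \<kappa> \<mu> p ` S)"
  using assms
proof (induction rule: hc.span_induct_alt)
  case (step c x y)
  then show ?case
    by (simp add: elementary_map_add elementary_map_scale endo.span_add endo.span_scale endo.span_base)
qed (simp add: elementary_map_zero endo.span_zero)

context
  fixes n :: nat and \<kappa> \<mu> :: "nat list" and z :: "'r hc"
  assumes \<kappa>: "\<kappa> \<in> compositions n CARD('r)" and \<mu>: "\<mu> \<in> compositions n CARD('r)"
    and z: "z \<in> range (\<lambda>h. x_comp \<kappa> * h)"
begin

lemma elementary_map_linear: "elementary_map n \<kappa> \<mu> p z \<in> linear_maps n"
proof -
  obtain h where h: "z = x_comp \<kappa> * h" using z by blast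
  have "at_comp \<kappa> (hc_scale a (z * h')) \<in> perm_module n" for a h'
    using at_comp_perm_module[OF \<kappa>, of "hc_scale a (h * h')"] by (simp add: h hc_scale_mult mult.assoc)
  then show ?thesis
    unfolding linear_maps_def
    by (intro CollectI conjI ballI allI impI image_subsetI)
      (simp_all add: elementary_map_def perm_module_add perm_module_scale grade_inv_pow_hom
        plus_fun_apply family_scale_apply distrib_left hc.scale_right_distrib
        hc_scale_mult at_comp_simps(1,2) family_scale_simps mult.commute)
qed

lemma elementary_map_act:
  assumes m: "m \<in> perm_module n" and p': "p' \<in> {0, 1}" and h: "h \<in> hc_homogeneous p'"
  shows "elementary_map n \<kappa> \<mu> p z (family_act m h) =
    family_scale ((-1) ^ (p * p')) (family_act (elementary_map n \<kappa> \<mu> p z m) h)"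
  using perm_module_act[OF m, of h] m
  by (auto simp: elementary_map_def fun_simps family_act_def family_scale_def at_comp_def
      grade_inv_pow_hom grade_inv_pow_homogeneous[OF p' h] hc_scale_mult mult.assoc mult.commute)

lemma elementary_map_homogeneous:
  assumes p: "p \<in> {0, 1}" and zp: "z \<in> hc_homogeneous p"
  shows "elementary_map n \<kappa> \<mu> p z \<in> homogeneous_endos n p"
proof -
  have "elementary_map n \<kappa> \<mu> p z m \<in> module_homogeneous n ((p + p') mod 2)"
    if p': "p' \<in> {0, 1}" and m: "m \<in> module_homogeneous n p'" for p' m
  proof -
    have mm: "m \<in> perm_module n" and hom: "m \<mu> \<in> hc_homogeneous p'"
      using m by (auto simp: module_homogeneous_def)
    have less: "p < 2" "p' < 2" "(p + p') mod 2 < 2" using p p' by auto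
    have "elementary_map n \<kappa> \<mu> p z m \<kappa>' \<in> hc_homogeneous ((p + p') mod 2)" for \<kappa>'
      using zp hom mm
      by (auto simp: hc_homogeneous_iff less elementary_map_def at_comp_def grade_inv_hom
          grade_inv_pow_homogeneous[OF p' hom] hc_scale_mult minus_one_power_mod2 power_add ac_simps)
    then show ?thesis
      using linear_maps_mem[OF elementary_map_linear] by (simp add: module_homogeneous_def)
  qed
  then show ?thesis
    by (intro homogeneous_endosI elementary_map_linear elementary_map_act)
qed

lemma elementary_map_at_comp:
  assumes inv: "right_invariant \<mu> z" and \<nu>: "\<nu> \<in> compositions n CARD('r)"
  shows "elementary_map n \<kappa> \<mu> p z (at_comp \<nu> (x_comp \<nu> * h)) =
    (if \<nu> = \<mu> then at_comp \<kappa> (z * (grade_inv ^^ p) h) else 0)"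
proof -
  have "sum_list \<mu> = CARD('r)" using \<mu> by (simp add: compositions_def)
  from right_invariant_mult_x_comp[OF this inv] have "z * (x_comp \<mu> * h') = hc_scale (poincare \<mu>) (z * h')" for h'
    by (simp add: hc_scale_mult flip: mult.assoc)
  then show ?thesis
    using at_comp_perm_module[OF \<nu>, of h] poincare_neq_0
    by (auto simp: elementary_map_def at_comp_apply grade_inv_pow_hom at_comp_simps(4))
qed

end

lemma smats_compositions:
  assumes "A \<in> smats n r"
  shows "ro (total A) \<in> compositions n r" "co (total A) \<in> compositions n r"
  using smatsD(3,4)[OF assms]
  by (simp_all add: compositions_def length_ro length_co sum_list_ro sum_list_co)

lemma parity_01: "parity A \<in> {0, 1}"
  by (auto simp: parity_def)

lemma T_mat_homogeneous:
  "A \<in> smats n CARD('r) \<Longrightarrow> (T_mat A :: 'r hc) \<in> hc_homogeneous (parity A)"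
  using parity_01[of A] by (subst hc_homogeneous_iff) (auto simp: grade_inv_T_mat)

text \<open>Existence comes from the right invariance of T_A, uniqueness from testing on homogeneous
  multiples of the generators. From here on \<open>Phi\<close> is handled through this
  formula.\<close>

lemma Phi_eq_elementary_map:
  assumes A: "A \<in> smats n CARD('r)"
  shows "(Phi n A :: 'r endo) = elementary_map n (ro (total A)) (co (total A)) (parity A) (T_mat A)"
proof -
  let ?\<kappa> = "ro (total A)" and ?\<mu> = "co (total A)"
  let ?f = "elementary_map n ?\<kappa> ?\<mu> (parity A) (T_mat A) :: 'r endo"
  let ?P = "\<lambda>f :: 'r endo. f \<in> linear_maps n \<and>
    (\<forall>\<mu> \<in> compositions n CARD('r). \<forall>p \<in> {0, 1}. \<forall>w \<in> hc_homogeneous p.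
      f (at_comp \<mu> (x_comp \<mu> * w)) =
        (if \<mu> = ?\<mu>
         then family_scale ((-1) ^ (parity A * p)) (at_comp ?\<kappa> (T_mat A * w))
         else 0))"
  note C = smats_compositions[OF A]
  have "?P ?f"
    by (intro conjI ballI elementary_map_linear[OF C T_mat_range])
      (simp add: elementary_map_at_comp[OF C T_mat_range right_invariant_T_mat[OF A]]
        grade_inv_pow_homogeneous hc_scale_mult at_comp_simps(2))
  moreover have "f = ?f" if "?P f" for f
  proof (rule linear_maps_eqI)
    fix \<mu> p w
    assume *: "\<mu> \<in> compositions n CARD('r)" "p \<in> {0, 1 :: nat}" "w \<in> (hc_homogeneous p :: 'r hc set)"
    show "f (at_comp \<mu> (x_comp \<mu> * w)) = ?f (at_comp \<mu> (x_comp \<mu> * w))"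
      using conjunct2[OF that, rule_format, OF *] conjunct2[OF \<open>?P ?f\<close>, rule_format, OF *] by simp
  qed (use that \<open>?P ?f\<close> in blast)+
  ultimately show ?thesis unfolding Phi_def by (intro the_equality) blast+
qed

lemma Phi_homogeneous: "A \<in> smats n CARD('r) \<Longrightarrow> (Phi n A :: 'r endo) \<in> homogeneous_endos n (parity A)"
  unfolding Phi_eq_elementary_map
  by (intro elementary_map_homogeneous smats_compositions T_mat_range parity_01 T_mat_homogeneous)

definition Phi_span :: "nat \<Rightarrow> 'r endo set" where
  "Phi_span n = endo_span {Phi n A | A. A \<in> smats n CARD('r)}"

lemma Phi_span_linear: "Phi_span n \<subseteq> linear_maps n"
  unfolding Phi_span_def
  by (rule endo.span_minimal[OF _ subspace_linear_maps])
    (auto dest: Phi_homogeneous homogeneous_endos_linear)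

lemma homogeneous_endos_Phi_span:
  fixes f :: "'r endo"
  assumes p: "p \<in> {0, 1}" and f: "f \<in> homogeneous_endos n p"
  shows "f \<in> Phi_span n"
proof -
  let ?C = "compositions n CARD('r)"
  define z where "z \<kappa> \<mu> = f (at_comp \<mu> (x_comp \<mu>)) \<kappa>" for \<kappa> \<mu>
  have lin: "f \<in> linear_maps n" by (rule homogeneous_endos_linear[OF f])
  note act = homogeneous_endos_act[OF f]
  have gen: "at_comp \<mu> (x_comp \<mu> :: 'r hc) \<in> perm_module n" if "\<mu> \<in> ?C" for \<mu>
    using at_comp_perm_module[OF that, of 1] by simp
  have range: "z \<kappa> \<mu> \<in> range (\<lambda>h. x_comp \<kappa> * h)" if "\<kappa> \<in> ?C" for \<kappa> \<mu>
    using linear_maps_mem[OF lin, of "at_comp \<mu> (x_comp \<mu>)"] that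
    by (auto simp: z_def perm_module_iff)
  have invariant: "right_invariant \<mu> (z \<kappa> \<mu>)" if \<mu>: "\<mu> \<in> ?C" for \<kappa> \<mu>
    unfolding right_invariant_def
  proof (intro allI impI)
    fix i assume i: "same_block \<mu> i"
    have sum: "sum_list \<mu> = CARD('r)" using \<mu> by (simp add: compositions_def)
    \<comment> \<open>T_i is even, so it passes f without a sign whatever the parity of f.\<close>
    have "T_gen i \<in> (hc_homogeneous 0 :: 'r hc set)" by (simp add: hc_homogeneous_iff grade_inv_hom)
    from act[OF _ gen[OF \<mu>] this]
    have "family_act (f (at_comp \<mu> (x_comp \<mu>))) (T_gen i) = f (at_comp \<mu> (x_comp \<mu> * T_gen i))"
      by (simp add: at_comp_simps(3) family_scale_def)
    also have "\<dots> = family_scale qq (f (at_comp \<mu> (x_comp \<mu>)))"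
      by (simp add: x_comp_mult_T[OF sum i] at_comp_simps(2) linear_maps_scale[OF lin gen[OF \<mu>]])
    finally show "z \<kappa> \<mu> * T_gen i = hc_scale qq (z \<kappa> \<mu>)"
      unfolding z_def by (auto simp: family_act_def family_scale_def dest: fun_cong[where x = \<kappa>])
  qed
  have homog: "z \<kappa> \<mu> \<in> hc_homogeneous p" if \<mu>: "\<mu> \<in> ?C" for \<kappa> \<mu>
  proof -
    have "at_comp \<mu> (x_comp \<mu> :: 'r hc) \<in> module_homogeneous n 0"
      using gen[OF \<mu>] by (simp add: module_homogeneous_def at_comp_def hc_homogeneous_iff grade_inv_x_comp)
    from homogeneous_endos_mem[OF f _ this]
    have "f (at_comp \<mu> (x_comp \<mu>)) \<in> module_homogeneous n p" using p by auto
    then show ?thesis by (simp add: module_homogeneous_def z_def)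
  qed
  \<comment> \<open>The matrix coefficients of f, each turned back into a map between two components
    and added up.\<close>
  define g where "g = (\<Sum>\<mu>\<in>?C. \<Sum>\<kappa>\<in>?C. elementary_map n \<kappa> \<mu> p (z \<kappa> \<mu>))"
  have "elementary_map n \<kappa> \<mu> p (z \<kappa> \<mu>) \<in> Phi_span n" if \<kappa>: "\<kappa> \<in> ?C" and \<mu>: "\<mu> \<in> ?C" for \<kappa> \<mu>
  proof -
    let ?S = "{T_mat A :: 'r hc | A. A \<in> smats n CARD('r) \<and> ro (total A) = \<kappa> \<and> co (total A) = \<mu> \<and> parity A = p}"
    have "z \<kappa> \<mu> \<in> hc.span ?S"
      by (rule homogeneous_invariants_span[OF \<kappa> \<mu> range[OF \<kappa>] invariant[OF \<mu>] _ homog[OF \<mu>]])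
        (use p in auto)
    then have mem: "elementary_map n \<kappa> \<mu> p (z \<kappa> \<mu>) \<in> endo_span (elementary_map n \<kappa> \<mu> p ` ?S)"
      by (rule elementary_map_span)
    have "elementary_map n \<kappa> \<mu> p ` ?S \<subseteq> {Phi n A | A. A \<in> smats n CARD('r)}"
    proof
      fix e assume "e \<in> elementary_map n \<kappa> \<mu> p ` ?S"
      then obtain A where "A \<in> smats n CARD('r)"
        "e = elementary_map n (ro (total A)) (co (total A)) (parity A) (T_mat A)" by blast
      then show "e \<in> {Phi n A | A. A \<in> smats n CARD('r)}"
        by (intro CollectI exI[of _ A]) (simp add: Phi_eq_elementary_map)
    qed
    from subsetD[OF endo.span_mono[OF this] mem] show ?thesis unfolding Phi_span_def .
  qed
  then have g: "g \<in> Phi_span n"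
    unfolding g_def Phi_span_def by (intro endo.span_sum)
  have "f = g"
  proof (rule linear_maps_eqI[OF lin])
    show "g \<in> linear_maps n" using g Phi_span_linear by blast
    fix \<nu> p' w assume \<nu>: "\<nu> \<in> ?C" and p': "p' \<in> {0, 1 :: nat}" and w: "w \<in> (hc_homogeneous p' :: 'r hc set)"
    show "f (at_comp \<nu> (x_comp \<nu> * w)) = g (at_comp \<nu> (x_comp \<nu> * w))"
    proof
      fix \<kappa>'
      have "g (at_comp \<nu> (x_comp \<nu> * w)) \<kappa>' = (\<Sum>\<mu>\<in>?C. \<Sum>\<kappa>\<in>?C.
          (if \<nu> = \<mu> then at_comp \<kappa> (z \<kappa> \<mu> * (grade_inv ^^ p) w) else 0) \<kappa>')"
        unfolding g_def sum_fun_apply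
        by (intro sum.cong refl) (simp add: elementary_map_at_comp[OF _ _ range invariant \<nu>])
      also have "\<dots> = (\<Sum>\<mu>\<in>?C. if \<nu> = \<mu> then
          (\<Sum>\<kappa>\<in>?C. at_comp \<kappa> (z \<kappa> \<mu> * (grade_inv ^^ p) w) \<kappa>') else 0)"
        by (rule sum.cong) (auto simp: zero_fun_apply)
      also have "\<dots> = (\<Sum>\<kappa>\<in>?C. at_comp \<kappa> (z \<kappa> \<nu> * (grade_inv ^^ p) w) \<kappa>')"
        using \<nu> by (simp add: sum.delta)
      also have "\<dots> = (if \<kappa>' \<in> ?C then z \<kappa>' \<nu> * (grade_inv ^^ p) w else 0)"
        by (simp add: at_comp_apply sum.delta')
      \<comment> \<open>At indices that are not compositions the component of f vanishes, so the
        case distinction disappears.\<close>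
      also have "\<dots> = z \<kappa>' \<nu> * (grade_inv ^^ p) w"
        using linear_maps_mem[OF lin] by (auto simp: z_def perm_module_iff)
      also have "\<dots> = f (at_comp \<nu> (x_comp \<nu> * w)) \<kappa>'"
        using act[OF p' gen[OF \<nu>] w]
        by (simp add: z_def at_comp_simps(3) family_scale_def family_act_def hc_scale_mult
            grade_inv_pow_homogeneous[OF p' w])
      finally show "f (at_comp \<nu> (x_comp \<nu> * w)) \<kappa>' = g (at_comp \<nu> (x_comp \<nu> * w)) \<kappa>'" ..
    qed
  qed
  then show ?thesis using g by simp
qed

section \<open>The algebra as a span, and direct sums from projections\<close>

lemma twisted_schur_eq_Phi_span: "(twisted_schur n :: 'r endo set) = Phi_span n"
proof
  show "(twisted_schur n :: 'r endo set) \<subseteq> Phi_span n"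
    unfolding twisted_schur_def
    by (rule endo.span_minimal)
      (use homogeneous_endos_Phi_span[of 0] homogeneous_endos_Phi_span[of 1] in
        \<open>auto simp: Phi_span_def endo.subspace_span\<close>)
  show "(Phi_span n :: 'r endo set) \<subseteq> twisted_schur n"
    unfolding Phi_span_def twisted_schur_def
  proof (rule endo.span_mono, clarify)
    fix A assume A: "A \<in> smats n CARD('r)" "(Phi n A :: 'r endo) \<notin> homogeneous_endos n 1"
    then show "(Phi n A :: 'r endo) \<in> homogeneous_endos n 0"
      using Phi_homogeneous[OF A(1)] parity_01[of A] by auto
  qed
qed

text \<open>Linear maps \<pi> i that act on the generators as Kronecker deltas extract the
  components: \<pi> i f is the i-th component of f in any decomposition, which settles existence and
  uniqueness together.\<close>

lemma internal_direct_sum_spanI: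
  fixes \<pi> :: "'i \<Rightarrow> 'r endo \<Rightarrow> 'r endo"
  assumes I: "finite I" and W: "\<And>i. i \<in> I \<Longrightarrow> W i = endo_span (B i)"
    and V: "V = endo_span (\<Union>i\<in>I. B i)"
    and add: "\<And>i f g. \<pi> i (f + g) = \<pi> i f + \<pi> i g"
    and scale: "\<And>i a f. \<pi> i (endo_scale a f) = endo_scale a (\<pi> i f)"
    and base: "\<And>i j b. i \<in> I \<Longrightarrow> j \<in> I \<Longrightarrow> b \<in> B j \<Longrightarrow> \<pi> i b = (if i = j then b else 0)"
  shows "internal_direct_sum V I W"
proof -
  have zero: "\<pi> i 0 = 0" for i using scale[of i 0 0] by simp
  have \<pi>_sum: "\<pi> i (\<Sum>j\<in>J. f j) = (\<Sum>j\<in>J. \<pi> i (f j))" for i J and f :: "'i \<Rightarrow> 'r endo"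
    by (induction J rule: infinite_finite_induct) (simp_all add: zero add)
  have \<pi>_W: "\<pi> i w = (if i = j then w else 0)" if ij: "i \<in> I" "j \<in> I" and w: "w \<in> W j" for i j w
    using w unfolding W[OF ij(2)]
    by (induction rule: endo.span_induct_alt) (auto simp: zero add scale base[OF ij])
  have "\<pi> i f \<in> W i \<and> (\<Sum>j\<in>I. \<pi> j f) = f" if i: "i \<in> I" and f: "f \<in> V" for i f
    using f unfolding V
  proof (induction rule: endo.span_induct_alt)
    case base
    then show ?case by (simp add: zero W[OF i] endo.span_zero)
  next
    case (step c b g)
    then obtain j where j: "j \<in> I" "b \<in> B j" by blast
    have "(\<Sum>k\<in>I. \<pi> k b) = b" using base[OF _ j] j(1) I by simp
    moreover have "\<pi> i b \<in> W i"
      using base[OF i j] j by (auto simp: W[OF i] endo.span_zero endo.span_base)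
    ultimately show ?case
      using step.IH unfolding W[OF i] add scale
      by (simp add: sum.distrib endo.span_add endo.span_scale flip: endo.scale_sum_right)
  qed
  then have mem: "\<And>i f. i \<in> I \<Longrightarrow> f \<in> V \<Longrightarrow> \<pi> i f \<in> W i"
    and sum: "\<And>i f. i \<in> I \<Longrightarrow> f \<in> V \<Longrightarrow> (\<Sum>j\<in>I. \<pi> j f) = f" by blast+
  show ?thesis
    unfolding internal_direct_sum_def
  proof (intro conjI ballI)
    show "endo_subspace V" by (simp add: V)
    fix i assume i: "i \<in> I"
    show "endo_subspace (W i)" by (simp add: W[OF i])
    show "W i \<subseteq> V" unfolding W[OF i] V using i by (intro endo.span_mono) blast
  next
    fix f assume f: "f \<in> V"
    show "\<exists>!g. g \<in> (\<Pi>\<^sub>E i \<in> I. W i) \<and> f = (\<Sum>i \<in> I. g i)"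
    proof (rule ex1I)
      have "f = (\<Sum>i\<in>I. \<pi> i f)"
      \<comment> \<open>For an empty index set V is the span of nothing, that is 0; the fact
        \<open>sum\<close> speaks only once an index is at hand.\<close>
      proof (cases "I = {}")
        case True
        then show ?thesis using f by (simp add: V)
      qed (use sum f in fastforce)
      then show "restrict (\<lambda>i. \<pi> i f) I \<in> (\<Pi>\<^sub>E i \<in> I. W i) \<and> f = (\<Sum>i \<in> I. restrict (\<lambda>i. \<pi> i f) I i)"
        using mem f by simp
      fix g assume g: "g \<in> (\<Pi>\<^sub>E i \<in> I. W i) \<and> f = (\<Sum>i \<in> I. g i)"
      show "g = restrict (\<lambda>i. \<pi> i f) I"
      proof (rule extensionalityI[of _ I])
        show "g \<in> extensional I" using g by (simp add: PiE_def)
        fix i assume i: "i \<in> I"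
        have "\<pi> i f = (\<Sum>j\<in>I. \<pi> i (g j))" using g \<pi>_sum by simp
        also have "\<dots> = (\<Sum>j\<in>I. if i = j then g j else 0)"
          using \<pi>_W[OF i] PiE_mem[of g I W] g by (intro sum.cong) simp_all
        also have "\<dots> = g i" using i I by simp
        finally show "g i = restrict (\<lambda>i. \<pi> i f) I i" using i by simp
      qed simp
    qed
  qed (rule I)
qed

text \<open>Precomposition with the projection to the source component \<mu>. The membership test
  keeps the result zero outside the module, where \<open>at_comp \<mu> (m \<mu>)\<close> may still
  lie inside.\<close>

definition col_proj :: "nat \<Rightarrow> nat list \<Rightarrow> 'r endo \<Rightarrow> 'r endo" where
  "col_proj n \<mu> f = (\<lambda>m. if m \<in> perm_module n then f (at_comp \<mu> (m \<mu>)) else 0)"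

definition row_proj :: "nat list \<Rightarrow> 'r endo \<Rightarrow> 'r endo" where
  "row_proj \<kappa> f = (\<lambda>m. at_comp \<kappa> (f m \<kappa>))"

lemma col_proj_add: "col_proj n \<mu> (f + g) = col_proj n \<mu> f + col_proj n \<mu> g"
  and col_proj_scale: "col_proj n \<mu> (endo_scale a f) = endo_scale a (col_proj n \<mu> f)"
  by (auto simp: col_proj_def fun_simps endo_scale_def family_scale_def)

lemma row_proj_add: "row_proj \<kappa> (f + g) = row_proj \<kappa> f + row_proj \<kappa> g"
  and row_proj_scale: "row_proj \<kappa> (endo_scale a f) = endo_scale a (row_proj \<kappa> f)"
  by (auto simp: row_proj_def fun_simps endo_scale_def family_scale_def at_comp_def)

lemma endo_span_image:
  fixes \<pi> :: "'r endo \<Rightarrow> 'r endo"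
  assumes "f \<in> endo_span S" and V: "endo_subspace V"
    and add: "\<And>f g. \<pi> (f + g) = \<pi> f + \<pi> g"
    and scale: "\<And>a f. \<pi> (endo_scale a f) = endo_scale a (\<pi> f)"
    and base: "\<And>b. b \<in> S \<Longrightarrow> \<pi> b \<in> V"
  shows "\<pi> f \<in> V"
  using assms(1)
proof (induction rule: endo.span_induct_alt)
  case base
  show ?case using scale[of 0 0] endo.subspace_0[OF V] by simp
next
  case (step c x y)
  show ?case
    unfolding add scale
    by (intro endo.subspace_add[OF V] endo.subspace_scale[OF V] base[OF step(1)] step(2))
qed

lemma col_proj_Phi:
  assumes A: "A \<in> smats n CARD('r)"
  shows "col_proj n \<mu> (Phi n A :: 'r endo) = (if \<mu> = co (total A) then Phi n A else 0)"
  unfolding Phi_eq_elementary_map[OF A]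
  by (auto simp: fun_simps col_proj_def elementary_map_def at_comp_component_perm_module
      at_comp_apply grade_inv_pow_hom)

lemma row_proj_Phi:
  assumes A: "A \<in> smats n CARD('r)"
  shows "row_proj \<kappa> (Phi n A :: 'r endo) = (if \<kappa> = ro (total A) then Phi n A else 0)"
  unfolding Phi_eq_elementary_map[OF A]
  by (auto simp: fun_simps row_proj_def elementary_map_def at_comp_apply)

lemma col_part_subset: "(col_part n \<mu> :: 'r endo set) \<subseteq> Phi_span n"
  unfolding col_part_def Phi_span_def by (rule endo.span_mono) blast

lemma row_col_part_subset: "(row_col_part n \<mu> \<kappa> :: 'r endo set) \<subseteq> col_part n \<mu>"
  unfolding col_part_def row_col_part_def by (rule endo.span_mono) blast

lemma direct_sum_col_parts:
  "internal_direct_sum (twisted_schur n :: 'r endo set) (compositions n CARD('r)) (col_part n)"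
proof (rule internal_direct_sum_spanI[where \<pi> = "col_proj n"])
  have "{Phi n A :: 'r endo | A. A \<in> smats n CARD('r)} =
      (\<Union>\<mu> \<in> compositions n CARD('r). {Phi n A | A. A \<in> smats n CARD('r) \<and> co (total A) = \<mu>})"
    using smats_compositions(2) by blast
  then show "(twisted_schur n :: 'r endo set) =
      endo_span (\<Union>\<mu> \<in> compositions n CARD('r). {Phi n A | A. A \<in> smats n CARD('r) \<and> co (total A) = \<mu>})"
    by (simp only: twisted_schur_eq_Phi_span Phi_span_def)
qed (auto simp: col_part_def col_proj_add col_proj_scale col_proj_Phi)

lemma direct_sum_row_col_parts:
  "internal_direct_sum (col_part n \<mu> :: 'r endo set) (compositions n CARD('r)) (row_col_part n \<mu>)"
proof (rule internal_direct_sum_spanI[where \<pi> = row_proj])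
  have "{Phi n A :: 'r endo | A. A \<in> smats n CARD('r) \<and> co (total A) = \<mu>} =
      (\<Union>\<kappa> \<in> compositions n CARD('r).
        {Phi n A | A. A \<in> smats n CARD('r) \<and> ro (total A) = \<kappa> \<and> co (total A) = \<mu>})"
    using smats_compositions(1) by blast
  then show "(col_part n \<mu> :: 'r endo set) = endo_span (\<Union>\<kappa> \<in> compositions n CARD('r).
      {Phi n A | A. A \<in> smats n CARD('r) \<and> ro (total A) = \<kappa> \<and> co (total A) = \<mu>})"
    by (simp only: col_part_def)
qed (auto simp: row_col_part_def row_proj_add row_proj_scale row_proj_Phi)

section \<open>Stability under left multiplication\<close>

lemma homogeneous_endos_comp:
  fixes f g :: "'r endo"
  assumes p: "p \<in> {0, 1}" "p' \<in> {0, 1}" and f: "f \<in> homogeneous_endos n p" and g: "g \<in> homogeneous_endos n p'"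
  shows "f \<circ> g \<in> homogeneous_endos n ((p + p') mod 2)"
proof -
  note lf = homogeneous_endos_linear[OF f] and lg = homogeneous_endos_linear[OF g]
  have "f \<circ> g \<in> linear_maps n"
    unfolding linear_maps_def
    using linear_maps_mem[OF lf] linear_maps_mem[OF lg]
    by (auto simp: linear_maps_add[OF lf] linear_maps_add[OF lg] linear_maps_scale[OF lf]
        linear_maps_scale[OF lg] linear_maps_outside[OF lg] linear_maps_zero[OF lf])
  moreover have "(f \<circ> g) m \<in> module_homogeneous n (((p + p') mod 2 + k) mod 2)"
    if k: "k \<in> {0, 1}" and m: "m \<in> module_homogeneous n k" for k m
  proof -
    have "(p' + k) mod 2 \<in> {0, 1}" by auto
    from homogeneous_endos_mem[OF f this homogeneous_endos_mem[OF g k m]]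
    have "f (g m) \<in> module_homogeneous n ((p + (p' + k) mod 2) mod 2)" .
    then show ?thesis by (simp add: mod_simps add.assoc)
  qed
  moreover have "(f \<circ> g) (family_act m h) =
      family_scale ((-1) ^ ((p + p') mod 2 * k)) (family_act ((f \<circ> g) m) h)"
    if k: "k \<in> {0, 1}" and m: "m \<in> perm_module n" and h: "h \<in> hc_homogeneous k" for k m h
  proof -
    have "g (family_act m h) = family_scale ((-1) ^ (p' * k)) (family_act (g m) h)"
      by (rule homogeneous_endos_act[OF g k m h])
    moreover have "f (family_act (g m) h) = family_scale ((-1) ^ (p * k)) (family_act (f (g m)) h)"
      by (rule homogeneous_endos_act[OF f k linear_maps_mem[OF lg] h])
    moreover have "(-1 :: qv) ^ (p' * k) * (-1) ^ (p * k) = (-1) ^ ((p + p') mod 2 * k)"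
      using p k by auto
    ultimately show ?thesis
      by (simp add: linear_maps_scale[OF lf] perm_module_act linear_maps_mem[OF lg] family_scale_simps)
  qed
  ultimately show ?thesis by (rule homogeneous_endosI)
qed

text \<open>The projection acts on the source and G on the target; outside the module G 0 = 0 is
  used.\<close>

lemma col_proj_comp: "G \<in> linear_maps n \<Longrightarrow> col_proj n \<mu> (G \<circ> f) = G \<circ> col_proj n \<mu> f"
  by (auto simp: col_proj_def fun_simps linear_maps_zero)

lemma col_proj_Phi_span:
  assumes "(f :: 'r endo) \<in> Phi_span n"
  shows "col_proj n \<mu> f \<in> col_part n \<mu>"
  using assms unfolding Phi_span_def
proof (rule endo_span_image[where \<pi> = "col_proj n \<mu>", OF _ _ col_proj_add col_proj_scale])
  fix x :: "'r endo" assume "x \<in> {Phi n A | A. A \<in> smats n CARD('r)}"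
  then obtain A where A: "x = Phi n A" "A \<in> smats n CARD('r)" by blast
  show "col_proj n \<mu> x \<in> col_part n \<mu>"
  proof (cases "\<mu> = co (total A)")
    case True
    then show ?thesis
      using A unfolding col_part_def
      by (intro endo.span_base CollectI exI[of _ A]) (simp add: col_proj_Phi)
  qed (simp add: A col_proj_Phi col_part_def endo.span_zero)
qed (simp_all add: col_part_def)

text \<open>A composite of two \<open>Phi\<close> maps is a homogeneous endomorphism, hence lies in
  the span of all of them. The source projection to \<mu> fixes the right factor and therefore the
  composite, which puts it into the part of \<mu>; this takes the place of a multiplication
  formula.\<close>

lemma Phi_span_comp_col_part:
  assumes G: "(G :: 'r endo) \<in> Phi_span n" and f: "f \<in> col_part n \<mu>"
  shows "G \<circ> f \<in> col_part n \<mu>"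
proof -
  have Phi: "Phi n A \<circ> (Phi n A' :: 'r endo) \<in> col_part n \<mu>"
    if A: "A \<in> smats n CARD('r)" "A' \<in> smats n CARD('r)" "co (total A') = \<mu>" for A A'
  proof -
    have "Phi n A \<circ> (Phi n A' :: 'r endo) \<in> Phi_span n"
      by (rule homogeneous_endos_Phi_span[OF _ homogeneous_endos_comp[OF parity_01 parity_01
            Phi_homogeneous[OF A(1)] Phi_homogeneous[OF A(2)]]]) auto
    from col_proj_Phi_span[OF this, of \<mu>]
    show ?thesis
      using A col_proj_comp[OF homogeneous_endos_linear[OF Phi_homogeneous[OF A(1)]]]
      by (simp add: col_proj_Phi)
  qed
  have lin: "(f + g) \<circ> h = (f \<circ> h) + (g \<circ> h)" "endo_scale a f \<circ> h = endo_scale a (f \<circ> h)"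
    for f g h :: "'r endo" and a
    by (simp_all add: fun_simps endo_scale_def)
  have G_Phi: "G \<circ> Phi n A' \<in> col_part n \<mu>" if A': "A' \<in> smats n CARD('r)" "co (total A') = \<mu>" for A'
    using G unfolding Phi_span_def
  proof (rule endo_span_image[where \<pi> = "\<lambda>f. f \<circ> Phi n A'", OF _ _ lin])
    fix x :: "'r endo" assume "x \<in> {Phi n A | A. A \<in> smats n CARD('r)}"
    then obtain A where "A \<in> smats n CARD('r)" "x = Phi n A" by blast
    then show "x \<circ> Phi n A' \<in> col_part n \<mu>" using Phi A' by simp
  qed (simp add: col_part_def)
  have G_lin: "G \<in> linear_maps n" using G Phi_span_linear by blast
  \<comment> \<open>Membership in the span is carried along because G is known to be additive on the
    module only, so the values of both summands must be known to lie there.\<close>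
  have "f \<in> Phi_span n \<and> G \<circ> f \<in> endo_span {Phi n A | A. A \<in> smats n CARD('r) \<and> co (total A) = \<mu>}"
    using f unfolding col_part_def
  proof (induction rule: endo.span_induct_alt)
    case base
    have "G \<circ> 0 = (0 :: 'r endo)" using linear_maps_zero[OF G_lin] by (simp add: fun_simps)
    then show ?case by (simp only: endo.span_zero Phi_span_def simp_thms)
  next
    case (step c x y)
    then obtain A' where A': "x = Phi n A'" "A' \<in> smats n CARD('r)" "co (total A') = \<mu>" by blast
    have x: "x \<in> Phi_span n"
      unfolding Phi_span_def by (intro endo.span_base CollectI exI[of _ A']) (simp add: A')
    have "x m \<in> perm_module n" "y m \<in> perm_module n" for m
      using x step Phi_span_linear linear_maps_mem by blast+
    then have "G \<circ> (endo_scale c x + y) = endo_scale c (G \<circ> x) + (G \<circ> y)"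
      by (auto simp: fun_simps endo_scale_def linear_maps_add[OF G_lin] linear_maps_scale[OF G_lin]
          perm_module_scale)
    moreover have "endo_scale c x + y \<in> Phi_span n"
      using x step by (simp add: Phi_span_def endo.span_add endo.span_scale)
    moreover have "G \<circ> x \<in> endo_span {Phi n A | A. A \<in> smats n CARD('r) \<and> co (total A) = \<mu>}"
      using G_Phi A' by (simp add: col_part_def)
    ultimately show ?case using step.IH by (simp only: endo.span_add endo.span_scale)
  qed
  then show ?thesis by (simp add: col_part_def)
qed

section \<open>Images of the generators and the diagonal idempotents\<close>

lemma index_diag: "i < length \<kappa> \<Longrightarrow> j < length \<kappa> \<Longrightarrow> diag \<kappa> $$ (i, j) = (if i = j then \<kappa> ! i else 0)"
  by (auto simp: diag_def mat_diag_def)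

lemma diag_carrier: "length \<kappa> = n \<Longrightarrow> diag \<kappa> \<in> carrier_mat n n"
  by (auto simp: diag_def mat_diag_def)

lemma index_matrix_unit:
  "a < n \<Longrightarrow> b < n \<Longrightarrow> matrix_unit n i j $$ (a, b) = (if a = i then if b = j then 1 else 0 else 0)"
  by (simp add: matrix_unit_def)

lemma matrix_unit_carrier: "matrix_unit n i j \<in> carrier_mat n n"
  by (simp add: matrix_unit_def)

lemma entry_sum_diag: "entry_sum (diag \<kappa>) = sum_list \<kappa>"
  using diag_carrier[of \<kappa>, OF refl]
  by (auto simp: entry_sum_def index_diag sum_list_sum_nth atLeast0LessThan)

lemma entry_sum_diag_matrix_unit:
  assumes "length \<kappa> = n" "i < n" "j < n"
  shows "entry_sum (diag \<kappa> + matrix_unit n i j) = Suc (sum_list \<kappa>)"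
proof -
  note D = diag_carrier[OF assms(1)] matrix_unit_carrier[of n i j]
  have "(\<Sum>a<n. \<Sum>b<n. matrix_unit n i j $$ (a, b)) = (\<Sum>a<n. if a = i then 1 else 0)"
    by (rule sum.cong) (use assms in \<open>simp_all add: index_matrix_unit\<close>)
  then have "(\<Sum>a<n. \<Sum>b<n. matrix_unit n i j $$ (a, b)) = 1" using assms by simp
  moreover have "entry_sum (diag \<kappa> + matrix_unit n i j) =
      entry_sum (diag \<kappa>) + (\<Sum>a<n. \<Sum>b<n. matrix_unit n i j $$ (a, b))"
    using D by (auto simp: entry_sum_def sum.distrib)
  ultimately show ?thesis by (simp add: entry_sum_diag)
qed

lemma generator_smats:
  assumes "\<kappa> \<in> compositions n (r - 1)" "r \<ge> 1" "i < n" "j < n"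
  shows "(diag \<kappa>, matrix_unit n i j) \<in> smats n r" "(diag \<kappa> + matrix_unit n i j, 0\<^sub>m n n) \<in> smats n r"
  using assms entry_sum_diag_matrix_unit[of \<kappa> n i j] diag_carrier[of \<kappa> n] matrix_unit_carrier[of n i j]
  by (auto simp: smats_def compositions_def elements_mat_def matrix_unit_def)

lemma diag_smats: "\<kappa> \<in> compositions n r \<Longrightarrow> (diag \<kappa>, 0\<^sub>m n n) \<in> smats n r"
  using diag_carrier[of \<kappa> n] entry_sum_diag[of \<kappa>]
  by (auto simp: smats_def compositions_def elements_mat_def)

lemma Phi_norm_Phi_span: "A \<in> smats n CARD('r) \<Longrightarrow> (Phi_norm n A :: 'r endo) \<in> Phi_span n"
  unfolding Phi_norm_def Phi_span_def by (intro endo.span_scale endo.span_base) blast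

lemma diag_sum_Phi_span:
  "(\<Sum>\<kappa> \<in> compositions n CARD('r). endo_scale (a \<kappa>) (Phi_norm n (diag \<kappa>, 0\<^sub>m n n)) :: 'r endo) \<in> Phi_span n"
  using Phi_norm_Phi_span[OF diag_smats] unfolding Phi_span_def
  by (intro endo.span_sum endo.span_scale) blast

lemma uv_image_Phi_span:
  assumes "g \<in> uv_gens n" "CARD('r::finite) \<ge> 1"
  shows "(uv_image n g :: 'r endo) \<in> Phi_span n"
proof -
  have uv_sum: "(uv_sum n M :: 'r endo) \<in> Phi_span n"
    if "\<And>\<kappa>. \<kappa> \<in> compositions n (CARD('r) - 1) \<Longrightarrow> M \<kappa> \<in> smats n CARD('r)" for M
    using that Phi_norm_Phi_span unfolding uv_sum_def Phi_span_def by (intro endo.span_sum) blast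
  show ?thesis
    using assms(1) by (auto simp: uv_gens_def intro!: diag_sum_Phi_span uv_sum generator_smats assms(2))
qed

lemma uv_submodule_col_part:
  assumes "CARD('r::finite) \<ge> 1"
  shows "uv_submodule n (col_part n \<mu> :: 'r endo set)"
  unfolding uv_submodule_def twisted_schur_eq_Phi_span
  using col_part_subset Phi_span_comp_col_part[OF uv_image_Phi_span[OF _ assms]]
  by (auto simp: col_part_def endo.subspace_span)

lemma ro_diag: "ro (diag \<kappa>) = \<kappa>" and co_diag: "co (diag \<kappa>) = \<kappa>"
  using diag_carrier[of \<kappa>, OF refl]
  by (auto intro!: nth_equalityI simp: length_ro length_co nth_ro nth_co index_diag)

text \<open>For a diagonal matrix d is the identity, the column reading is \<kappa> padded with
  zeros, so that S_\<nu> = S_\<kappa>, and there are no Clifford factors. Multiplied by P_\<kappa>,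
  both sides become x_\<kappa> x_\<kappa>.\<close>

lemma T_mat_diag:
  assumes \<kappa>: "\<kappa> \<in> compositions n CARD('r)"
  shows "(T_mat (diag \<kappa>, 0\<^sub>m n n) :: 'r hc) = x_comp \<kappa>"
proof -
  let ?A = "(diag \<kappa>, 0\<^sub>m n n) :: smat"
  have len: "length \<kappa> = n" and sum: "sum_list \<kappa> = CARD('r)" using \<kappa> by (simp_all add: compositions_def)
  note D = diag_carrier[OF len]
  have total: "total ?A = diag \<kappa>" using D by auto
  have blk: "block \<kappa> i \<inter> block \<kappa> j = (if i = j then block \<kappa> i else {})" for i j
    using block_unique by auto
  have d: "d_mat (diag \<kappa>) = id"
  proof (rule d_mat_eqI[OF D])
    show "doubly_reduced (ro (diag \<kappa>)) (co (diag \<kappa>)) id"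
      by (simp add: doubly_reduced_def ro_diag co_diag permutes_id)
    show "has_counts n (diag \<kappa>) id"
      unfolding has_counts_def[OF D] ro_diag co_diag by (auto simp: blk index_diag len card_block)
  qed
  have "young \<kappa> \<subseteq> young (nu (diag \<kappa>))"
  proof
    fix w assume w: "w \<in> young \<kappa>"
    have "w ` block (nu (diag \<kappa>)) k = block (nu (diag \<kappa>)) k" if k: "k < n * n" for k
    proof -
      note ij = mod_div_less_square[OF k]
      have "block (nu (diag \<kappa>)) ((k div n) * n + k mod n) = block \<kappa> (k div n) \<inter> block \<kappa> (k mod n)"
        unfolding block_nu_eq_fibre[OF D ij] by (auto simp: d ro_diag co_diag)
      then have "block (nu (diag \<kappa>)) k = (if k div n = k mod n then block \<kappa> (k div n) else {})"
        by (simp add: blk)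
      then show ?thesis using w ij len by (simp add: young_def)
    qed
    then show "w \<in> young (nu (diag \<kappa>))"
      using w by (simp add: young_def length_nu[OF D] sum_list_nu[OF D] entry_sum_diag)
  qed
  then have "young (nu (diag \<kappa>)) = young \<kappa>"
    using young_nu_subset[OF D] co_diag by auto
  then have P: "poincare (nu (diag \<kappa>)) = poincare \<kappa>"
    by (simp add: poincare_def sum_list_nu[OF D] entry_sum_diag)
  have "nu (0\<^sub>m n n :: nat mat) ! k = 0" if k: "k < n * n" for k
  proof -
    note ij = mod_div_less_square[OF k]
    show ?thesis using nth_nu[of "0\<^sub>m n n" n, OF _ ij] ij by simp
  qed
  then have odd: "odd_blocks ?A = []"
    unfolding odd_blocks_def total by (simp add: length_nu[OF D] filter_empty_conv)
  have "hc_scale (poincare \<kappa>) (T_mat ?A :: 'r hc) = x_comp \<kappa> * x_comp \<kappa>"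
    using poincare_T_mat[OF diag_smats[OF \<kappa>]] unfolding total by (simp add: P odd d ro_diag co_diag)
  also have "\<dots> = hc_scale (poincare \<kappa>) (x_comp \<kappa>)"
    by (rule right_invariant_mult_x_comp[OF sum right_invariant_x_comp[OF sum]])
  finally show ?thesis using poincare_neq_0 by simp
qed

text \<open>A nonzero term of the first sum needs i = j and k = l, and then i \<ge> k contradicts j
  < l; the second sum vanishes with the odd part. So the normalising power of v is 1 here.\<close>

lemma twist_diag: "twist (diag \<kappa>, 0\<^sub>m (length \<kappa>) (length \<kappa>)) = 0"
proof -
  have "total (diag \<kappa>, 0\<^sub>m (length \<kappa>) (length \<kappa>)) = diag \<kappa>"
    using diag_carrier[of \<kappa>, OF refl] by auto
  then show ?thesis
    using diag_carrier[of \<kappa>, OF refl]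
    by (auto simp: twist_def Let_def index_diag intro!: sum.neutral)
qed

text \<open>Left multiplication by P_\<kappa>^-1 x_\<kappa> is the identity on x_\<kappa> H, so the
  diagonal elements are the idempotents projecting to single components.\<close>

lemma Phi_norm_diag:
  assumes \<kappa>: "\<kappa> \<in> compositions n CARD('r)"
  shows "(Phi_norm n (diag \<kappa>, 0\<^sub>m n n) :: 'r endo) =
    (\<lambda>m. if m \<in> perm_module n then at_comp \<kappa> (m \<kappa>) else 0)"
proof -
  let ?A = "(diag \<kappa>, 0\<^sub>m n n) :: smat"
  have len: "length \<kappa> = n" and sum: "sum_list \<kappa> = CARD('r)" using \<kappa> by (simp_all add: compositions_def)
  have total: "total ?A = diag \<kappa>" using diag_carrier[OF len] by auto
  have "hc_scale (1 / poincare \<kappa>) (x_comp \<kappa> * m \<kappa>) = m \<kappa>" if m: "m \<in> perm_module n" for m :: "'r family"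
  proof -
    obtain h where "m \<kappa> = x_comp \<kappa> * h" using m \<kappa> by (auto simp: perm_module_iff)
    moreover have "(x_comp \<kappa> :: 'r hc) * x_comp \<kappa> = hc_scale (poincare \<kappa>) (x_comp \<kappa>)"
      by (rule right_invariant_mult_x_comp[OF sum right_invariant_x_comp[OF sum]])
    ultimately show ?thesis using poincare_neq_0 by (simp add: hc_scale_mult flip: mult.assoc)
  qed
  moreover have "parity ?A = 0" by (simp add: parity_def entry_sum_def)
  ultimately show ?thesis
    using twist_diag[of \<kappa>] len
    unfolding Phi_norm_def Phi_eq_elementary_map[OF diag_smats[OF \<kappa>]] T_mat_diag[OF \<kappa>] total
    by (auto simp: fun_simps elementary_map_def ro_diag co_diag)
qed

lemma uv_image_UK_apply:
  fixes m :: "'r family"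
  assumes m: "m \<in> perm_module n" and \<kappa>: "\<kappa> \<in> compositions n CARD('r)"
  shows "uv_image n (UK 1 i) m \<kappa> = hc_scale (vv ^ (\<kappa> ! i)) (m \<kappa>)"
proof -
  have "uv_image n (UK 1 i) m \<kappa> = (\<Sum>\<nu> \<in> compositions n CARD('r).
      endo_scale (vv powi (1 * int (\<nu> ! i))) (Phi_norm n (diag \<nu>, 0\<^sub>m n n)) m \<kappa>)"
    by (simp add: sum_fun_apply)
  also have "\<dots> = (\<Sum>\<nu> \<in> compositions n CARD('r). if \<nu> = \<kappa> then hc_scale (vv ^ (\<nu> ! i)) (m \<nu>) else 0)"
    using m by (intro sum.cong)
      (auto simp: Phi_norm_diag endo_scale_def family_scale_def at_comp_apply)
  also have "\<dots> = hc_scale (vv ^ (\<kappa> ! i)) (m \<kappa>)" using \<kappa> by simp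
  finally show ?thesis .
qed

section \<open>Weight spaces\<close>

lemma row_proj_row_col_part:
  assumes "(f :: 'r endo) \<in> row_col_part n \<mu> \<kappa>"
  shows "row_proj \<kappa> f = f"
  using assms unfolding row_col_part_def
  by (induction rule: endo.span_induct_alt)
    (auto simp: row_proj_add row_proj_scale row_proj_Phi, simp add: row_proj_def at_comp_simps(4) fun_simps)

lemma row_proj_col_part:
  assumes "(f :: 'r endo) \<in> col_part n \<mu>"
  shows "row_proj \<kappa> f \<in> row_col_part n \<mu> \<kappa>"
  using assms unfolding col_part_def
proof (rule endo_span_image[where \<pi> = "row_proj \<kappa>", OF _ _ row_proj_add row_proj_scale])
  fix x :: "'r endo" assume "x \<in> {Phi n A | A. A \<in> smats n CARD('r) \<and> co (total A) = \<mu>}"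
  then obtain A where A: "x = Phi n A" "A \<in> smats n CARD('r)" "co (total A) = \<mu>" by blast
  show "row_proj \<kappa> x \<in> row_col_part n \<mu> \<kappa>"
  proof (cases "\<kappa> = ro (total A)")
    case True
    then show ?thesis
      using A unfolding row_col_part_def
      by (intro endo.span_base CollectI exI[of _ A]) (simp add: row_proj_Phi)
  qed (simp add: A row_proj_Phi row_col_part_def endo.span_zero)
qed (simp_all add: row_col_part_def)

text \<open>Powers of an indeterminate are told apart by their degrees; this is what keeps distinct
  weights distinct.\<close>

lemma vv_power_inject: "vv ^ a = vv ^ b \<longleftrightarrow> a = b"
proof
  assume "vv ^ a = vv ^ b"
  then have "[:0, 1 :: rat:] ^ a = [:0, 1:] ^ b" by (simp add: vv_power eq_fract)
  then have "degree ([:0, 1 :: rat:] ^ a) = degree ([:0, 1 :: rat:] ^ b)" by simp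
  then show "a = b" by (simp add: degree_power_eq)
qed simp

text \<open>Both sides say that all values of f are concentrated in component \<kappa>, which in
  turn means that \<open>row_proj \<kappa>\<close> fixes f; this projection maps the part of \<mu>
  into the smaller span.\<close>

lemma row_col_part_eq_weight_space:
  assumes \<kappa>: "\<kappa> \<in> compositions n CARD('r)"
  shows "(row_col_part n \<mu> \<kappa> :: 'r endo set) = weight_space n (col_part n \<mu>) (\<lambda>i. vv ^ (\<kappa> ! i))"
proof (intro equalityI subsetI)
  fix f :: "'r endo" assume f: "f \<in> row_col_part n \<mu> \<kappa>"
  then have col: "f \<in> col_part n \<mu>" using row_col_part_subset by blast
  then have lin: "f \<in> linear_maps n" using col_part_subset Phi_span_linear by blast
  have "uv_image n (UK 1 i) (f m) \<nu> = hc_scale (vv ^ (\<kappa> ! i)) (f m \<nu>)" for i m \<nu>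
  proof (cases "\<nu> \<in> compositions n CARD('r)")
    case True
    have "f m = at_comp \<kappa> (f m \<kappa>)"
      using fun_cong[OF row_proj_row_col_part[OF f], of m] by (simp add: row_proj_def)
    then have "f m \<nu> = 0" if "\<nu> \<noteq> \<kappa>" using that by (metis at_comp_apply)
    then show ?thesis
      using uv_image_UK_apply[OF linear_maps_mem[OF lin] True] by (cases "\<nu> = \<kappa>") simp_all
  next
    case False
    \<comment> \<open>Values of K_i and of f lie in the module, so at an index that is not a
      composition both sides are zero.\<close>
    have K: "(uv_image n (UK 1 i) :: 'r endo) \<in> linear_maps n"
      unfolding uv_image.simps by (rule subsetD[OF Phi_span_linear diag_sum_Phi_span])
    show ?thesis
      using linear_maps_mem[OF K, of "f m"] linear_maps_mem[OF lin, of m] False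
      unfolding perm_module_iff by (metis hc.scale_zero_right)
  qed
  then show "f \<in> weight_space n (col_part n \<mu>) (\<lambda>i. vv ^ (\<kappa> ! i))"
    using col by (simp add: weight_space_def fun_simps endo_scale_def family_scale_def del: uv_image.simps)
next
  fix f :: "'r endo" assume f: "f \<in> weight_space n (col_part n \<mu>) (\<lambda>i. vv ^ (\<kappa> ! i))"
  then have col: "f \<in> col_part n \<mu>"
    and K: "\<And>i. i < n \<Longrightarrow> uv_image n (UK 1 i) \<circ> f = endo_scale (vv ^ (\<kappa> ! i)) f"
    by (simp_all add: weight_space_def del: uv_image.simps)
  have lin: "f \<in> linear_maps n" using col col_part_subset Phi_span_linear by blast
  have "f m \<nu> = 0" if \<nu>: "\<nu> \<noteq> \<kappa>" for m \<nu>
  proof (cases "\<nu> \<in> compositions n CARD('r)")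
    case True
    \<comment> \<open>Distinct compositions of the same length differ at some position, and there
      the two eigenvalues of K_i differ.\<close>
    then obtain i where i: "i < n" "\<nu> ! i \<noteq> \<kappa> ! i"
      using \<kappa> \<nu> by (auto simp: compositions_def list_eq_iff_nth_eq)
    have "uv_image n (UK 1 i) (f m) \<nu> = hc_scale (vv ^ (\<kappa> ! i)) (f m \<nu>)"
      using fun_cong[OF fun_cong[OF K[OF i(1)]], of m \<nu>]
      by (simp add: endo_scale_def family_scale_def del: uv_image.simps)
    then have "hc_scale (vv ^ (\<nu> ! i)) (f m \<nu>) = hc_scale (vv ^ (\<kappa> ! i)) (f m \<nu>)"
      using uv_image_UK_apply[OF linear_maps_mem[OF lin] True] by metis
    then show ?thesis using i(2) vv_power_inject by simp
  qed (use linear_maps_mem[OF lin, of m] in \<open>simp add: perm_module_iff\<close>)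
  then have "row_proj \<kappa> f = f"
    by (auto simp: row_proj_def fun_simps at_comp_apply)
  then show "f \<in> row_col_part n \<mu> \<kappa>" using row_proj_col_part[OF col, of \<kappa>] by simp
qed

theorem proposition4p6:
  fixes n :: nat
  assumes "n \<ge> 2" and "CARD('r::finite) \<ge> 2"
  shows "internal_direct_sum (twisted_schur n :: 'r endo set)
      (compositions n CARD('r)) (col_part n) \<and>
    (\<forall>\<mu> \<in> compositions n CARD('r).
      uv_submodule n (col_part n \<mu> :: 'r endo set) \<and>
      internal_direct_sum (col_part n \<mu> :: 'r endo set)
        (compositions n CARD('r)) (row_col_part n \<mu>) \<and>
      (\<forall>\<kappa> \<in> compositions n CARD('r).
        (row_col_part n \<mu> \<kappa> :: 'r endo set) =
          weight_space n (col_part n \<mu>) (\<lambda>i. vv ^ (\<kappa> ! i))))"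
proof -
  have "CARD('r) \<ge> 1" using assms(2) by simp
  then show ?thesis
    by (intro conjI ballI direct_sum_col_parts direct_sum_row_col_parts uv_submodule_col_part
        row_col_part_eq_weight_space)
qed

end
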